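(* For each pair $(\alpha,p_\alpha)$ in the following list, every prime $p>p_\alpha$ satisfies $g(p)<p^\alpha$: $(0.62,\,1.91\times10^{23})$, $(0.615,\,1.97\times10^{24})$, $(0.61,\,2.47\times10^{25})$, $(0.605,\,4.00\times10^{26})$, $(0.6,\,8.52\times10^{27})$, $(0.595,\,2.53\times10^{29})$, $(0.59,\,1.09\times10^{31})$, $(0.585,\,7.24\times10^{32})$, $(0.58,\,8.21\times10^{34})$, $(0.575,\,1.77\times10^{37})$, $(0.57,\,7.98\times10^{39})$, $(0.565,\,9.42\times10^{42})$, $(0.56,\,3.57\times10^{46})$, $(0.555,\,6.08\times10^{50})$, $(0.55,\,7.27\times10^{55})$.
   Context: For a prime $p$, $g(p)$ denotes the least positive integer that is a primitive root modulo $p$, i.e. whose residue class generates the cyclic group $(\mathbb{Z}/p\mathbb{Z})^\times$. *)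

theory Defs
  imports "HOL-Number_Theory.Number_Theory" Complex_Main
begin

definition least_primroot :: "nat \<Rightarrow> nat" where
  "least_primroot p = (LEAST g. g > 0 \<and> residue_primroot p g)"

end

theory Submission
  imports Defs "HOL-Computational_Algebra.Polynomial" "HOL-Library.FuncSet"
begin

text \<open>
  All the thresholds satisfy \<open>p\<^sub>\<alpha> powr (\<alpha> - 1/2) > 620\<close>, so it is enough to find a primitive root below
  \<open>620 * sqrt p\<close> for every prime \<open>p \<ge> 1.91 * 10^23\<close>.  Let \<open>s + k\<close> be the number of primes dividing \<open>p - 1\<close>.
  Sieving exactly by the \<open>k\<close> smallest of them and with a union bound by the other \<open>s\<close>, whose reciprocals add up
  to \<open>1 - \<delta>\<close>, an interval without primitive roots forces a character sum to be large; the \<open>L\<^sup>1\<close> norm of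
  the sieve weights, relative to their mean, is \<open>C = 2^k * (s / \<delta> + 1)\<close>.

  If \<open>p - 1\<close> has at most 19 prime factors, a smoothed Polya-Vinogradov inequality suffices.  For \<open>p\<close> congruent
  to 1 modulo 4 all characters involved are even and a window centred at 0 can be used; otherwise even and odd
  characters occur with equal weight, and \<open>\<bar>cos\<bar> + \<bar>sin\<bar> \<le> sqrt 2\<close> replaces the trivial bound 2.

  If there are at least 20 prime factors, the Burgess argument with fourth moments is used: \<open>q * (x + b)\<close> is
  close to a multiple of \<open>p\<close> for all \<open>b < h\<close> whenever \<open>x\<close> is slightly to the right of \<open>t * p / q\<close>.  The sieve
  weights only see averages of the fourth moments over the characters of order dividing some \<open>D\<close>.  Such an
  average counts the \<open>x\<close> for which a ratio of two quadratic polynomials is a \<open>D\<close>-th power residue, and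
  Stepanov's auxiliary polynomial bounds this count by \<open>p / D + 4.9 * sqrt p\<close> without leaving the prime field.
\<close>

section \<open>Integer polynomials modulo a prime\<close>

text \<open>The cut at 20 prime factors is forced from both sides. With three primes sieved exactly,
  19 prime factors give \<open>C\<close> at most 428.4, while 20 give about 476. For p congruent to
  3 modulo 4 the Polya-Vinogradov argument needs \<open>C * sqrt 2 / 2\<close> below 310, which
  holds for the first value and fails for the second. The Burgess argument essentially needs
  \<open>C ^ 4 < 15900 * sqrt (0.6 * sqrt p)\<close>, so it pays off only for large p: 20 prime
  factors force p to be at least 5 * 10^26, which is enough, whereas the product of the first 19
  primes is too small. With more factors the growth of the product of primes outweighs that of
  \<open>C\<close>. All values of \<open>p_\<alpha> powr (\<alpha> - 1/2)\<close> lie between 620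
  and 623, so little is lost by treating all pairs through one bound. Polynomials stay over the
  integers, and divisibility by the constant polynomial \<open>[:p:]\<close> stands for equality
  over the prime field. Ordinary derivatives can measure orders of vanishing there because these
  orders never exceed p.\<close>

lemma prime_const_poly_dvd_mult:
  fixes P Q :: "int poly"
  assumes "prime c" "[:c:] dvd P * Q"
  shows "[:c:] dvd P \<or> [:c:] dvd Q"
proof -
  have "prime_elem [:c:]" using prime_imp_prime_elem[OF assms(1)] by (simp add: prime_elem_const_poly_iff)
  thus ?thesis using assms(2) by (rule prime_elem_dvd_multD)
qed

lemma const_poly_dvd_imp_dvd_poly:
  fixes P :: "int poly"
  assumes "[:c:] dvd P"
  shows "c dvd poly P a"
proof -
  from assms obtain Q where "P = [:c:] * Q" by (elim dvdE)
  thus ?thesis by simp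
qed

lemma linear_factor_mod:
  fixes G :: "int poly"
  assumes "c dvd poly G a"
  shows "\<exists>G'. [:c:] dvd (G - [:-a, 1:] * G')"
proof -
  have "[:-a, 1:] dvd (G - [:poly G a:])" by (subst poly_eq_0_iff_dvd[symmetric]) simp
  then obtain G' where G': "G - [:poly G a:] = [:-a, 1:] * G'" by (elim dvdE)
  have "G - [:-a, 1:] * G' = [:poly G a:]" using G' by (simp add: algebra_simps)
  moreover have "[:c:] dvd [:poly G a:]" using assms by simp
  ultimately show ?thesis by metis
qed

lemma const_poly_not_dvd_monic:
  fixes P :: "int poly"
  assumes "prime c" "lead_coeff P = 1"
  shows "\<not> [:c:] dvd P"
proof
  assume "[:c:] dvd P"
  hence "c dvd lead_coeff P" by (simp add: const_poly_dvd_iff)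
  thus False using assms by (simp add: not_prime_unit)
qed

lemma dvd_diff_trans:
  fixes a b c d :: "'a :: comm_ring_1"
  assumes "d dvd a - b" "d dvd b - c"
  shows "d dvd a - c"
  using dvd_add[OF assms] by simp

text \<open>Over the field with \<open>c\<close> elements the linear powers are pairwise coprime. In
  the induction step the product \<open>W\<close> over the old points is a unit at the new point
  \<open>b\<close>, so the whole order of vanishing of \<Psi> at \<open>b\<close> passes to the
  cofactor \<open>G\<close>.\<close>

lemma mod_product_of_linear_powers:
  fixes \<Psi> :: "int poly" and S :: "int set"
  assumes c: "prime c" and S: "finite S" "\<And>a b. a \<in> S \<Longrightarrow> b \<in> S \<Longrightarrow> a \<noteq> b \<Longrightarrow> \<not> c dvd (a - b)"
    and ord: "\<And>a. a \<in> S \<Longrightarrow> \<exists>G. [:c:] dvd (\<Psi> - [:-a, 1:] ^ M * G)"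
  shows "\<exists>G. [:c:] dvd (\<Psi> - (\<Prod>a\<in>S. [:-a, 1:] ^ M) * G)"
  using S ord
proof (induction S rule: finite_induct)
  case empty
  show ?case by (rule exI[of _ \<Psi>]) simp
next
  case (insert b S)
  define W where "W = (\<Prod>a\<in>S. [:-a, 1::int:] ^ M)"
  from insert obtain G where G: "[:c:] dvd (\<Psi> - W * G)" unfolding W_def by auto
  from insert obtain H where H: "[:c:] dvd (\<Psi> - [:-b, 1:] ^ M * H)" by blast
  have Wb: "\<not> c dvd poly W b"
  proof
    assume "c dvd poly W b"
    hence "c dvd (\<Prod>a\<in>S. (b - a) ^ M)" by (simp add: W_def poly_prod)
    then obtain a where "a \<in> S" "c dvd (b - a) ^ M"
      using c insert.hyps(1) by (auto simp: prime_dvd_prod_iff)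
    hence "c dvd b - a" using c prime_dvd_power by blast
    moreover have "a \<noteq> b" using \<open>a \<in> S\<close> insert.hyps by auto
    ultimately show False using insert.prems(1)[of b a] \<open>a \<in> S\<close> by auto
  qed
  \<comment> \<open>Linear factors of \<open>G\<close> are split off one at a time: after cancelling
    the monic power, \<open>W\<close> times the cofactor must vanish at \<open>b\<close>.\<close>
  have "\<exists>G'. [:c:] dvd (G - [:-b, 1:] ^ j * G')" if "j \<le> M" for j
    using that
  proof (induction j)
    case 0
    show ?case by (rule exI[of _ G]) simp
  next
    case (Suc j)
    then obtain G' where G': "[:c:] dvd (G - [:-b, 1:] ^ j * G')" by auto
    have "[:c:] dvd (W * (G - [:-b, 1:] ^ j * G'))" using G' by simp
    with G have "[:c:] dvd ((\<Psi> - W * G) + W * (G - [:-b, 1:] ^ j * G'))" by (rule dvd_add)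
    from dvd_diff[OF H this]
    have "[:c:] dvd (W * ([:-b, 1:] ^ j * G') - [:-b, 1:] ^ M * H)" by (simp add: algebra_simps)
    also have "[:-b, 1:] ^ M = [:-b, 1::int:] ^ j * [:-b, 1:] ^ (M - j)"
      using Suc.prems by (simp flip: power_add)
    finally have "[:c:] dvd [:-b, 1:] ^ j * (W * G' - [:-b, 1:] ^ (M - j) * H)"
      by (simp only: algebra_simps)
    moreover have "\<not> [:c:] dvd [:-b, 1::int:] ^ j"
      by (rule const_poly_not_dvd_monic[OF c]) (simp add: lead_coeff_power)
    ultimately have "[:c:] dvd (W * G' - [:-b, 1:] ^ (M - j) * H)"
      using prime_const_poly_dvd_mult[OF c] by blast
    hence "c dvd poly (W * G' - [:-b, 1:] ^ (M - j) * H) b" by (rule const_poly_dvd_imp_dvd_poly)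
    hence "c dvd poly W b * poly G' b" using Suc.prems by (simp add: zero_power)
    hence "c dvd poly G' b" using Wb c by (simp add: prime_dvd_mult_iff)
    then obtain G'' where "[:c:] dvd (G' - [:-b, 1:] * G'')" using linear_factor_mod by blast
    hence "[:c:] dvd [:-b, 1:] ^ j * (G' - [:-b, 1:] * G'')" by simp
    from dvd_add[OF G' this] have "[:c:] dvd (G - [:-b, 1:] ^ Suc j * G'')"
      by (simp add: algebra_simps)
    thus ?case by blast
  qed
  then obtain G' where "[:c:] dvd (G - [:-b, 1:] ^ M * G')" by blast
  hence "[:c:] dvd W * (G - [:-b, 1:] ^ M * G')" by simp
  from dvd_add[OF G this] have "[:c:] dvd (\<Psi> - ([:-b, 1:] ^ M * W) * G')"
    by (simp add: algebra_simps)
  thus ?case using insert.hyps by (auto simp: W_def)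
qed

text \<open>Once the coefficients of \<open>G\<close> are reduced modulo \<open>c\<close>, its
  leading coefficient is not divisible by \<open>c\<close>. As \<open>W\<close> is monic, the top
  coefficient of the product survives modulo \<open>c\<close>, so \<Psi> has a nonzero coefficient
  in that degree.\<close>

lemma degree_ge_mod:
  fixes \<Psi> W G :: "int poly"
  assumes c: "prime c" and W: "lead_coeff W = 1" and \<Psi>: "\<not> [:c:] dvd \<Psi>" "[:c:] dvd (\<Psi> - W * G)"
  shows "degree W \<le> degree \<Psi>"
proof -
  define G' where "G' = map_poly (\<lambda>x. x mod c) G"
  have G': "coeff G' i = coeff G i mod c" for i by (simp add: G'_def coeff_map_poly)
  have "[:c:] dvd G - G'" by (auto simp: const_poly_dvd_iff G' minus_mod_eq_mult_div)
  hence "[:c:] dvd W * (G - G')" by simp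
  from dvd_add[OF \<Psi>(2) this] have dv: "[:c:] dvd (\<Psi> - W * G')" by (simp add: algebra_simps)
  have nz: "G' \<noteq> 0" using dv \<Psi>(1) by auto
  have "lead_coeff G' \<noteq> 0" using nz by simp
  hence "\<not> c dvd lead_coeff G'" by (simp add: G' dvd_eq_mod_eq_0)
  moreover have "coeff (W * G') (degree W + degree G') = lead_coeff G'"
    using W by (simp add: coeff_mult_degree_sum)
  moreover have "c dvd coeff (\<Psi> - W * G') (degree W + degree G')"
    using dv by (simp add: const_poly_dvd_iff)
  ultimately have "coeff \<Psi> (degree W + degree G') \<noteq> 0"
    by auto
  hence "degree W + degree G' \<le> degree \<Psi>" by (rule le_degree)
  thus ?thesis by simp
qed

lemma card_roots_mod_mult_le:
  fixes \<Psi> :: "int poly" and S :: "int set"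
  assumes c: "prime c" and S: "finite S" "\<And>a b. a \<in> S \<Longrightarrow> b \<in> S \<Longrightarrow> a \<noteq> b \<Longrightarrow> \<not> c dvd (a - b)"
    and \<Psi>: "\<not> [:c:] dvd \<Psi>"
    and ord: "\<And>a. a \<in> S \<Longrightarrow> \<exists>G. [:c:] dvd (\<Psi> - [:-a, 1:] ^ M * G)"
  shows "card S * M \<le> degree \<Psi>"
proof -
  obtain G where "[:c:] dvd (\<Psi> - (\<Prod>a\<in>S. [:-a, 1:] ^ M) * G)"
    using mod_product_of_linear_powers[OF c S ord] by blast
  hence "degree (\<Prod>a\<in>S. [:-a, 1::int:] ^ M) \<le> degree \<Psi>"
    by (intro degree_ge_mod[OF c _ \<Psi>]) (simp add: lead_coeff_prod lead_coeff_power)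
  moreover have "degree (\<Prod>a\<in>S. [:-a, 1::int:] ^ M) = (\<Sum>a\<in>S. M)"
    by (subst degree_prod_eq_sum_degree) (simp_all add: degree_power_eq)
  ultimately show ?thesis by simp
qed

text \<open>By counting instead of linear algebra: vectors with entries in
  \<open>{0..<int p}\<close> outnumber the possible right-hand sides, so two of them share the same
  values, and their difference is a nontrivial solution. It will provide the coefficients of
  Stepanov's auxiliary polynomial.\<close>

lemma siegel_mod:
  fixes A :: "'e \<Rightarrow> 'u \<Rightarrow> int" and p :: nat
  assumes fin: "finite E" "finite U" and card: "card E < card U" and p: "p > 1"
  shows "\<exists>f. (\<exists>u\<in>U. \<not> int p dvd f u) \<and> (\<forall>e\<in>E. int p dvd (\<Sum>u\<in>U. A e u * f u))"
proof -
  define X where "X = PiE U (\<lambda>_. {0..<int p})"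
  define F where "F = (\<lambda>f. restrict (\<lambda>e. (\<Sum>u\<in>U. A e u * f u) mod int p) E)"
  have "F ` X \<subseteq> PiE E (\<lambda>_. {0..<int p})" using p by (auto simp: F_def)
  moreover have "card (PiE E (\<lambda>_. {0..<int p})) < card X"
    using fin card p by (simp add: X_def card_PiE)
  moreover have "finite (PiE E (\<lambda>_. {0..<int p}))" using fin by (intro finite_PiE) auto
  ultimately have "card (F ` X) < card X"
    by (meson card_mono le_less_trans)
  hence "\<not> inj_on F X" using card_image by fastforce
  then obtain f g where fg: "f \<in> X" "g \<in> X" "f \<noteq> g" "F f = F g" by (auto simp: inj_on_def)
  have "\<exists>u\<in>U. f u \<noteq> g u" using fg(1-3) unfolding X_def by (metis PiE_ext)
  then obtain u where u: "u \<in> U" "f u \<noteq> g u" by blast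
  have "f u \<in> {0..<int p}" "g u \<in> {0..<int p}" using fg u by (auto simp: X_def)
  hence "f u mod int p = f u" "g u mod int p = g u" by auto
  with u have "\<not> int p dvd (f u - g u)" by (metis mod_eq_dvd_iff)
  moreover have "int p dvd (\<Sum>u\<in>U. A e u * (f u - g u))" if "e \<in> E" for e
  proof -
    have "F f e = F g e" using fg by simp
    hence "int p dvd (\<Sum>u\<in>U. A e u * f u) - (\<Sum>u\<in>U. A e u * g u)"
      using that by (simp add: F_def mod_eq_dvd_iff)
    thus ?thesis by (simp add: sum_subtractf right_diff_distrib)
  qed
  ultimately show ?thesis using u(1) by (intro exI[of _ "\<lambda>u. f u - g u"]) auto
qed

section \<open>Stepanov's method\<close>

text \<open>The derivation \<open>P * R * pderiv\<close> maps
  \<open>k * X^(p i) * P^a * R^b\<close>, modulo \<open>p\<close>, to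
  \<open>stepanov_op P R a b k\<close> times the same powers: \<open>P * R\<close> clears the
  denominators of the logarithmic derivatives, and \<open>X^(p i)\<close> has derivative 0.
  Iteration therefore changes only the cofactor \<open>k\<close>, whose degree grows by at most 3
  each time when \<open>P\<close> and \<open>R\<close> are quadratic.\<close>

definition stepanov_op :: "int poly \<Rightarrow> int poly \<Rightarrow> nat \<Rightarrow> nat \<Rightarrow> int poly \<Rightarrow> int poly" where
  "stepanov_op P R a b k = P * R * pderiv k + (of_nat a * pderiv P * R + of_nat b * P * pderiv R) * k"

lemma mult_pderiv_power: "P * pderiv (P ^ a) = of_nat a * pderiv P * (P :: int poly) ^ a"
  by (induction a) (auto simp: pderiv_mult algebra_simps)

lemma const_poly_dvd_pderiv:
  fixes X :: "int poly"
  assumes "[:c:] dvd X"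
  shows "[:c:] dvd pderiv X"
proof -
  from assms obtain Y where "X = [:c:] * Y" by (elim dvdE)
  hence "pderiv X = [:c:] * pderiv Y" by (simp add: pderiv_smult)
  thus ?thesis by (metis dvd_triv_left)
qed

lemma derivation_stepanov_term:
  fixes P R k :: "int poly" and p i a b :: nat
  defines "T \<equiv> monom 1 (p * i) * P ^ a * R ^ b"
  shows "[:int p:] dvd (P * R * pderiv (k * T) - stepanov_op P R a b k * T)"
proof -
  have "P * R * pderiv (k * T) - stepanov_op P R a b k * T
      = k * P ^ a * R ^ b * P * R * pderiv (monom 1 (p * i))
        + k * monom 1 (p * i) * R * R ^ b * (P * pderiv (P ^ a) - of_nat a * pderiv P * P ^ a)
        + k * monom 1 (p * i) * P * P ^ a * (R * pderiv (R ^ b) - of_nat b * pderiv R * R ^ b)"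
    unfolding T_def stepanov_op_def by (simp add: pderiv_mult algebra_simps)
  also have "\<dots> = k * P ^ a * R ^ b * P * R * pderiv (monom 1 (p * i))"
    by (simp only: mult_pderiv_power) simp
  also have "[:int p:] dvd \<dots>"
  proof (rule dvd_mult)
    show "[:int p:] dvd pderiv (monom 1 (p * i))"
      by (auto simp: pderiv_monom const_poly_dvd_iff)
  qed
  finally show ?thesis .
qed

lemma derivation_iter_stepanov_term:
  fixes P R k :: "int poly" and p i a b :: nat
  defines "T \<equiv> monom 1 (p * i) * P ^ a * R ^ b"
  shows "[:int p:] dvd (((\<lambda>X. P * R * pderiv X) ^^ m) (k * T) - (stepanov_op P R a b ^^ m) k * T)"
proof (induction m)
  case (Suc m)
  let ?D = "\<lambda>X. P * R * pderiv X" and ?L = "stepanov_op P R a b"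
  have "[:int p:] dvd ?D ((?D ^^ m) (k * T) - (?L ^^ m) k * T)"
    using const_poly_dvd_pderiv[OF Suc] by (rule dvd_mult)
  moreover have "?D ((?D ^^ m) (k * T) - (?L ^^ m) k * T)
      = (?D ^^ Suc m) (k * T) - ?D ((?L ^^ m) k * T)"
    by (simp only: funpow.simps o_apply pderiv_diff right_diff_distrib)
  ultimately have 1: "[:int p:] dvd (?D ^^ Suc m) (k * T) - ?D ((?L ^^ m) k * T)"
    by (simp only:)
  have 2: "[:int p:] dvd ?D ((?L ^^ m) k * T) - (?L ^^ Suc m) k * T"
    unfolding T_def funpow.simps o_apply by (rule derivation_stepanov_term)
  show ?case by (rule dvd_diff_trans[OF 1 2])
qed simp

lemma pderiv_sum_poly: "pderiv (\<Sum>x\<in>A. f x) = (\<Sum>x\<in>A. pderiv (f x))"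
  by (induction A rule: infinite_finite_induct) (auto simp: pderiv_add)

lemma derivation_iter_sum:
  fixes V :: "int poly"
  shows "((\<lambda>X. V * pderiv X) ^^ m) (\<Sum>u\<in>U. smult (f u) (X u))
    = (\<Sum>u\<in>U. smult (f u) (((\<lambda>X. V * pderiv X) ^^ m) (X u)))"
  by (induction m) (simp_all add: pderiv_sum_poly pderiv_smult sum_distrib_left)

lemma degree_stepanov_op:
  assumes "degree P \<le> 2" "degree R \<le> 2"
  shows "degree (stepanov_op P R a b k) \<le> degree k + 3"
proof -
  have dP: "degree (pderiv P) \<le> 1" "degree (pderiv R) \<le> 1" "degree (pderiv k) \<le> degree k - 1"
    using assms by (auto simp: degree_pderiv)
  have ofn: "degree (of_nat n :: int poly) = 0" for n by simp
  have m: "degree (X * Y) \<le> x + y" if "degree X \<le> x" "degree Y \<le> y" for X Y :: "int poly" and x y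
    using degree_mult_le[of X Y] that by linarith
  have "degree (P * R * pderiv k) \<le> degree k + 3"
  proof (cases "degree k = 0")
    case True
    hence "pderiv k = 0" by (simp add: pderiv_eq_0_iff)
    thus ?thesis by simp
  next
    case False
    have "degree (P * R * pderiv k) \<le> (2 + 2) + (degree k - 1)" using assms dP by (intro m) auto
    thus ?thesis using False by simp
  qed
  moreover have "degree (of_nat a * pderiv P * R + of_nat b * P * pderiv R) \<le> 3"
  proof (rule degree_add_le)
    have "degree (of_nat a * pderiv P * R) \<le> (0 + 1) + 2" using assms dP by (intro m) auto
    thus "degree (of_nat a * pderiv P * R) \<le> 3" by simp
    have "degree (of_nat b * P * pderiv R) \<le> (0 + 2) + 1" using assms dP by (intro m) auto
    thus "degree (of_nat b * P * pderiv R) \<le> 3" by simp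
  qed
  hence "degree ((of_nat a * pderiv P * R + of_nat b * P * pderiv R) * k) \<le> 3 + degree k"
    by (intro m) auto
  ultimately show ?thesis unfolding stepanov_op_def by (intro degree_add_le) auto
qed

lemma degree_stepanov_op_iter:
  assumes "degree P \<le> 2" "degree R \<le> 2"
  shows "degree ((stepanov_op P R a b ^^ m) k) \<le> degree k + 3 * m"
proof (induction m)
  case (Suc m)
  thus ?case using degree_stepanov_op[OF assms, of a b "(stepanov_op P R a b ^^ m) k"] by simp
qed simp

lemma derivation_iter_linear_power:
  fixes V G :: "int poly"
  assumes "s \<le> r"
  shows "\<exists>H. ((\<lambda>X. V * pderiv X) ^^ s) ([:-a, 1:] ^ r * G) = [:-a, 1:] ^ (r - s) * H \<and>
    poly H a = (\<Prod>i<s. int (r - i)) * poly V a ^ s * poly G a"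
  using assms
proof (induction s)
  case 0
  show ?case by (rule exI[of _ G]) simp
next
  case (Suc s)
  then obtain H where H: "((\<lambda>X. V * pderiv X) ^^ s) ([:-a, 1:] ^ r * G) = [:-a, 1:] ^ (r - s) * H"
    "poly H a = (\<Prod>i<s. int (r - i)) * poly V a ^ s * poly G a" by auto
  define e where "e = r - Suc s"
  have e: "r - s = Suc e" using Suc.prems by (simp add: e_def)
  have d: "pderiv ([:-a, 1:] ^ Suc e :: int poly) = of_nat (Suc e) * [:-a, 1:] ^ e"
    by (subst pderiv_power_Suc) (simp add: pderiv_pCons one_pCons of_nat_poly)
  define H' where "H' = V * (of_nat (Suc e) * H + [:-a, 1:] * pderiv H)"
  have "((\<lambda>X. V * pderiv X) ^^ Suc s) ([:-a, 1:] ^ r * G) = V * pderiv ([:-a, 1:] ^ Suc e * H)"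
    using H(1) e by simp
  also have "\<dots> = V * ([:-a, 1:] ^ Suc e * pderiv H + (of_nat (Suc e) * [:-a, 1:] ^ e) * H)"
    by (simp only: pderiv_mult d) (simp only: mult.commute)
  also have "\<dots> = [:-a, 1:] ^ e * H'"
    unfolding H'_def by (simp only: power_Suc ring_distribs mult_ac)
  finally have "((\<lambda>X. V * pderiv X) ^^ Suc s) ([:-a, 1:] ^ r * G) = [:-a, 1:] ^ (r - Suc s) * H'"
    by (simp add: e_def)
  moreover have "poly H' a = (\<Prod>i<Suc s. int (r - i)) * poly V a ^ Suc s * poly G a"
  proof -
    have "poly H' a = poly V a * (of_nat (Suc e) * poly H a)"
      unfolding H'_def by (simp del: of_nat_Suc)
    thus ?thesis unfolding H(2) prod.lessThan_Suc e by (simp del: of_nat_Suc)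
  qed
  ultimately show ?case by blast
qed

text \<open>Once the order at \<open>a\<close> is known to be at least \<open>r\<close>, the
  \<open>r\<close>-th iterate has at \<open>a\<close> the value \<open>r! * V(a)^r * G(a)\<close>.
  Since \<open>r < M \<le> p\<close>, the factorial is a unit modulo \<open>p\<close>, so
  \<open>G\<close> vanishes at \<open>a\<close> and the order rises by one.\<close>

lemma order_from_derivation:
  fixes V \<Psi> :: "int poly"
  assumes p: "prime p" and M: "M \<le> p" and V: "\<not> int p dvd poly V a"
    and z: "\<And>m. m < M \<Longrightarrow> int p dvd poly (((\<lambda>X. V * pderiv X) ^^ m) \<Psi>) a"
  shows "\<exists>G. [:int p:] dvd (\<Psi> - [:-a, 1:] ^ M * G)"
  using M z
proof (induction M)
  case 0
  show ?case by (rule exI[of _ \<Psi>]) simp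
next
  case (Suc r)
  let ?D = "\<lambda>X. V * pderiv X"
  have pp: "prime (int p)" using p by simp
  obtain G where G: "[:int p:] dvd (\<Psi> - [:-a, 1:] ^ r * G)" using Suc by auto
  have "[:int p:] dvd (?D ^^ m) X \<or> \<not> [:int p:] dvd X" for X m
    by (induction m) (auto intro!: dvd_mult const_poly_dvd_pderiv)
  hence "[:int p:] dvd (?D ^^ r) (\<Psi> - [:-a, 1:] ^ r * G)" using G by blast
  hence "int p dvd poly ((?D ^^ r) (\<Psi> - [:-a, 1:] ^ r * G)) a" by (rule const_poly_dvd_imp_dvd_poly)
  moreover have "(?D ^^ r) (X - Y) = (?D ^^ r) X - (?D ^^ r) Y" for X Y
    by (induction r) (simp_all add: pderiv_diff right_diff_distrib)
  moreover have "int p dvd poly ((?D ^^ r) \<Psi>) a" using Suc.prems by auto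
  ultimately have "int p dvd poly ((?D ^^ r) ([:-a, 1:] ^ r * G)) a"
    by (simp add: dvd_diff_right_iff)
  moreover obtain H where "(?D ^^ r) ([:-a, 1:] ^ r * G) = [:-a, 1:] ^ (r - r) * H"
    "poly H a = (\<Prod>i<r. int (r - i)) * poly V a ^ r * poly G a"
    using derivation_iter_linear_power[of r r V a G] by auto
  ultimately have "int p dvd (\<Prod>i<r. int (r - i)) * poly V a ^ r * poly G a" by simp
  moreover have "\<not> int p dvd (\<Prod>i<r. int (r - i))"
  proof
    assume "int p dvd (\<Prod>i<r. int (r - i))"
    then obtain i where "i < r" "int p dvd int (r - i)" using pp by (auto simp: prime_dvd_prod_iff)
    from this(2) have "p dvd r - i" by (simp only: int_dvd_int_iff)
    moreover have "r - i > 0" "r - i < p" using Suc.prems \<open>i < r\<close> by auto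
    ultimately show False by (meson dvd_imp_le leD)
  qed
  moreover have "\<not> int p dvd poly V a ^ r" using V pp prime_dvd_power by blast
  ultimately have "int p dvd poly G a" using pp by (simp add: prime_dvd_mult_iff)
  then obtain G' where "[:int p:] dvd (G - [:-a, 1:] * G')" using linear_factor_mod by blast
  hence "[:int p:] dvd [:-a, 1:] ^ r * (G - [:-a, 1:] * G')" by simp
  from dvd_add[OF G this] have "[:int p:] dvd (\<Psi> - [:-a, 1:] ^ Suc r * G')"
    by (simp add: algebra_simps)
  thus ?case by blast
qed


section \<open>Zeros of high order of Stepanov's auxiliary polynomial\<close>

lemma fermat_int:
  fixes a :: int
  assumes "prime p"
  shows "[a ^ p = a] (mod int p)"
proof -
  have p: "p > 0" using assms by (rule prime_gt_0_nat)
  define b where "b = nat (a mod int p)"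
  have ab: "[a = int b] (mod int p)" using p by (simp add: b_def cong_def)
  have "[b ^ p = b] (mod p)"
  proof (cases "p dvd b")
    case True
    moreover from this have "p dvd b ^ p" using p by (simp add: dvd_trans dvd_power)
    ultimately show ?thesis by (simp add: cong_def)
  next
    case False
    have "[b ^ (p - 1) * b = 1 * b] (mod p)" by (intro cong_mult fermat_theorem assms False cong_refl)
    thus ?thesis using p by (cases p) (simp_all add: mult.commute)
  qed
  hence "[int b ^ p = int b] (mod int p)" by (metis cong_int_iff of_nat_power)
  thus ?thesis using ab by (meson cong_pow cong_sym cong_trans)
qed

text \<open>Uniqueness of digits in a mixed radix: \<open>u\<close> below \<open>g\<close>, then
  \<open>j\<close> below \<open>D\<close>, then \<open>i\<close> as multiplier of \<open>p\<close>,
  with room because \<open>g * D < p\<close>. The number \<open>u + p * i + g * j\<close> will be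
  the lowest exponent occurring in a term of the auxiliary polynomial.\<close>

lemma key_unique:
  fixes p g D :: nat
  assumes "g * D < p" "u < g" "u' < g" "j < D" "j' < D"
    and eq: "u + p * i + g * j = u' + p * i' + g * j'"
  shows "u = u' \<and> i = i' \<and> j = j'"
proof -
  have b: "u + g * j < g * D" if "u < g" "j < D" for u j
  proof -
    have "u + g * j < g * Suc j" using that by simp
    also have "\<dots> \<le> g * D" using that by (intro mult_le_mono2) simp
    finally show ?thesis .
  qed
  have l: "u + g * j < p" "u' + g * j' < p" using b assms by (meson less_trans)+
  have eq': "(u + g * j) + p * i = (u' + g * j') + p * i'" using eq by simp
  have "i = ((u + g * j) + p * i) div p" using l by simp
  also have "\<dots> = i'" unfolding eq' using l by simp
  finally have i: "i = i'" .
  with eq have eq'': "u + g * j = u' + g * j'" by simp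
  have "j = (u + g * j) div g" using assms by simp
  also have "\<dots> = j'" unfolding eq'' using assms by simp
  finally show ?thesis using i eq'' by simp
qed

text \<open>The auxiliary polynomial is the sum of
  \<open>f(u,i,j) * X^(u + p i) * P^(g j) * R^(g (D - 1 - j))\<close>. On \<open>S\<close>,
  \<open>X^p\<close> acts like \<open>X\<close> and \<open>R^g\<close> like \<open>P^g\<close>, so
  after \<open>m\<close> derivations the value is \<open>P^e\<close> times that of a polynomial of
  degree below \<open>g + I + 3 * m\<close>. Killing all its coefficients for every
  \<open>m < M\<close> takes fewer equations than there are unknowns, yet forces zeros of order
  \<open>M\<close> at every point of \<open>S\<close>.\<close>

lemma stepanov:
  fixes p g D J :: nat and \<beta> r0 r1 :: int and S :: "int set"
  defines "P \<equiv> [:0, \<beta>, 1:]" and "R \<equiv> [:r0, r1, 1:]"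
  assumes p: "prime p" and gD: "g * D = p - 1" and D: "D \<ge> 2" and J: "J \<ge> 1"
    and \<beta>: "\<not> int p dvd \<beta>" and r0: "\<not> int p dvd r0"
    and JD: "4 * D * J ^ 2 + D * J \<le> 2 * g"
    and S: "finite S" "\<And>a b. a \<in> S \<Longrightarrow> b \<in> S \<Longrightarrow> a \<noteq> b \<Longrightarrow> \<not> int p dvd (a - b)"
    and SP: "\<And>a. a \<in> S \<Longrightarrow> \<not> int p dvd poly P a" and SR: "\<And>a. a \<in> S \<Longrightarrow> \<not> int p dvd poly R a"
    and eq: "\<And>a. a \<in> S \<Longrightarrow> [poly P a ^ g = poly R a ^ g] (mod (int p))"
  shows "card S * (D * J) < p * (J + 2)"
proof -
  define I where "I = J + 1"
  \<comment> \<open>With this multiplicity, degree divided by multiplicity is at most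
    \<open>(p / D) * (1 + 2 / J)\<close>.\<close>
  define M where "M = D * J"
  have p2: "p \<ge> 2" using p by (rule prime_ge_2_nat)
  have pp: "prime (int p)" using p by simp
  have g: "g \<ge> 1" using gD p2 by (cases g) auto
  have degP: "degree P \<le> 2" "degree R \<le> 2" by (simp_all add: P_def R_def)
  define L where "L = (\<lambda>j. stepanov_op P R (g * j) (g * (D - 1 - j)))"
  define T where "T = (\<lambda>i j. monom 1 (p * i) * P ^ (g * j) * R ^ (g * (D - 1 - j)))"
  define U where "U = {..<g} \<times> {..<I} \<times> {..<D}"
  define E where "E = (SIGMA m:{..<M}. {..<g + I + 3 * m})"
  define Z where "Z = (\<lambda>m (u, i, j). monom 1 i * (L j ^^ m) (monom 1 u) :: int poly)"
  have finU: "finite U" and finE: "finite E" by (auto simp: U_def E_def)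
  have gauss: "2 * (\<Sum>m<M. 3 * m) + 3 * M = 3 * M * M" for M :: nat
    by (induction M) (auto simp: algebra_simps)
  have "card E = (\<Sum>m<M. g + I + 3 * m)" by (simp add: E_def)
  hence "2 * card E + 3 * M = 2 * M * (g + I) + 3 * M * M"
    using gauss[of M] by (simp add: sum.distrib algebra_simps)
  \<comment> \<open>Since \<open>I = J + 1\<close> and \<open>M = D * J\<close>, the unknowns exceed
    the main part \<open>M * g\<close> of the equations by \<open>g * D\<close>. This surplus has to
    pay for \<open>M * I\<close> and for the growth of the degrees, and \<open>JD\<close> says that
    it does.\<close>
  moreover have "2 * M * (g + I) + 3 * M * M < 2 * card U + 3 * M"
  proof -
    have cU: "card U = g * I * D" by (simp add: U_def card_cartesian_product)
    have "D * (4 * D * J ^ 2 + D * J) \<le> D * (2 * g)" using JD by (rule mult_le_mono2)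
    hence 1: "4 * M * M + D * M \<le> 2 * g * D" by (simp add: M_def power2_eq_square algebra_simps)
    have "2 * M * J \<le> M * M" using D by (simp add: M_def)
    moreover have "2 * M \<le> D * M" using D by simp
    moreover have "M > 0" using D J by (simp add: M_def)
    ultimately have "2 * M * J + 3 * M * M + 2 * M < 4 * M * M + D * M + 3 * M" by linarith
    also have "\<dots> \<le> 2 * g * D + 3 * M" using 1 by simp
    finally have "2 * M * J + 3 * M * M + 2 * M + 2 * M * g < 2 * g * D + 3 * M + 2 * M * g" by simp
    thus ?thesis unfolding cU I_def by (simp add: algebra_simps M_def)
  qed
  ultimately have "card E < card U" by linarith
  moreover have "1 < p" using p2 by simp
  ultimately obtain f where f: "\<exists>u\<in>U. \<not> int p dvd f u"
    and f0: "\<forall>e\<in>E. int p dvd (\<Sum>u\<in>U. coeff (Z (fst e) u) (snd e) * f u)"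
    using siegel_mod[OF finE finU, of p "\<lambda>e u. coeff (Z (fst e) u) (snd e)"] by blast
  define \<Psi> where "\<Psi> = (\<Sum>v\<in>U. smult (f v) (case v of (u, i, j) \<Rightarrow> monom 1 u * T i j))"
  have ZE: "[:int p:] dvd (\<Sum>v\<in>U. smult (f v) (Z m v))" if m: "m < M" for m
    unfolding const_poly_dvd_iff
  proof
    fix t
    show "int p dvd coeff (\<Sum>v\<in>U. smult (f v) (Z m v)) t"
    proof (cases "t < g + I + 3 * m")
      case True
      hence "(m, t) \<in> E" using m by (simp add: E_def)
      with f0 have "int p dvd (\<Sum>u\<in>U. coeff (Z m u) t * f u)" by fastforce
      thus ?thesis by (simp add: coeff_sum mult.commute)
    next
      case False
      have "coeff (Z m v) t = 0" if "v \<in> U" for v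
      proof -
        obtain u i j where v: "v = (u, i, j)" by (cases v) auto
        have "u < g" "i < I" using that by (auto simp: v U_def)
        moreover have "degree ((L j ^^ m) (monom 1 u)) \<le> u + 3 * m"
          using degree_stepanov_op_iter[OF degP, where a = "g * j" and b = "g * (D - 1 - j)" and m = m and k = "monom 1 u"]
          by (simp add: L_def degree_monom_eq)
        moreover have "degree (Z m v) \<le> i + degree ((L j ^^ m) (monom 1 u))"
          using degree_mult_le[of "monom 1 i" "(L j ^^ m) (monom 1 u)"]
          by (simp add: Z_def v degree_monom_eq)
        ultimately have "degree (Z m v) < t" using False by linarith
        thus ?thesis by (rule coeff_eq_0)
      qed
      thus ?thesis by (simp add: coeff_sum)
    qed
  qed
  \<comment> \<open>Among the terms whose coefficient is nonzero modulo \<open>p\<close>, the one of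
    least key cannot cancel. As \<open>P = X * (X + \<beta>)\<close>, each term is
    \<open>X^key\<close> times a polynomial whose constant coefficient is a power of \<beta> times a
    power of \<open>r0\<close>, hence a unit modulo \<open>p\<close>.\<close>
  have ndvd: "\<not> [:int p:] dvd \<Psi>"
  proof
    assume dv: "[:int p:] dvd \<Psi>"
    define key where "key = (\<lambda>(u, i, j). u + p * i + g * j)"
    have kinj: "v = w" if "v \<in> U" "w \<in> U" "key v = key w" for v w
    proof -
      obtain u i j where v: "v = (u, i, j)" by (cases v) auto
      obtain u' i' j' where w: "w = (u', i', j')" by (cases w) auto
      have "g * D < p" using gD p2 by simp
      from key_unique[OF this, of u u' j j' i i'] show ?thesis
        using that by (simp add: v w key_def U_def)
    qed
    define B where "B = {v \<in> U. \<not> int p dvd f v}"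
    have B: "finite B" "B \<noteq> {}" using finU f by (auto simp: B_def)
    define w where "w = arg_min_on key B"
    have w: "w \<in> B" "\<And>v. v \<in> B \<Longrightarrow> key w \<le> key v"
      using B by (auto simp: w_def arg_min_if_finite(1) arg_min_least)
    have wU: "w \<in> U" using w(1) by (simp add: B_def)
    obtain u i j where wv: "w = (u, i, j)" by (cases w) auto
    define X where "X = (\<lambda>j. [:\<beta>, 1:] ^ (g * j) * R ^ (g * (D - 1 - j)) :: int poly)"
    have TX: "(case v of (u, i, j) \<Rightarrow> monom 1 u * T i j) = monom 1 (key v) * X (snd (snd v))" for v
    proof -
      obtain u i j where v: "v = (u, i, j)" by (cases v) auto
      have "P = monom 1 1 * [:\<beta>, 1:]" by (simp add: P_def monom_altdef)
      hence "P ^ (g * j) = monom 1 (g * j) * [:\<beta>, 1:] ^ (g * j)"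
        by (simp only: power_mult_distrib monom_power) simp
      moreover have "monom 1 (u + p * i + g * j) = monom 1 u * monom 1 (p * i) * monom (1 :: int) (g * j)"
        by (simp add: mult_monom)
      ultimately show ?thesis
        unfolding v key_def T_def X_def prod.case snd_conv by (simp only: mult_ac)
    qed
    have cf: "int p dvd f v * coeff (case v of (u, i, j) \<Rightarrow> monom 1 u * T i j) (key w)"
      if "v \<in> U" "v \<noteq> w" for v
    proof (cases "v \<in> B")
      case True
      hence "key w \<le> key v" by (rule w(2))
      moreover have "key w \<noteq> key v" using kinj[OF that(1) wU] that(2) by metis
      ultimately have "coeff (case v of (u, i, j) \<Rightarrow> monom 1 u * T i j) (key w) = 0"
        unfolding TX by (simp add: coeff_monom_mult)
      thus ?thesis by simp
    next
      case False
      thus ?thesis using that by (simp add: B_def)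
    qed
    have "int p dvd coeff \<Psi> (key w)" using dv by (simp add: const_poly_dvd_iff)
    also have "coeff \<Psi> (key w) = (\<Sum>v\<in>U. f v * coeff (case v of (u, i, j) \<Rightarrow> monom 1 u * T i j) (key w))"
      by (simp add: \<Psi>_def coeff_sum)
    also have "\<dots> = f w * coeff (case w of (u, i, j) \<Rightarrow> monom 1 u * T i j) (key w)
       + (\<Sum>v\<in>U - {w}. f v * coeff (case v of (u, i, j) \<Rightarrow> monom 1 u * T i j) (key w))"
      by (rule sum.remove[OF finU wU])
    finally have s1: "int p dvd f w * coeff (case w of (u, i, j) \<Rightarrow> monom 1 u * T i j) (key w)
       + (\<Sum>v\<in>U - {w}. f v * coeff (case v of (u, i, j) \<Rightarrow> monom 1 u * T i j) (key w))" .
    have "int p dvd (\<Sum>v\<in>U - {w}. f v * coeff (case v of (u, i, j) \<Rightarrow> monom 1 u * T i j) (key w))"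
      by (rule dvd_sum) (use cf in blast)
    from dvd_diff[OF s1 this]
    have "int p dvd f w * coeff (case w of (u, i, j) \<Rightarrow> monom 1 u * T i j) (key w)"
      by (simp only: add_diff_cancel_right')
    hence "int p dvd coeff (case w of (u, i, j) \<Rightarrow> monom 1 u * T i j) (key w)"
      using w(1) pp unfolding B_def by (metis (mono_tags, lifting) mem_Collect_eq prime_dvd_mult_iff)
    hence "int p dvd coeff (X j) 0" unfolding TX by (simp add: coeff_monom_mult wv)
    moreover have "coeff (X j) 0 = \<beta> ^ (g * j) * r0 ^ (g * (D - 1 - j))"
      unfolding poly_0_coeff_0[symmetric] by (simp add: X_def R_def)
    ultimately have "int p dvd \<beta> ^ (g * j) \<or> int p dvd r0 ^ (g * (D - 1 - j))"
      using pp by (simp add: prime_dvd_mult_iff)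
    thus False using \<beta> r0 pp prime_dvd_power by blast
  qed
  define e where "e = g * (D - 1)"
  have ord: "\<exists>G. [:int p:] dvd (\<Psi> - [:-a, 1:] ^ M * G)" if a: "a \<in> S" for a
  proof (rule order_from_derivation[OF p])
    have "M \<le> 4 * D * J ^ 2 + D * J" by (simp add: M_def)
    also have "\<dots> \<le> 2 * g" by (rule JD)
    also have "\<dots> \<le> D * g" using D by simp
    finally show "M \<le> p" using gD by (simp add: mult.commute)
    show "\<not> int p dvd poly (P * R) a" using SP[OF a] SR[OF a] pp by (simp add: prime_dvd_mult_iff)
    fix m assume m: "m < M"
    let ?D = "\<lambda>X. P * R * pderiv X"
    \<comment> \<open>Here the relations on \<open>S\<close> enter: Fermat reduces
      \<open>a^(p i)\<close> to \<open>a^i\<close>, and equality of the \<open>g\<close>-th powers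
      merges both powers into \<open>P^e\<close>, which no longer depends on
      \<open>j\<close>.\<close>
    have c1: "[poly ((?D ^^ m) (monom 1 u * T i j)) a = poly P a ^ e * poly (Z m (u, i, j)) a] (mod int p)"
      if "j < D" for u i j
    proof -
      have "[:int p:] dvd ((?D ^^ m) (monom 1 u * T i j) - (L j ^^ m) (monom 1 u) * T i j)"
        using derivation_iter_stepanov_term[where p = p and P = P and R = R and m = m and k = "monom 1 u" and i = i and a = "g * j" and b = "g * (D - 1 - j)"]
        by (simp add: T_def L_def)
      from const_poly_dvd_imp_dvd_poly[OF this, of a]
      have "[poly ((?D ^^ m) (monom 1 u * T i j)) a = poly ((L j ^^ m) (monom 1 u)) a * poly (T i j) a] (mod int p)"
        by (simp add: cong_iff_dvd_diff)
      also have "[poly (T i j) a = a ^ i * poly P a ^ e] (mod int p)"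
      proof -
        have "[(a ^ p) ^ i = a ^ i] (mod int p)"
          by (intro cong_pow fermat_int[OF p])
        moreover have "[(poly R a ^ g) ^ (D - 1 - j) = (poly P a ^ g) ^ (D - 1 - j)] (mod int p)"
          by (intro cong_pow cong_sym[OF eq[OF a]])
        ultimately have "[(a ^ p) ^ i * poly P a ^ (g * j) * (poly R a ^ g) ^ (D - 1 - j) =
           a ^ i * poly P a ^ (g * j) * (poly P a ^ g) ^ (D - 1 - j)] (mod int p)"
          by (intro cong_mult cong_refl)
        moreover have "poly P a ^ (g * j) * (poly P a ^ g) ^ (D - 1 - j) = poly P a ^ e"
          using that by (simp add: e_def flip: power_mult power_add distrib_left)
        ultimately show ?thesis
          by (simp add: T_def poly_monom power_mult mult.assoc)
      qed
      hence "[poly ((L j ^^ m) (monom 1 u)) a * poly (T i j) a = poly ((L j ^^ m) (monom 1 u)) a * (a ^ i * poly P a ^ e)] (mod int p)"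
        by (intro cong_mult cong_refl)
      also have "poly ((L j ^^ m) (monom 1 u)) a * (a ^ i * poly P a ^ e) = poly P a ^ e * poly (Z m (u, i, j)) a"
        by (simp add: Z_def poly_monom)
      finally show ?thesis .
    qed
    have "poly ((?D ^^ m) \<Psi>) a = (\<Sum>v\<in>U. f v * poly ((?D ^^ m) (case v of (u, i, j) \<Rightarrow> monom 1 u * T i j)) a)"
      unfolding \<Psi>_def derivation_iter_sum by (simp add: poly_sum)
    also have "[\<dots> = (\<Sum>v\<in>U. f v * (poly P a ^ e * poly (Z m v) a))] (mod int p)"
      by (intro cong_sum cong_mult cong_refl) (auto simp: U_def intro!: c1)
    also have "(\<Sum>v\<in>U. f v * (poly P a ^ e * poly (Z m v) a))
        = poly P a ^ e * poly (\<Sum>v\<in>U. smult (f v) (Z m v)) a"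
      by (simp add: poly_sum sum_distrib_left mult_ac)
    also have "[\<dots> = 0] (mod int p)"
      using const_poly_dvd_imp_dvd_poly[OF ZE[OF m]] by (simp add: cong_0_iff)
    finally show "int p dvd poly ((?D ^^ m) \<Psi>) a" by (simp add: cong_0_iff)
  qed
  have "card S * M \<le> degree \<Psi>"
    by (rule card_roots_mod_mult_le[OF pp S ndvd ord])
  also have "degree \<Psi> < p * (J + 2)"
  proof -
    have "degree (smult (f v) (case v of (u, i, j) \<Rightarrow> monom 1 u * T i j)) \<le> p * (J + 2) - 1" if "v \<in> U" for v
    proof -
      obtain u i j where v: "v = (u, i, j)" by (cases v) auto
      have b: "u < g" "i \<le> J" "j < D" using that by (auto simp: v U_def I_def)
      have dm: "degree (X * Y) \<le> x + y" if "degree X \<le> x" "degree Y \<le> y" for X Y :: "int poly" and x y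
        using degree_mult_le[of X Y] that by linarith
      have dp: "degree (X ^ n) \<le> 2 * n" if "degree X \<le> 2" for X :: "int poly" and n
        using degree_power_le[of X n] that by (meson le_trans mult_le_mono1)
      have "degree (smult (f v) (monom 1 u * (monom 1 (p * i) * P ^ (g * j) * R ^ (g * (D - 1 - j)))))
          \<le> u + (p * i + 2 * (g * j) + 2 * (g * (D - 1 - j)))"
        by (intro order_trans[OF degree_smult_le] dm dp degP) (auto simp: degree_monom_eq)
      also have "2 * (g * j) + 2 * (g * (D - 1 - j)) = 2 * (g * (j + (D - 1 - j)))"
        by (simp only: distrib_left)
      hence "u + (p * i + 2 * (g * j) + 2 * (g * (D - 1 - j))) = u + p * i + 2 * (g * (D - 1))"
        using b by simp
      also have "\<dots> \<le> u + p * J + 2 * (g * (D - 1))" using b by simp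
      also have "\<dots> \<le> p * (J + 2) - 1"
      proof -
        have "g * (D - 1) + g = g * D" using D by (cases D) auto
        hence "g * (D - 1) + g = p - 1" using gD by simp
        moreover have "p * (J + 2) = p * J + 2 * p" by simp
        ultimately show ?thesis using b p2 by linarith
      qed
      finally show ?thesis by (simp add: v T_def)
    qed
    hence "degree \<Psi> \<le> p * (J + 2) - 1"
      unfolding \<Psi>_def using finU by (intro degree_sum_le) auto
    moreover have "p * (J + 2) > 0" using p2 by simp
    ultimately show ?thesis by linarith
  qed
  finally show ?thesis by (simp add: M_def)
qed

text \<open>The bound of \<open>stepanov\<close> is \<open>(p / D) * (1 + 2 / J)\<close>, subject to
  \<open>J\<close> being at most about \<open>z = sqrt (p / 2) / D\<close>. As
  \<open>p / D = sqrt 2 * z * sqrt p\<close>, the excess is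
  \<open>2 * sqrt 2 * (z / J) * sqrt p\<close>; for \<open>z \<ge> 3\<close> rounding costs at most
  \<open>z / J \<le> 12 / 7\<close>, which gives 4.9. For \<open>z < 3\<close> the degree bound
  \<open>2 * g\<close> is enough, because \<open>p / D\<close> itself is below
  \<open>4.9 * sqrt p\<close>.\<close>

lemma card_quadratic_coset_le:
  fixes p g D :: nat and \<beta> r0 r1 :: int and S :: "int set"
  defines "P \<equiv> [:0, \<beta>, 1:]" and "R \<equiv> [:r0, r1, 1:]"
  assumes p: "prime p" and gD: "g * D = p - 1" and D: "D \<ge> 2"
    and \<beta>: "\<not> int p dvd \<beta>" and r0: "\<not> int p dvd r0"
    and S: "finite S" "\<And>a b. a \<in> S \<Longrightarrow> b \<in> S \<Longrightarrow> a \<noteq> b \<Longrightarrow> \<not> int p dvd (a - b)"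
    and SP: "\<And>a. a \<in> S \<Longrightarrow> \<not> int p dvd poly P a" and SR: "\<And>a. a \<in> S \<Longrightarrow> \<not> int p dvd poly R a"
    and eq: "\<And>a. a \<in> S \<Longrightarrow> [poly P a ^ g = poly R a ^ g] (mod (int p))"
  shows "real (card S) \<le> p / D + 4.9 * sqrt p"
proof -
  have p2: "p \<ge> 2" using p by (rule prime_ge_2_nat)
  have pp: "prime (int p)" using p by simp
  define z where "z = sqrt (p / 2) / D"
  have z0: "z > 0" using p2 D by (simp add: z_def)
  have pz: "real p = 2 * D ^ 2 * z ^ 2"
    using D by (simp add: z_def power_divide)
  have pDz: "p / D = (sqrt 2 * z) * sqrt p"
  proof -
    have "sqrt 2 * z * sqrt p = sqrt 2 * sqrt (p / 2) * sqrt p / D" by (simp add: z_def)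
    also have "sqrt 2 * sqrt (p / 2) = sqrt p" by (simp flip: real_sqrt_mult)
    finally show ?thesis by simp
  qed
  show ?thesis
  proof (cases "z < 3")
    case True
    define \<Psi> where "\<Psi> = P ^ g - R ^ g"
    have g: "g > 0" using gD p2 by (cases g) auto
    have "card S * 1 \<le> degree \<Psi>"
    proof (rule card_roots_mod_mult_le[OF pp S])
      show "\<not> [:int p:] dvd \<Psi>"
      proof
        assume "[:int p:] dvd \<Psi>"
        from const_poly_dvd_imp_dvd_poly[OF this, of 0] have "int p dvd r0 ^ g"
          using g by (simp add: \<Psi>_def P_def R_def zero_power)
        thus False using r0 pp prime_dvd_power by blast
      qed
      fix a assume "a \<in> S"
      from eq[OF this] have "int p dvd poly \<Psi> a" by (simp add: \<Psi>_def cong_iff_dvd_diff)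
      from linear_factor_mod[OF this] show "\<exists>G. [:int p:] dvd (\<Psi> - [:-a, 1:] ^ 1 * G)" by simp
    qed
    also have "degree \<Psi> \<le> 2 * g"
      unfolding \<Psi>_def
    proof (rule degree_diff_le)
      show "degree (P ^ g) \<le> 2 * g" "degree (R ^ g) \<le> 2 * g"
        by (simp_all add: P_def R_def degree_power_eq)
    qed
    finally have "real (card S) \<le> 2 * real g" by simp
    moreover have "real g \<le> p / D"
    proof -
      have "real g * real D = real (p - 1)" using gD by (metis of_nat_mult)
      also have "\<dots> \<le> real p" by simp
      finally show ?thesis using D by (simp add: pos_le_divide_eq)
    qed
    moreover have "p / D \<le> 4.9 * sqrt p"
      unfolding pDz
    proof (rule mult_right_mono)
      have "sqrt 2 \<le> 1.5" by (rule real_le_lsqrt) (auto simp: power2_eq_square)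
      hence "sqrt 2 * z \<le> 1.5 * 3" using True z0 by (intro mult_mono) auto
      thus "sqrt 2 * z \<le> 4.9" by simp
    qed simp
    ultimately show ?thesis by linarith
  next
    case False
    \<comment> \<open>The shift by 1/4 leaves a slack of \<open>z / 2\<close> in the quadratic
      condition, which covers the difference between \<open>g * D = p - 1\<close> and
      \<open>p = 2 * D^2 * z^2\<close>.\<close>
    define J where "J = nat \<lfloor>z - 1/4\<rfloor>"
    have J: "real J \<le> z - 1/4" "real J \<ge> z - 5/4" using False by (auto simp: J_def) linarith
    have J1: "J \<ge> 1" using J False by linarith
    have "4 * D * J ^ 2 + D * J \<le> 2 * g"
    proof -
      have "real J ^ 2 * 2 + real J / 2 \<le> (z - 1/4) ^ 2 * 2 + (z - 1/4) / 2"
        using J by (intro add_mono mult_right_mono power_mono) auto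
      also have "\<dots> = 2 * z ^ 2 - z / 2" by (simp add: power2_eq_square field_simps)
      also have "\<dots> \<le> 2 * z ^ 2 - 1 / real D ^ 2"
      proof -
        have "1 / real D ^ 2 \<le> 1 / 1" using D by (intro divide_left_mono) auto
        thus ?thesis using False by linarith
      qed
      finally have "real D ^ 2 * (real J ^ 2 * 2 + real J / 2) \<le> real D ^ 2 * (2 * z ^ 2 - 1 / real D ^ 2)"
        by (intro mult_left_mono) auto
      also have "\<dots> = real p - 1" unfolding pz using D by (simp add: field_simps)
      also have "\<dots> = real D * g" using gD p2 by (metis One_nat_def Suc_1 Suc_leD mult.commute of_nat_1 of_nat_diff of_nat_mult)
      finally have "real D * (real D * (real J ^ 2 * 2 + real J / 2)) \<le> real D * g"
        by (simp add: power2_eq_square mult.assoc)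
      hence "real D * (real J ^ 2 * 2 + real J / 2) \<le> g" using D by simp
      hence "real (4 * D * J ^ 2 + D * J) \<le> real (2 * g)" by (simp add: algebra_simps)
      thus ?thesis by (simp only: of_nat_le_iff)
    qed
    from stepanov[OF p gD D J1 \<beta> r0 this S SP[unfolded P_def] SR[unfolded R_def] eq[unfolded P_def R_def]]
    have "card S * (D * J) < p * (J + 2)" .
    hence "real (card S) * (D * J) < p * (J + 2)"
      by (metis of_nat_less_iff of_nat_mult)
    hence "real (card S) < p * (J + 2) / (D * J)" using D J1 by (simp add: pos_less_divide_eq)
    also have "\<dots> = p / D + (p / D) * (2 / J)" using D J1 by (simp add: field_simps)
    also have "(p / D) * (2 / J) \<le> 4.9 * sqrt p"
    proof -
      have "2 * z * 7 \<le> 24 * real J" using J False by linarith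
      hence "z * (2 / J) \<le> 24 / 7" using J1 by (simp add: field_simps)
      moreover have "sqrt 2 \<le> 1.42" by (rule real_le_lsqrt) (auto simp: power2_eq_square)
      ultimately have "sqrt 2 * (z * (2 / J)) \<le> 1.42 * (24 / 7)" using z0 by (intro mult_mono) auto
      also have "\<dots> \<le> 4.9" by simp
      finally have "(sqrt 2 * (z * (2 / J))) * sqrt p \<le> 4.9 * sqrt p" by (rule mult_right_mono) simp
      thus ?thesis unfolding pDz by (simp add: mult_ac)
    qed
    finally show ?thesis by simp
  qed
qed

text \<open>When \<open>g * D = p - 1\<close>, equality of the \<open>g\<close>-th powers means that
  \<open>(x + a) (x + b)\<close> divided by \<open>(x + c) (x + d)\<close> is a \<open>D\<close>-th
  power residue.\<close>

definition quad_count :: "nat \<Rightarrow> nat \<Rightarrow> nat \<Rightarrow> nat \<Rightarrow> nat \<Rightarrow> nat \<Rightarrow> nat set" where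
  "quad_count p g a b c d = {x. x < p \<and> \<not> p dvd x + a \<and> \<not> p dvd x + b \<and> \<not> p dvd x + c \<and> \<not> p dvd x + d \<and>
     [((x + a) * (x + b)) ^ g = ((x + c) * (x + d)) ^ g] (mod p)}"

lemma not_dvd_diff_of_less:
  fixes a b p :: nat
  assumes "a < p" "b < p" "a \<noteq> b"
  shows "\<not> int p dvd int a - int b"
proof
  assume "int p dvd int a - int b"
  hence "[a = b] (mod p)" by (metis cong_iff_dvd_diff cong_int_iff)
  thus False using assms by (simp add: cong_def)
qed

text \<open>Translation by \<open>a\<close> moves a root of the numerator to 0. That
  \<open>a\<close> differs from \<open>b\<close>, \<open>c\<close> and \<open>d\<close> makes
  \<beta> and \<open>r0\<close> units modulo \<open>p\<close>, as the Stepanov bound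
  demands.\<close>

lemma card_quad_count_le_aux:
  fixes p g D a b c d :: nat
  assumes p: "prime p" and gD: "g * D = p - 1" and D: "D \<ge> 2"
    and lt: "a < p" "b < p" "c < p" "d < p" and ne: "a \<noteq> b" "a \<noteq> c" "a \<noteq> d"
  shows "real (card (quad_count p g a b c d)) \<le> p / D + 4.9 * sqrt p"
proof -
  define S where "S = (\<lambda>x. int x + int a) ` quad_count p g a b c d"
  define \<beta> where "\<beta> = int b - int a"
  define r0 where "r0 = (int c - int a) * (int d - int a)"
  define r1 where "r1 = (int c - int a) + (int d - int a)"
  have pp: "prime (int p)" using p by simp
  have fin: "finite (quad_count p g a b c d)"
    by (rule finite_subset[of _ "{..<p}"]) (auto simp: quad_count_def)
  have P: "poly [:0, \<beta>, 1:] (int x + int a) = int ((x + a) * (x + b))" for x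
    by (simp add: \<beta>_def algebra_simps)
  have R: "poly [:r0, r1, 1:] (int x + int a) = int ((x + c) * (x + d))" for x
    by (simp add: r0_def r1_def algebra_simps)
  have "card S = card (quad_count p g a b c d)"
    unfolding S_def by (intro card_image inj_onI) auto
  moreover have "real (card S) \<le> p / D + 4.9 * sqrt p"
  proof (rule card_quadratic_coset_le[OF p gD D])
    show "\<not> int p dvd \<beta>" unfolding \<beta>_def using lt ne by (intro not_dvd_diff_of_less) auto
    show "\<not> int p dvd r0" unfolding r0_def using not_dvd_diff_of_less[of c p a] not_dvd_diff_of_less[of d p a] lt ne pp
      by (auto simp: prime_dvd_mult_iff)
    show "finite S" using fin by (simp add: S_def)
    show "\<not> int p dvd u - v" if "u \<in> S" "v \<in> S" "u \<noteq> v" for u v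
      using that not_dvd_diff_of_less by (auto simp: S_def quad_count_def)
    fix u assume "u \<in> S"
    then obtain x where x: "x \<in> quad_count p g a b c d" and u: "u = int x + int a" by (auto simp: S_def)
    show "\<not> int p dvd poly [:0, \<beta>, 1:] u" "\<not> int p dvd poly [:r0, r1, 1:] u"
      unfolding u P R int_dvd_int_iff using x p by (simp_all add: quad_count_def prime_dvd_mult_iff)
    show "[poly [:0, \<beta>, 1:] u ^ g = poly [:r0, r1, 1:] u ^ g] (mod int p)"
      unfolding u P R using x by (simp only: quad_count_def mem_Collect_eq cong_int_iff flip: of_nat_power)
  qed
  ultimately show ?thesis by simp
qed

text \<open>The hypotheses \<open>ne\<close> leave an entry that occurs only once; the symmetries of
  the condition let it play the role of \<open>a\<close>.\<close>

lemma card_quad_count_le: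
  fixes p g D a b c d :: nat
  assumes p: "prime p" and gD: "g * D = p - 1" and D: "D \<ge> 2"
    and lt: "a < p" "b < p" "c < p" "d < p" and ne: "{a, b} \<noteq> {c, d}" "\<not> (a = b \<and> c = d)"
  shows "real (card (quad_count p g a b c d)) \<le> p / D + 4.9 * sqrt p"
proof -
  have sym: "quad_count p g b a c d = quad_count p g a b c d" "quad_count p g c d a b = quad_count p g a b c d"
    "quad_count p g d c a b = quad_count p g a b c d" for a b c d
    by (auto simp: quad_count_def mult.commute cong_sym_eq)
  note aux = card_quad_count_le_aux[OF p gD D]
  consider "a \<noteq> b" "a \<noteq> c" "a \<noteq> d" | "b \<noteq> a" "b \<noteq> c" "b \<noteq> d" | "c \<noteq> d" "c \<noteq> a" "c \<noteq> b" | "d \<noteq> c" "d \<noteq> a" "d \<noteq> b"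
    using ne by blast
  thus ?thesis
  proof cases
    case 1 thus ?thesis using lt by (intro aux)
  next
    case 2 thus ?thesis using aux[of b a c d] lt sym(1)[of b a c d] by simp
  next
    case 3 thus ?thesis using aux[of c d a b] lt sym(2)[of c d a b] by simp
  next
    case 4 thus ?thesis using aux[of d c a b] lt sym(3)[of d c a b] by simp
  qed
qed

section \<open>Multiplicative characters and smoothed character sums\<close>

lemma cis_2pi_of_int: "cis (2 * pi * of_int n) = 1"
  using cis_multiple_2pi[of "of_int n"] by simp

lemma cis_2pi_of_int' [simp]: "cis (2 * (pi * of_int n)) = 1"
  using cis_2pi_of_int[of n] by (simp add: mult.assoc)

abbreviation uroot :: "nat \<Rightarrow> int \<Rightarrow> complex" where
  "uroot n j \<equiv> cis (2 * pi * of_int j / real n)"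

lemma sum_cis_roots_of_unity:
  fixes l :: nat and j :: int
  assumes "l > 0"
  shows "(\<Sum>i<l. uroot l (int i * j)) = (if int l dvd j then of_nat l else 0)"
proof -
  define z where "z = uroot l j"
  have pw: "uroot l (int i * j) = z ^ i" for i
    by (simp add: z_def DeMoivre mult_ac)
  have zl: "z ^ l = 1"
    using assms cis_2pi_of_int[of j] by (simp add: z_def DeMoivre)
  show ?thesis
  proof (cases "int l dvd j")
    case True
    then obtain t where "j = int l * t" by (elim dvdE)
    hence "z = 1" using assms cis_2pi_of_int[of t] by (simp add: z_def)
    thus ?thesis using True by (simp only: pw) simp
  next
    case False
    have "z \<noteq> 1"
    proof
      assume "z = 1"
      hence "cos (2 * pi * of_int j / l) = 1" by (simp add: z_def cis.ctr complex_eq_iff)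
      then obtain t :: int where "2 * pi * of_int j / l = of_int t * (2 * pi)"
        by (subst (asm) cos_one_2pi_int) auto
      hence "of_int j = (of_int (int l * t) :: real)" using assms by (simp add: field_simps)
      hence "j = int l * t" by (simp only: of_int_eq_iff)
      thus False using False by simp
    qed
    hence "(\<Sum>i<l. z ^ i) = 0" using zl by (simp add: geometric_sum)
    thus ?thesis using False by (simp only: pw) simp
  qed
qed

lemma parseval_mod:
  fixes F :: "nat \<Rightarrow> complex" and p :: nat
  assumes "p > 0"
  shows "(\<Sum>n<p. (cmod (\<Sum>a<p. F a * uroot p (int a * int n)))\<^sup>2) = p * (\<Sum>a<p. (cmod (F a))\<^sup>2)"
proof -
  let ?e = "\<lambda>j :: int. uroot p j"
  have ee: "?e i * cnj (?e j) = ?e (i - j)" for i j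
    by (simp add: cis_cnj cis_mult diff_divide_distrib right_diff_distrib)
  have "of_real (\<Sum>n<p. (cmod (\<Sum>a<p. F a * ?e (int a * int n)))\<^sup>2)
      = (\<Sum>n<p. (\<Sum>a<p. F a * ?e (int a * int n)) * cnj (\<Sum>b<p. F b * ?e (int b * int n)))"
    by (simp only: of_real_sum complex_norm_square[symmetric])
  also have "\<dots> = (\<Sum>n<p. \<Sum>a<p. \<Sum>b<p. F a * cnj (F b) * ?e (int n * (int a - int b)))"
  proof (rule sum.cong[OF refl])
    fix n
    have inner: "(F a * ?e (int a * int n)) * cnj (F b * ?e (int b * int n)) = F a * cnj (F b) * ?e (int n * (int a - int b))" for a b
    proof -
      have "(F a * ?e (int a * int n)) * cnj (F b * ?e (int b * int n)) = F a * cnj (F b) * (?e (int a * int n) * cnj (?e (int b * int n)))"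
        by (simp only: complex_cnj_mult mult_ac)
      moreover have "int a * int n - int b * int n = int n * (int a - int b)" by (simp add: algebra_simps)
      ultimately show ?thesis by (simp only: ee)
    qed
    have "(\<Sum>a<p. F a * ?e (int a * int n)) * cnj (\<Sum>b<p. F b * ?e (int b * int n))
      = (\<Sum>a<p. \<Sum>b<p. (F a * ?e (int a * int n)) * cnj (F b * ?e (int b * int n)))"
      by (simp only: cnj_sum sum_product)
    thus "(\<Sum>a<p. F a * ?e (int a * int n)) * cnj (\<Sum>b<p. F b * ?e (int b * int n)) = (\<Sum>a<p. \<Sum>b<p. F a * cnj (F b) * ?e (int n * (int a - int b)))"
      by (simp only: inner)
  qed
  also have "\<dots> = (\<Sum>a<p. \<Sum>b<p. F a * cnj (F b) * (\<Sum>n<p. ?e (int n * (int a - int b))))"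
    unfolding sum_distrib_left by (subst sum.swap, rule sum.cong[OF refl], rule sum.swap)
  also have "\<dots> = (\<Sum>a<p. \<Sum>b<p. if a = b then of_nat p * (F a * cnj (F a)) else 0)"
  proof (intro sum.cong refl)
    fix a b assume "a \<in> {..<p}" "b \<in> {..<p}"
    hence "int p dvd int a - int b \<longleftrightarrow> a = b" using not_dvd_diff_of_less by auto
    thus "F a * cnj (F b) * (\<Sum>n<p. ?e (int n * (int a - int b))) = (if a = b then of_nat p * (F a * cnj (F a)) else 0)"
      using assms by (subst sum_cis_roots_of_unity) auto
  qed
  also have "\<dots> = of_nat p * (\<Sum>a<p. F a * cnj (F a))"
    by (simp add: sum_distrib_left)
  also have "\<dots> = of_real (p * (\<Sum>a<p. (cmod (F a))\<^sup>2))"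
    by (simp only: complex_norm_square[symmetric] of_real_mult of_real_sum of_real_of_nat_eq)
  finally show ?thesis by (simp only: of_real_eq_iff)
qed

section \<open>Characters modulo \<open>p\<close> through the discrete logarithm\<close>

locale primroot_prime =
  fixes p \<gamma> :: nat
  assumes prime_p: "prime p" and p_gt_2: "p > 2" and primroot: "residue_primroot p \<gamma>"
begin

definition m :: nat where "m = p - 1"

definition dlog :: "nat \<Rightarrow> nat" where "dlog n = (LEAST i. [\<gamma> ^ i = n] (mod p))"

definition chi :: "nat \<Rightarrow> nat \<Rightarrow> complex" where
  "chi k n = (if p dvd n then 0 else uroot m (int k * int (dlog n)))"

lemma p_pos: "p > 0" and m_pos: "m > 0" and p_eq: "p = m + 1" and totient_p: "totient p = m"
  using p_gt_2 prime_p by (auto simp: m_def totient_prime)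

lemma even_m: "even m"
  using prime_odd_nat[OF prime_p p_gt_2] by (simp add: m_def)

lemma not_dvd_iff_coprime: "\<not> p dvd n \<longleftrightarrow> coprime p n"
  using prime_p by (meson coprime_commute not_prime_unit prime_imp_coprime_nat coprime_absorb_left)

lemma gamma_coprime: "coprime p \<gamma>" and ord_gamma: "ord p \<gamma> = m"
  using primroot totient_p by (auto simp: residue_primroot_def)

lemma gamma_pow_cong_iff: "[\<gamma> ^ i = \<gamma> ^ j] (mod p) \<longleftrightarrow> [i = j] (mod m)"
  using order_divides_expdiff[of p \<gamma> i j] gamma_coprime ord_gamma by (simp add: coprime_commute)

lemma gamma_bij: "bij_betw (\<lambda>i. \<gamma> ^ i mod p) {..<m} {1..<p}"
proof -
  have "totatives p = {1..<p}"
    using prime_p by (simp add: totatives_prime) (use p_gt_2 in auto)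
  thus ?thesis using residue_primroot_is_generator[of p \<gamma>] primroot p_gt_2 totient_p by simp
qed

lemma dlog_cong: "\<not> p dvd n \<Longrightarrow> [\<gamma> ^ dlog n = n] (mod p)"
proof -
  assume n: "\<not> p dvd n"
  hence "n mod p \<in> {1..<p}" using p_pos by (auto simp: dvd_eq_mod_eq_0)
  then obtain i where "n mod p = \<gamma> ^ i mod p" using gamma_bij unfolding bij_betw_def by blast
  hence "[\<gamma> ^ i = n] (mod p)" by (simp add: cong_def)
  thus ?thesis unfolding dlog_def by (rule LeastI)
qed

lemma dlog_unique: "[\<gamma> ^ i = n] (mod p) \<Longrightarrow> [dlog n = i] (mod m)"
proof -
  assume i: "[\<gamma> ^ i = n] (mod p)"
  hence "[\<gamma> ^ dlog n = n] (mod p)" unfolding dlog_def by (rule LeastI)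
  thus ?thesis using i gamma_pow_cong_iff by (meson cong_sym cong_trans)
qed

lemma cis_cong:
  assumes "[a = b] (mod int m)"
  shows "uroot m (int k * a) = uroot m (int k * b)"
proof -
  from assms obtain t where "a - b = int m * t" by (auto simp: cong_iff_dvd_diff)
  hence "a = b + int m * t" by simp
  hence "2 * pi * of_int (int k * a) / m = 2 * pi * of_int (int k * b) / m + 2 * pi * of_int (int k * t)"
    using m_pos by (simp add: field_simps)
  thus ?thesis by (simp only: cis_mult[symmetric] cis_2pi_of_int mult_1_right)
qed

lemma chi_of_exponent:
  assumes "\<not> p dvd n" "[int (dlog n) = i] (mod int m)"
  shows "chi k n = uroot m (int k * i)"
  using cis_cong[OF assms(2)] assms(1) by (simp add: chi_def)

lemma dlog_mult:
  assumes "\<not> p dvd a" "\<not> p dvd b"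
  shows "[dlog (a * b) = dlog a + dlog b] (mod m)"
  by (rule dlog_unique) (simp add: power_add cong_mult dlog_cong assms)

lemma chi_mult: "chi k (a * b) = chi k a * chi k b"
proof (cases "p dvd a \<or> p dvd b")
  case True
  thus ?thesis using prime_p by (auto simp: chi_def)
next
  case False
  hence ab: "\<not> p dvd a * b" using prime_p by (simp add: prime_dvd_mult_iff)
  have "[int (dlog (a * b)) = int (dlog a) + int (dlog b)] (mod int m)"
    using dlog_mult[of a b] False by (simp flip: of_nat_add add: cong_int_iff)
  from chi_of_exponent[OF ab this] show ?thesis
    using False by (simp add: chi_def cis_mult distrib_left add_divide_distrib)
qed

lemma chi_cong: "[a = b] (mod p) \<Longrightarrow> chi k a = chi k b"
proof -
  assume ab: "[a = b] (mod p)"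
  hence "[\<gamma> ^ i = a] (mod p) \<longleftrightarrow> [\<gamma> ^ i = b] (mod p)" for i by (meson cong_sym cong_trans)
  hence "dlog a = dlog b" by (simp add: dlog_def)
  thus ?thesis using ab by (simp add: chi_def cong_dvd_iff)
qed

lemma norm_chi: "cmod (chi k n) = (if p dvd n then 0 else 1)"
  by (simp add: chi_def)

lemma chi_dvd: "p dvd n \<Longrightarrow> chi k n = 0"
  by (simp add: chi_def)

lemma sum_less_p: "(\<Sum>a<p. F a) = F 0 + (\<Sum>a\<in>{1..<p}. F a)" for F :: "nat \<Rightarrow> 'a :: comm_monoid_add"
  using p_pos by (simp add: lessThan_atLeast0 sum.atLeast_Suc_lessThan)

lemma sum_chi:
  assumes "\<not> m dvd k"
  shows "(\<Sum>a<p. chi k a) = 0"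
proof -
  have "(\<Sum>a<p. chi k a) = (\<Sum>a\<in>{1..<p}. chi k a)"
    by (simp add: sum_less_p chi_dvd)
  also have "\<dots> = (\<Sum>i<m. chi k (\<gamma> ^ i mod p))"
    by (rule sum.reindex_bij_betw[OF gamma_bij, symmetric])
  also have "\<dots> = (\<Sum>i<m. uroot m (int i * int k))"
  proof (rule sum.cong[OF refl])
    fix i assume "i \<in> {..<m}"
    hence "\<gamma> ^ i mod p \<in> {1..<p}" using gamma_bij by (auto simp: bij_betw_def)
    hence nd: "\<not> p dvd \<gamma> ^ i mod p" by (auto dest: dvd_imp_le)
    have "[dlog (\<gamma> ^ i mod p) = i] (mod m)" by (rule dlog_unique) (simp add: cong_def)
    hence "[int (dlog (\<gamma> ^ i mod p)) = int i] (mod int m)" by (simp add: cong_int_iff)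
    from chi_of_exponent[OF nd this] show "chi k (\<gamma> ^ i mod p) = uroot m (int i * int k)"
      by (simp only: mult.commute)
  qed
  also have "\<dots> = 0" using assms m_pos by (subst sum_cis_roots_of_unity) auto
  finally show ?thesis .
qed

lemma half_p: "[\<gamma> ^ (m div 2) = p - 1] (mod p)"
proof -
  define y where "y = \<gamma> ^ (m div 2)"
  have "y ^ 2 = \<gamma> ^ m" using even_m by (simp add: y_def flip: power_mult)
  also have "[\<gamma> ^ m = 1] (mod p)"
    using gamma_pow_cong_iff[of m 0] by (simp add: cong_def)
  finally have "int p dvd int y ^ 2 - 1"
    by (metis cong_iff_dvd_diff cong_int_iff of_nat_1 of_nat_power)
  hence "int p dvd (int y - 1) * (int y + 1)" by (simp add: algebra_simps power2_eq_square)
  hence "int p dvd int y - 1 \<or> int p dvd int y + 1"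
    using prime_p by (simp add: prime_dvd_mult_iff)
  moreover have "\<not> int p dvd int y - 1"
  proof
    assume "int p dvd int y - 1"
    hence "[\<gamma> ^ (m div 2) = \<gamma> ^ 0] (mod p)"
      unfolding y_def[symmetric] by (metis cong_iff_dvd_diff cong_int_iff of_nat_1 power_0)
    hence "[m div 2 = 0] (mod m)" by (simp only: gamma_pow_cong_iff)
    hence "m dvd m div 2" by (simp add: cong_0_iff)
    moreover have "m div 2 > 0" "m div 2 < m" using p_gt_2 by (auto simp: m_def)
    ultimately show False by (meson dvd_imp_le leD)
  qed
  ultimately have "int p dvd int y + 1" by blast
  hence "int p dvd int y - int (p - 1) + int p" using p_pos by (simp add: of_nat_diff)
  hence "int p dvd int y - int (p - 1)" by (metis dvd_add_left_iff dvd_refl)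
  thus ?thesis unfolding y_def by (metis cong_iff_dvd_diff cong_int_iff)
qed

lemma dlog_uminus:
  assumes "a < p" "a > 0"
  shows "[dlog (p - a) = m div 2 + dlog a] (mod m)"
proof (rule dlog_unique)
  have nd: "\<not> p dvd a" using assms by (auto dest: dvd_imp_le)
  have "[\<gamma> ^ (m div 2 + dlog a) = (p - 1) * a] (mod p)"
    unfolding power_add by (intro cong_mult half_p dlog_cong nd)
  also have "[(p - 1) * a = p - a] (mod p)"
  proof -
    have "(p - 1) * a = p * (a - 1) + (p - a)"
      using assms by (cases a; cases p) (auto simp: algebra_simps)
    thus ?thesis by (simp add: cong_def)
  qed
  finally show "[\<gamma> ^ (m div 2 + dlog a) = p - a] (mod p)" .
qed

lemma chi_uminus:
  assumes "a < p" "a > 0"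
  shows "chi k (p - a) = (-1) ^ k * chi k a"
proof -
  have nd: "\<not> p dvd a" "\<not> p dvd (p - a)" using assms by (auto dest: dvd_imp_le)
  obtain h where h: "m = 2 * h" using even_m by (elim evenE)
  have h0: "h > 0" using m_pos h by simp
  have "[int (dlog (p - a)) = int h + int (dlog a)] (mod int m)"
  proof -
    have "[int (dlog (p - a)) = int (m div 2 + dlog a)] (mod int m)"
      using dlog_uminus[OF assms] by (simp only: cong_int_iff)
    thus ?thesis using h by simp
  qed
  from chi_of_exponent[OF nd(2) this, of k]
  have "chi k (p - a) = uroot m (int k * int h) * chi k a"
    using nd by (simp add: chi_def cis_mult distrib_left add_divide_distrib)
  also have "2 * pi * of_int (int k * int h) / m = real k * pi" using h h0 by (simp add: field_simps)
  also have "cis (real k * pi) = (-1) ^ k" by (simp add: DeMoivre[symmetric])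
  finally show ?thesis .
qed

section \<open>Gauss sums\<close>

definition gauss :: "nat \<Rightarrow> nat \<Rightarrow> complex" where
  "gauss k n = (\<Sum>a<p. cnj (chi k a) * uroot p (int a * int n))"

lemma mult_mod_bij:
  assumes "\<not> p dvd n"
  shows "bij_betw (\<lambda>a. a * n mod p) {..<p} {..<p}"
proof -
  have "inj_on (\<lambda>a. a * n mod p) {..<p}"
  proof (rule inj_onI)
    fix a b assume ab: "a \<in> {..<p}" "b \<in> {..<p}" "a * n mod p = b * n mod p"
    hence "[a * n = b * n] (mod p)" by (simp add: cong_def)
    hence "[a = b] (mod p)" using assms by (simp add: not_dvd_iff_coprime cong_mult_rcancel_nat coprime_commute)
    thus "a = b" using ab by (simp add: cong_def)
  qed
  moreover have "(\<lambda>a. a * n mod p) ` {..<p} \<subseteq> {..<p}" using p_pos by auto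
  ultimately show ?thesis by (simp add: bij_betw_def endo_inj_surj)
qed

lemma cis_mod_p: "uroot p (int (a mod p)) = uroot p (int a)"
proof -
  have "real a = real p * real (a div p) + real (a mod p)"
    by (metis mult_div_mod_eq of_nat_add of_nat_mult)
  hence "2 * pi * of_int (int a) / p = 2 * pi * of_int (int (a mod p)) / p + 2 * pi * of_int (int (a div p))"
    using p_pos by (simp add: field_simps)
  thus ?thesis by (simp only: cis_mult[symmetric] cis_2pi_of_int mult_1_right)
qed

text \<open>The conjugate in \<open>gauss\<close> makes the substitution of \<open>a * n\<close> for
  \<open>a\<close> bring out \<open>chi k n\<close> itself, so this is the Fourier expansion of the
  character. For \<open>p dvd n\<close> both sides vanish by orthogonality.\<close>

lemma gauss_mult:
  assumes "\<not> m dvd k"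
  shows "gauss k n = chi k n * gauss k 1"
proof (cases "p dvd n")
  case True
  then obtain t where t: "n = p * t" by (elim dvdE)
  have "gauss k n = (\<Sum>a<p. cnj (chi k a))"
    unfolding gauss_def
  proof (rule sum.cong[OF refl])
    fix a
    have "2 * pi * of_int (int a * int n) / p = 2 * pi * of_int (int a * int t)"
      using p_pos by (simp add: t)
    thus "cnj (chi k a) * uroot p (int a * int n) = cnj (chi k a)"
      by (simp only: cis_2pi_of_int mult_1_right)
  qed
  also have "\<dots> = 0" using sum_chi[OF assms] by (simp flip: cnj_sum)
  finally show ?thesis using True by (simp add: chi_dvd)
next
  case False
  have "chi k n * gauss k 1 = (\<Sum>a<p. chi k n * (cnj (chi k a) * uroot p (int a)))"
    by (simp add: gauss_def sum_distrib_left)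
  also have "\<dots> = (\<Sum>a<p. chi k n * (cnj (chi k (a * n mod p)) * uroot p (int (a * n mod p))))"
    by (rule sum.reindex_bij_betw[OF mult_mod_bij[OF False], symmetric])
  also have "\<dots> = gauss k n"
    unfolding gauss_def
  proof (rule sum.cong[OF refl])
    fix a
    have "chi k (a * n mod p) = chi k a * chi k n"
      using chi_cong[of "a * n mod p" "a * n" k] by (simp add: chi_mult cong_def)
    moreover have "chi k n * cnj (chi k n) = 1"
      using norm_chi[of k n] False by (simp add: complex_norm_square[symmetric])
    ultimately have "chi k n * cnj (chi k (a * n mod p)) = cnj (chi k a)"
      by (simp add: mult_ac)
    moreover have "uroot p (int (a * n mod p)) = uroot p (int a * int n)"
      using cis_mod_p[of "a * n"] by (simp only: of_nat_mult)
    ultimately show "chi k n * (cnj (chi k (a * n mod p)) * uroot p (int (a * n mod p)))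
       = cnj (chi k a) * uroot p (int a * int n)" by (simp only: mult.assoc[symmetric])
  qed
  finally show ?thesis by simp
qed

lemma sum_norm_chi: "(\<Sum>a<p. (cmod (chi k a))\<^sup>2) = m"
proof -
  have "(\<Sum>a\<in>{1..<p}. (cmod (chi k a))\<^sup>2) = (\<Sum>a\<in>{1..<p}. 1)"
    by (rule sum.cong) (auto simp: norm_chi dest: dvd_imp_le)
  hence "(\<Sum>a<p. (cmod (chi k a))\<^sup>2) = (\<Sum>a\<in>{1..<p}. 1)"
    by (simp add: sum_less_p norm_chi)
  thus ?thesis by (simp add: m_def of_nat_diff)
qed

text \<open>Parseval for the conjugate character: by \<open>gauss_mult\<close> its Fourier transform
  has constant modulus off the multiples of \<open>p\<close>, so \<open>p * m\<close> is
  \<open>m\<close> times the squared modulus.\<close>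

lemma norm_gauss:
  assumes "\<not> m dvd k"
  shows "cmod (gauss k 1) = sqrt p"
proof -
  have "p * (\<Sum>a<p. (cmod (cnj (chi k a)))\<^sup>2) = (\<Sum>n<p. (cmod (gauss k n))\<^sup>2)"
    unfolding gauss_def by (rule parseval_mod[OF p_pos, symmetric])
  also have "\<dots> = (\<Sum>n<p. (cmod (chi k n))\<^sup>2 * (cmod (gauss k 1))\<^sup>2)"
    by (subst gauss_mult[OF assms]) (simp add: norm_mult power_mult_distrib)
  also have "\<dots> = m * (cmod (gauss k 1))\<^sup>2"
    by (simp only: sum_distrib_right[symmetric] sum_norm_chi)
  finally have "p = (cmod (gauss k 1))\<^sup>2"
    using m_pos by (simp add: sum_norm_chi)
  thus ?thesis by (metis norm_ge_zero real_sqrt_unique)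
qed

section \<open>Fejer kernel and smoothed windows\<close>

definition fejer :: "nat \<Rightarrow> nat \<Rightarrow> real" where
  "fejer N a = (cmod (\<Sum>i<N. uroot p (int a * int i)))\<^sup>2"

lemma fejer_nonneg: "fejer N a \<ge> 0"
  by (simp add: fejer_def)

lemma sum_fejer:
  assumes "N \<le> p"
  shows "(\<Sum>a<p. fejer N a) = real p * N"
proof -
  define F :: "nat \<Rightarrow> complex" where "F = (\<lambda>i. if i < N then 1 else 0)"
  have "(\<Sum>i<p. F i * uroot p (int i * int a)) = (\<Sum>i<N. uroot p (int a * int i))" for a
    using assms by (intro sum.mono_neutral_cong_right) (auto simp: F_def mult.commute)
  hence "(\<Sum>a<p. fejer N a) = p * (\<Sum>i<p. (cmod (F i))\<^sup>2)"
    unfolding fejer_def using parseval_mod[OF p_pos, of F] by simp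
  also have "(\<Sum>i<p. (cmod (F i))\<^sup>2) = (\<Sum>i<N. 1)"
    using assms by (intro sum.mono_neutral_cong_right) (auto simp: F_def)
  finally show ?thesis by simp
qed

lemma cis_neg_mod_p:
  assumes "a \<le> p"
  shows "uroot p (int (p - a) * j) = cnj (uroot p (int a * j))"
proof -
  have "2 * pi * of_int (int (p - a) * j) / p = 2 * pi * of_int j + - (2 * pi * of_int (int a * j) / p)"
    using assms p_pos by (simp add: of_nat_diff field_simps)
  thus ?thesis by (simp only: cis_mult[symmetric] cis_2pi_of_int mult_1_left cis_cnj)
qed

lemma fejer_neg:
  assumes "a \<le> p"
  shows "fejer N (p - a) = fejer N a"
proof -
  have "(\<Sum>i<N. uroot p (int (p - a) * int i)) = cnj (\<Sum>i<N. uroot p (int a * int i))"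
    by (simp only: cis_neg_mod_p[OF assms] cnj_sum)
  thus ?thesis unfolding fejer_def by (simp only: complex_mod_cnj)
qed

text \<open>The difference \<open>i - j = t\<close> occurs with the triangular weight
  \<open>N - \<bar>t\<bar>\<close>. Its Fourier transform is the Fejer kernel, nonnegative and of
  total mass \<open>p * N\<close>, so the Polya-Vinogradov bound comes out without a logarithm. For
  \<open>N \<le> s\<close> the subtraction is never truncated.\<close>

definition window_sum :: "nat \<Rightarrow> nat \<Rightarrow> nat \<Rightarrow> complex" where
  "window_sum s N k = (\<Sum>i<N. \<Sum>j<N. chi k (s + i - j))"

lemma gauss_window_sum:
  assumes "\<not> m dvd k" "N \<le> s"
  shows "gauss k 1 * window_sum s N k
    = (\<Sum>a\<in>{1..<p}. of_real (fejer N a) * (cnj (chi k a) * uroot p (int a * int s)))"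
proof -
  let ?e = "\<lambda>j :: int. uroot p j"
  have "gauss k 1 * window_sum s N k = (\<Sum>i<N. \<Sum>j<N. gauss k (s + i - j))"
    unfolding window_sum_def sum_distrib_left
    by (subst (2) gauss_mult[OF assms(1)]) (simp only: mult.commute)
  also have "\<dots> = (\<Sum>i<N. \<Sum>j<N. \<Sum>a<p. cnj (chi k a) * ?e (int a * int s) * (?e (int a * int i) * cnj (?e (int a * int j))))"
    unfolding gauss_def
  proof (intro sum.cong refl)
    fix i j a assume "j \<in> {..<N}"
    hence "int a * int (s + i - j) = int a * int s + (int a * int i - int a * int j)"
      using assms by (simp add: of_nat_diff algebra_simps)
    hence "2 * pi * of_int (int a * int (s + i - j)) / p = 2 * pi * of_int (int a * int s) / p +
       (2 * pi * of_int (int a * int i) / p + - (2 * pi * of_int (int a * int j) / p))"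
      by (simp add: add_divide_distrib diff_divide_distrib distrib_left right_diff_distrib)
    thus "cnj (chi k a) * ?e (int a * int (s + i - j)) = cnj (chi k a) * ?e (int a * int s) * (?e (int a * int i) * cnj (?e (int a * int j)))"
      by (simp only: cis_mult[symmetric] cis_cnj mult.assoc)
  qed
  also have "\<dots> = (\<Sum>i<N. \<Sum>a<p. \<Sum>j<N. cnj (chi k a) * ?e (int a * int s) * (?e (int a * int i) * cnj (?e (int a * int j))))"
    by (rule sum.cong[OF refl], rule sum.swap)
  also have "\<dots> = (\<Sum>a<p. \<Sum>i<N. \<Sum>j<N. cnj (chi k a) * ?e (int a * int s) * (?e (int a * int i) * cnj (?e (int a * int j))))"
    by (rule sum.swap)
  also have "\<dots> = (\<Sum>a<p. of_real (fejer N a) * (cnj (chi k a) * ?e (int a * int s)))"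
  proof (rule sum.cong[OF refl])
    fix a
    have "(\<Sum>i<N. \<Sum>j<N. cnj (chi k a) * ?e (int a * int s) * (?e (int a * int i) * cnj (?e (int a * int j))))
        = cnj (chi k a) * ?e (int a * int s) * ((\<Sum>i<N. ?e (int a * int i)) * cnj (\<Sum>j<N. ?e (int a * int j)))"
    proof -
      have "(\<Sum>i<N. ?e (int a * int i)) * cnj (\<Sum>j<N. ?e (int a * int j)) = (\<Sum>i<N. \<Sum>j<N. ?e (int a * int i) * cnj (?e (int a * int j)))"
        by (simp only: cnj_sum sum_product)
      thus ?thesis by (simp only: sum_distrib_left)
    qed
    also have "(\<Sum>i<N. ?e (int a * int i)) * cnj (\<Sum>j<N. ?e (int a * int j)) = of_real (fejer N a)"
      unfolding fejer_def by (simp only: complex_norm_square)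
    finally show "(\<Sum>i<N. \<Sum>j<N. cnj (chi k a) * ?e (int a * int s) * (?e (int a * int i) * cnj (?e (int a * int j))))
      = of_real (fejer N a) * (cnj (chi k a) * ?e (int a * int s))"
      by (simp only: mult.commute)
  qed
  also have "\<dots> = (\<Sum>a\<in>{1..<p}. of_real (fejer N a) * (cnj (chi k a) * ?e (int a * int s)))"
    by (subst sum_less_p) (simp add: chi_dvd)
  finally show ?thesis .
qed

definition trig_weight :: "nat \<Rightarrow> nat \<Rightarrow> nat \<Rightarrow> real" where
  "trig_weight s k a = (if even k then \<bar>cos (2 * pi * of_int (int a * int s) / p)\<bar> else \<bar>sin (2 * pi * of_int (int a * int s) / p)\<bar>)"

text \<open>The frequencies \<open>a\<close> and \<open>p - a\<close> are paired: the Fejer kernel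
  is even and the character contributes the sign \<open>(-1)^k\<close>, so the exponential becomes
  twice a cosine or \<open>2 * \<i>\<close> times a sine.\<close>

lemma norm_window_sum_le:
  assumes "\<not> m dvd k" "N \<le> s"
  shows "sqrt p * cmod (window_sum s N k) \<le> (\<Sum>a\<in>{1..<p}. fejer N a * trig_weight s k a)"
proof -
  let ?e = "\<lambda>j :: int. uroot p j"
  let ?G = "\<lambda>a. of_real (fejer N a) * (cnj (chi k a) * (?e (int a * int s) + (-1) ^ k * cnj (?e (int a * int s))))"
  define h where "h = (\<lambda>a. of_real (fejer N a) * (cnj (chi k a) * ?e (int a * int s)))"
  have bij: "bij_betw (\<lambda>a. p - a) {1..<p} {1..<p}"
    by (rule bij_betwI[where g = "\<lambda>a. p - a"]) auto
  have "2 * (gauss k 1 * window_sum s N k) = (\<Sum>a\<in>{1..<p}. h a) + (\<Sum>a\<in>{1..<p}. h (p - a))"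
  proof -
    have "gauss k 1 * window_sum s N k = (\<Sum>a\<in>{1..<p}. h a)"
      unfolding h_def by (rule gauss_window_sum[OF assms])
    moreover have "(\<Sum>a\<in>{1..<p}. h (p - a)) = (\<Sum>a\<in>{1..<p}. h a)"
      by (rule sum.reindex_bij_betw[OF bij])
    ultimately show ?thesis by simp
  qed
  also have "\<dots> = (\<Sum>a\<in>{1..<p}. ?G a)"
    unfolding sum.distrib[symmetric]
  proof (rule sum.cong[OF refl])
    fix a assume "a \<in> {1..<p}"
    hence a: "a < p" "a > 0" by auto
    have "h (p - a) = of_real (fejer N a) * (cnj (chi k a) * ((-1) ^ k * cnj (?e (int a * int s))))"
      unfolding h_def cis_neg_mod_p[OF less_imp_le[OF a(1)]] fejer_neg[OF less_imp_le[OF a(1)]] chi_uminus[OF a]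
      by (simp add: mult_ac)
    thus "h a + h (p - a) = ?G a"
      unfolding h_def by (simp only: distrib_left)
  qed
  finally have "cmod (2 * (gauss k 1 * window_sum s N k)) \<le>
    (\<Sum>a\<in>{1..<p}. cmod (?G a))"
    by (simp only: norm_sum)
  also have "\<dots> \<le> (\<Sum>a\<in>{1..<p}. 2 * (fejer N a * trig_weight s k a))"
  proof (rule sum_mono)
    fix a assume "a \<in> {1..<p}"
    have tr: "cmod (cis t + (-1) ^ k * cnj (cis t)) = 2 * (if even k then \<bar>cos t\<bar> else \<bar>sin t\<bar>)" for t
    proof (cases "even k")
      case True
      hence "cis t + (-1) ^ k * cnj (cis t) = of_real (2 * cos t)" by (simp add: complex_eq_iff)
      thus ?thesis using True by (simp only: norm_of_real) (simp add: abs_mult)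
    next
      case False
      hence "cis t + (-1) ^ k * cnj (cis t) = \<i> * of_real (2 * sin t)" by (simp add: complex_eq_iff)
      thus ?thesis using False by (simp only: norm_mult norm_of_real norm_ii) (simp add: abs_mult)
    qed
    have "cmod (?G a)
      = fejer N a * (cmod (chi k a) * (2 * trig_weight s k a))"
      unfolding norm_mult[of "of_real _"] norm_mult[of "cnj _"] tr trig_weight_def norm_of_real complex_mod_cnj
      by (simp only: abs_of_nonneg[OF fejer_nonneg])
    also have "\<dots> \<le> fejer N a * (1 * (2 * trig_weight s k a))"
      by (intro mult_left_mono mult_right_mono) (auto simp: norm_chi trig_weight_def fejer_def)
    finally show "cmod (?G a)
       \<le> 2 * (fejer N a * trig_weight s k a)" by simp
  qed
  finally have "2 * (sqrt p * cmod (window_sum s N k)) \<le> 2 * (\<Sum>a\<in>{1..<p}. fejer N a * trig_weight s k a)"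
    by (simp only: norm_mult norm_gauss[OF assms(1)] norm_numeral sum_distrib_left)
  thus ?thesis by simp
qed

lemma sum_fejer_weight_le:
  assumes "N \<le> p" and w: "\<And>a. w a \<le> c" and c: "c \<ge> 0"
  shows "(\<Sum>a\<in>{1..<p}. fejer N a * w a) \<le> c * (real p * N)"
proof -
  have "(\<Sum>a\<in>{1..<p}. fejer N a * w a) \<le> (\<Sum>a\<in>{1..<p}. fejer N a * c)"
    by (intro sum_mono mult_left_mono w) (simp add: fejer_def)
  also have "\<dots> \<le> (\<Sum>a<p. fejer N a * c)"
    by (intro sum_mono2) (auto simp: fejer_def c)
  also have "\<dots> = c * (real p * N)"
    using sum_fejer[OF assms(1)] by (simp add: sum_distrib_right[symmetric])
  finally show ?thesis .
qed

lemma norm_window_sum_le_sqrt: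
  assumes "\<not> m dvd k" "N \<le> s" "N \<le> p"
  shows "cmod (window_sum s N k) \<le> sqrt p * N"
proof -
  have "sqrt p * cmod (window_sum s N k) \<le> 1 * (real p * N)"
    by (rule order_trans[OF norm_window_sum_le[OF assms(1,2)] sum_fejer_weight_le[OF assms(3)]])
       (auto simp: trig_weight_def)
  also have "\<dots> = sqrt p * (sqrt p * N)" by (simp flip: mult.assoc)
  finally show ?thesis using p_pos by simp
qed

text \<open>Even and odd characters are weighted by \<open>\<bar>cos\<bar>\<close> and \<open>\<bar>sin\<bar>\<close> of the same angle, which is
  why they cannot both attain the bound \<open>sqrt p * N\<close>.\<close>

lemma window_sum_parity_bound:
  assumes "N \<le> s" "N \<le> p"
  obtains A B where "A \<ge> 0" "B \<ge> 0" "A + B \<le> sqrt 2 * (sqrt p * N)"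
    "\<And>k. \<not> m dvd k \<Longrightarrow> cmod (window_sum s N k) \<le> (if even k then A else B)"
proof -
  define A B where "A = (\<Sum>a\<in>{1..<p}. fejer N a * trig_weight s 0 a) / sqrt p"
    and "B = (\<Sum>a\<in>{1..<p}. fejer N a * trig_weight s 1 a) / sqrt p"
  show thesis
  proof (rule that[of A B])
    show "A \<ge> 0" "B \<ge> 0"
      unfolding A_def B_def by (intro divide_nonneg_nonneg sum_nonneg mult_nonneg_nonneg; simp add: fejer_def trig_weight_def)+
    have cs: "\<bar>cos t\<bar> + \<bar>sin t\<bar> \<le> sqrt 2" for t :: real
    proof (rule real_le_rsqrt)
      have "0 \<le> (\<bar>cos t\<bar> - \<bar>sin t\<bar>)\<^sup>2" by simp
      hence "2 * \<bar>cos t\<bar> * \<bar>sin t\<bar> \<le> (cos t)\<^sup>2 + (sin t)\<^sup>2" by (simp add: power2_diff)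
      moreover have "(\<bar>cos t\<bar> + \<bar>sin t\<bar>)\<^sup>2 = (cos t)\<^sup>2 + (sin t)\<^sup>2 + 2 * \<bar>cos t\<bar> * \<bar>sin t\<bar>"
        by (simp add: power2_sum)
      ultimately show "(\<bar>cos t\<bar> + \<bar>sin t\<bar>)\<^sup>2 \<le> 2" by simp
    qed
    have "A + B = (\<Sum>a\<in>{1..<p}. fejer N a * (trig_weight s 0 a + trig_weight s 1 a)) / sqrt p"
      unfolding A_def B_def by (simp add: add_divide_distrib sum.distrib distrib_left)
    also have "\<dots> \<le> (sqrt 2 * (real p * N)) / sqrt p"
      by (intro divide_right_mono sum_fejer_weight_le assms) (auto simp: trig_weight_def cs)
    also have "real p * N = sqrt p * (sqrt p * N)" by (simp flip: mult.assoc)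
    finally show "A + B \<le> sqrt 2 * (sqrt p * N)" using p_pos by simp
    fix k assume "\<not> m dvd k"
    from norm_window_sum_le[OF this assms(1), THEN divide_right_mono, of "sqrt p"]
    show "cmod (window_sum s N k) \<le> (if even k then A else B)"
      using p_pos by (auto simp: A_def B_def trig_weight_def)
  qed
qed

end

section \<open>The sieve as an operator on the character side\<close>

text \<open>Characters of exponent \<open>m\<close> are indexed by frequencies \<open>k\<close>, those of order dividing \<open>l\<close> by the
  multiples of \<open>m div l\<close>.  Averaging over the latter detects divisibility of the discrete logarithm by \<open>l\<close>.\<close>

definition freq_avg :: "nat \<Rightarrow> nat \<Rightarrow> (nat \<Rightarrow> 'a :: real_normed_field) \<Rightarrow> nat \<Rightarrow> 'a" where
  "freq_avg m l \<Psi> k = (\<Sum>i<l. \<Psi> (k + i * (m div l))) / of_nat l"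

primrec avg :: "nat \<Rightarrow> nat list \<Rightarrow> (nat \<Rightarrow> 'a :: real_normed_field) \<Rightarrow> nat \<Rightarrow> 'a" where
  "avg m [] \<Psi> = \<Psi>"
| "avg m (l # ls) \<Psi> = avg m ls (freq_avg m l \<Psi>)"

primrec sift :: "nat \<Rightarrow> nat list \<Rightarrow> (nat \<Rightarrow> 'a :: real_normed_field) \<Rightarrow> nat \<Rightarrow> 'a" where
  "sift m [] \<Psi> = \<Psi>"
| "sift m (l # ls) \<Psi> = sift m ls (\<lambda>k. \<Psi> k - freq_avg m l \<Psi> k)"

text \<open>\<open>sift_norm\<close> has the absolute values of the coefficients of \<open>sift\<close>.\<close>

primrec sift_norm :: "nat \<Rightarrow> nat list \<Rightarrow> (nat \<Rightarrow> real) \<Rightarrow> nat \<Rightarrow> real" where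
  "sift_norm m [] \<Phi> = \<Phi>"
| "sift_norm m (l # ls) \<Phi> = sift_norm m ls (\<lambda>k. (1 - 2 / l) * \<Phi> k + freq_avg m l \<Phi> k)"

lemma freq_avg_linear:
  "freq_avg m l (\<lambda>k. a * \<Psi> k + b * \<Psi>' k) = (\<lambda>k. a * freq_avg m l \<Psi> k + b * freq_avg m l \<Psi>' k)"
  by (simp add: freq_avg_def fun_eq_iff sum.distrib sum_distrib_left[symmetric] add_divide_distrib)

lemma freq_avg_sum:
  "freq_avg m l (\<lambda>k. \<Sum>x\<in>X. \<Psi> x k) = (\<lambda>k. \<Sum>x\<in>X. freq_avg m l (\<Psi> x) k)"
proof
  fix k
  show "freq_avg m l (\<lambda>k. \<Sum>x\<in>X. \<Psi> x k) k = (\<Sum>x\<in>X. freq_avg m l (\<Psi> x) k)"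
    unfolding freq_avg_def by (subst sum.swap) (simp add: sum_divide_distrib)
qed

lemma freq_avg_mono:
  fixes \<Phi> \<Phi>' :: "nat \<Rightarrow> real"
  assumes "\<And>k. \<Phi> k \<le> \<Phi>' k"
  shows "freq_avg m l \<Phi> k \<le> freq_avg m l \<Phi>' k"
  unfolding freq_avg_def by (intro divide_right_mono sum_mono assms) auto

lemma avg_linear:
  "avg m ls (\<lambda>k. a * \<Psi> k + b * \<Psi>' k) = (\<lambda>k. a * avg m ls \<Psi> k + b * avg m ls \<Psi>' k)"
  by (induction ls arbitrary: \<Psi> \<Psi>') (simp_all add: freq_avg_linear)

lemma sift_linear:
  "sift m ls (\<lambda>k. a * \<Psi> k + b * \<Psi>' k) = (\<lambda>k. a * sift m ls \<Psi> k + b * sift m ls \<Psi>' k)"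
proof (induction ls arbitrary: \<Psi> \<Psi>')
  case (Cons l ls)
  have "(\<lambda>k. a * \<Psi> k + b * \<Psi>' k - freq_avg m l (\<lambda>k. a * \<Psi> k + b * \<Psi>' k) k)
    = (\<lambda>k. a * (\<Psi> k - freq_avg m l \<Psi> k) + b * (\<Psi>' k - freq_avg m l \<Psi>' k))"
    by (simp add: freq_avg_linear fun_eq_iff algebra_simps)
  thus ?case by (simp add: Cons)
qed simp

lemma sift_norm_linear:
  "sift_norm m ls (\<lambda>k. a * \<Phi> k + b * \<Phi>' k) = (\<lambda>k. a * sift_norm m ls \<Phi> k + b * sift_norm m ls \<Phi>' k)"
proof (induction ls arbitrary: \<Phi> \<Phi>')
  case (Cons l ls)
  have "(\<lambda>k. (1 - 2 / l) * (a * \<Phi> k + b * \<Phi>' k) + freq_avg m l (\<lambda>k. a * \<Phi> k + b * \<Phi>' k) k)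
    = (\<lambda>k. a * ((1 - 2 / l) * \<Phi> k + freq_avg m l \<Phi> k) + b * ((1 - 2 / l) * \<Phi>' k + freq_avg m l \<Phi>' k))"
    by (simp add: freq_avg_linear fun_eq_iff algebra_simps)
  thus ?case by (simp only: sift_norm.simps Cons)
qed simp

lemma sift_norm_sum:
  "sift_norm m ls (\<lambda>k. \<Sum>x\<in>X. \<Phi> x k) = (\<lambda>k. \<Sum>x\<in>X. sift_norm m ls (\<Phi> x) k)"
proof (induction ls arbitrary: \<Phi>)
  case (Cons l ls)
  have "(\<lambda>k. (1 - 2 / l) * (\<Sum>x\<in>X. \<Phi> x k) + freq_avg m l (\<lambda>k. \<Sum>x\<in>X. \<Phi> x k) k)
    = (\<lambda>k. \<Sum>x\<in>X. (1 - 2 / l) * \<Phi> x k + freq_avg m l (\<Phi> x) k)"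
    by (simp only: freq_avg_sum fun_eq_iff sum.distrib sum_distrib_left) simp
  thus ?case by (simp only: sift_norm.simps Cons)
qed simp

lemma sift_norm_mono:
  assumes "\<And>k. \<Phi> k \<le> \<Phi>' k" "\<forall>l\<in>set ls. l \<ge> 2"
  shows "sift_norm m ls \<Phi> k \<le> sift_norm m ls \<Phi>' k"
  using assms
proof (induction ls arbitrary: \<Phi> \<Phi>')
  case (Cons l ls)
  have "1 - 2 / real l \<ge> 0" using Cons.prems by simp
  thus ?case unfolding sift_norm.simps
    by (intro Cons.IH add_mono mult_left_mono freq_avg_mono) (use Cons.prems in auto)
qed simp

text \<open>Subtracting the average leaves the coefficient \<open>1 - 1 / l\<close> at the frequency
  itself and \<open>-1 / l\<close> at the \<open>l - 1\<close> others. In absolute value this is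
  \<open>1 - 2 / l\<close> times the identity plus the average.\<close>

lemma norm_sift_le:
  assumes "\<forall>l\<in>set ls. l \<ge> 2"
  shows "norm (sift m ls \<Psi> k) \<le> sift_norm m ls (\<lambda>k. norm (\<Psi> k)) k"
  using assms
proof (induction ls arbitrary: \<Psi>)
  case (Cons l ls)
  have l: "l \<ge> 2" using Cons.prems by simp
  have "norm (sift m (l # ls) \<Psi> k) \<le> sift_norm m ls (\<lambda>k. norm (\<Psi> k - freq_avg m l \<Psi> k)) k"
    using Cons by simp
  also have "\<dots> \<le> sift_norm m ls (\<lambda>k. (1 - 2 / l) * norm (\<Psi> k) + freq_avg m l (\<lambda>k. norm (\<Psi> k)) k) k"
  proof (rule sift_norm_mono)
    fix k
    define d where "d = m div l"
    have sp: "(\<Sum>i<l. f i) = f 0 + (\<Sum>i\<in>{1..<l}. f i)" for f :: "nat \<Rightarrow> 'c :: comm_monoid_add"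
      using l by (simp add: lessThan_atLeast0 sum.atLeast_Suc_lessThan)
    have "\<Psi> k - freq_avg m l \<Psi> k = of_real (1 - 1 / l) * \<Psi> k - (\<Sum>i\<in>{1..<l}. \<Psi> (k + i * d)) / of_nat l"
      unfolding freq_avg_def sp d_def using l by (simp add: field_simps)
    also have "norm \<dots> \<le> norm (of_real (1 - 1 / l) * \<Psi> k) + norm ((\<Sum>i\<in>{1..<l}. \<Psi> (k + i * d)) / of_nat l)"
      by (rule norm_triangle_ineq4)
    also have "\<dots> \<le> (1 - 1 / l) * norm (\<Psi> k) + (\<Sum>i\<in>{1..<l}. norm (\<Psi> (k + i * d))) / l"
    proof (rule add_mono)
      show "norm (of_real (1 - 1 / l) * \<Psi> k) \<le> (1 - 1 / l) * norm (\<Psi> k)"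
        unfolding norm_mult norm_of_real using l by simp
      show "norm ((\<Sum>i\<in>{1..<l}. \<Psi> (k + i * d)) / of_nat l) \<le> (\<Sum>i\<in>{1..<l}. norm (\<Psi> (k + i * d))) / l"
        unfolding norm_divide norm_of_nat by (intro divide_right_mono norm_sum) simp
    qed
    also have "\<dots> = (1 - 2 / l) * norm (\<Psi> k) + freq_avg m l (\<lambda>k. norm (\<Psi> k)) k"
      unfolding freq_avg_def sp d_def using l by (simp add: field_simps)
    finally show "norm (\<Psi> k - freq_avg m l \<Psi> k) \<le> (1 - 2 / l) * norm (\<Psi> k) + freq_avg m l (\<lambda>k. norm (\<Psi> k)) k" .
  qed (use Cons.prems in auto)
  finally show ?case by simp
qed simp

text \<open>Expanding the composition of the operators \<open>(1 - 2 / l) * id + freq_avg\<close>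
  gives a nonnegative combination of averages over subsets \<open>T\<close> of \<open>ls\<close>, of
  total weight the product of \<open>2 - 2 / l\<close>.\<close>

lemma sift_norm_le_avg:
  assumes "\<forall>l\<in>set ls. l \<ge> 2" "Y \<ge> 0" "\<And>T. set T \<subseteq> set ls \<Longrightarrow> distinct T \<Longrightarrow> avg m T \<Phi> k \<le> Y" "distinct ls"
  shows "sift_norm m ls \<Phi> k \<le> (\<Prod>l\<leftarrow>ls. 2 - 2 / real l) * Y"
  using assms
proof (induction ls arbitrary: \<Phi> Y)
  case Nil
  thus ?case using Nil(3)[of "[]"] by simp
next
  case (Cons l ls)
  have l: "1 - 2 / real l \<ge> 0" using Cons.prems by simp
  have "sift_norm m ls (\<lambda>k. (1 - 2 / l) * \<Phi> k + freq_avg m l \<Phi> k) k \<le> (\<Prod>l\<leftarrow>ls. 2 - 2 / real l) * ((2 - 2 / l) * Y)"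
  proof (rule Cons.IH)
    show "(2 - 2 / l) * Y \<ge> 0" by (rule mult_nonneg_nonneg) (use l Cons.prems in linarith)+
    fix T assume T: "set T \<subseteq> set ls" "distinct T"
    have "avg m T (\<lambda>k. (1 - 2 / l) * \<Phi> k + 1 * freq_avg m l \<Phi> k) k = (1 - 2 / l) * avg m T \<Phi> k + 1 * avg m (l # T) \<Phi> k"
      by (simp only: avg_linear avg.simps)
    also have "\<dots> \<le> (1 - 2 / l) * Y + 1 * Y"
      by (intro add_mono mult_left_mono Cons.prems l) (use T Cons.prems in auto)
    finally show "avg m T (\<lambda>k. (1 - 2 / l) * \<Phi> k + freq_avg m l \<Phi> k) k \<le> (2 - 2 / l) * Y"
      by (simp add: algebra_simps)
  qed (use Cons.prems in auto)
  thus ?case by (simp add: mult_ac)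
qed

lemma sift_norm_const:
  "\<forall>l\<in>set ls. l > 0 \<Longrightarrow> sift_norm m ls (\<lambda>k. c) k = (\<Prod>l\<leftarrow>ls. 2 - 2 / real l) * c"
proof (induction ls arbitrary: c)
  case (Cons l ls)
  have "(\<lambda>k. (1 - 2 / l) * c + freq_avg m l (\<lambda>k. c) k) = (\<lambda>k. (2 - 2 / l) * c)"
    using Cons.prems by (simp add: freq_avg_def fun_eq_iff algebra_simps)
  thus ?case using Cons by (simp add: mult_ac)
qed simp

lemma freq_avg_cis:
  fixes J :: "'y \<Rightarrow> int" and w :: "'y \<Rightarrow> complex"
  assumes "l dvd m" "l > 0" "m > 0"
  shows "freq_avg m l (\<lambda>k. \<Sum>y\<in>Y. w y * uroot m (int k * J y))
    = (\<lambda>k. \<Sum>y\<in>Y. (if int l dvd J y then w y else 0) * uroot m (int k * J y))"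
proof
  fix k
  have e: "uroot m (int (k + i * (m div l)) * j)
    = uroot m (int k * j) * uroot l (int i * j)" for i and j :: int
  proof -
    obtain t where t: "m = l * t" using assms by (elim dvdE)
    have "2 * pi * of_int (int (k + i * (m div l)) * j) / m
      = 2 * pi * of_int (int k * j) / m + 2 * pi * of_int (int i * j) / l"
      using assms(2,3) by (simp add: t field_simps)
    thus ?thesis by (simp only: cis_mult)
  qed
  have "freq_avg m l (\<lambda>k. \<Sum>y\<in>Y. w y * uroot m (int k * J y)) k
    = (\<Sum>y\<in>Y. \<Sum>i<l. w y * (uroot m (int k * J y) * uroot l (int i * J y))) / of_nat l"
    unfolding freq_avg_def e by (subst sum.swap) (rule refl)
  also have "\<dots> = (\<Sum>y\<in>Y. w y * uroot m (int k * J y) * (\<Sum>i<l. uroot l (int i * J y)) / of_nat l)"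
    unfolding sum_divide_distrib[of _ Y]
    by (intro sum.cong refl arg_cong[where f = "\<lambda>x. x / of_nat l"]) (simp only: sum_distrib_left mult.assoc)
  also have "\<dots> = (\<Sum>y\<in>Y. (if int l dvd J y then w y else 0) * uroot m (int k * J y))"
    by (rule sum.cong[OF refl], subst sum_cis_roots_of_unity[OF assms(2)]) (use assms(2) in simp)
  finally show "freq_avg m l (\<lambda>k. \<Sum>y\<in>Y. w y * uroot m (int k * J y)) k
    = (\<Sum>y\<in>Y. (if int l dvd J y then w y else 0) * uroot m (int k * J y))" .
qed

lemma sift_cis:
  fixes J :: "'y \<Rightarrow> int" and w :: "'y \<Rightarrow> complex"
  assumes "\<forall>l\<in>set ls. l dvd m" "m > 0"
  shows "sift m ls (\<lambda>k. \<Sum>y\<in>Y. w y * uroot m (int k * J y))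
    = (\<lambda>k. \<Sum>y\<in>Y. (if \<exists>l\<in>set ls. int l dvd J y then 0 else w y) * uroot m (int k * J y))"
  using assms(1)
proof (induction ls arbitrary: w)
  case (Cons l ls)
  have l: "l dvd m" "l > 0" using Cons.prems assms(2) by (auto intro: dvd_pos_nat)
  have "(\<lambda>k. (\<Sum>y\<in>Y. w y * uroot m (int k * J y)) -
      freq_avg m l (\<lambda>k. \<Sum>y\<in>Y. w y * uroot m (int k * J y)) k)
    = (\<lambda>k. \<Sum>y\<in>Y. (if int l dvd J y then 0 else w y) * uroot m (int k * J y))"
    unfolding freq_avg_cis[OF l assms(2)] sum_subtractf[symmetric]
    by (intro ext sum.cong refl) auto
  hence "sift m (l # ls) (\<lambda>k. \<Sum>y\<in>Y. w y * uroot m (int k * J y))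
    = sift m ls (\<lambda>k. \<Sum>y\<in>Y. (if int l dvd J y then 0 else w y) * uroot m (int k * J y))"
    by (simp only: sift.simps)
  also have "\<dots> = (\<lambda>k. \<Sum>y\<in>Y. (if \<exists>l\<in>set ls. int l dvd J y then 0 else if int l dvd J y then 0 else w y) * uroot m (int k * J y))"
    by (rule Cons.IH) (use Cons.prems in auto)
  also have "\<dots> = (\<lambda>k. \<Sum>y\<in>Y. (if \<exists>l\<in>set (l # ls). int l dvd J y then 0 else w y) * uroot m (int k * J y))"
    by (intro ext sum.cong refl) auto
  finally show ?case .
qed simp

lemma avg_cis:
  fixes J :: "'y \<Rightarrow> int" and w :: "'y \<Rightarrow> complex"
  assumes "\<forall>l\<in>set ls. l dvd m" "m > 0"
  shows "avg m ls (\<lambda>k. \<Sum>y\<in>Y. w y * uroot m (int k * J y))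
    = (\<lambda>k. \<Sum>y\<in>Y. (if \<forall>l\<in>set ls. int l dvd J y then w y else 0) * uroot m (int k * J y))"
  using assms(1)
proof (induction ls arbitrary: w)
  case (Cons l ls)
  have l: "l dvd m" "l > 0" using Cons.prems assms(2) by (auto intro: dvd_pos_nat)
  have "avg m (l # ls) (\<lambda>k. \<Sum>y\<in>Y. w y * uroot m (int k * J y))
    = avg m ls (\<lambda>k. \<Sum>y\<in>Y. (if int l dvd J y then w y else 0) * uroot m (int k * J y))"
    by (simp only: avg.simps freq_avg_cis[OF l assms(2)])
  also have "\<dots> = (\<lambda>k. \<Sum>y\<in>Y. (if \<forall>l\<in>set ls. int l dvd J y then if int l dvd J y then w y else 0 else 0) * uroot m (int k * J y))"
    by (rule Cons.IH) (use Cons.prems in auto)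
  also have "\<dots> = (\<lambda>k. \<Sum>y\<in>Y. (if \<forall>l\<in>set (l # ls). int l dvd J y then w y else 0) * uroot m (int k * J y))"
    by (intro ext sum.cong refl) auto
  finally show ?case .
qed simp

text \<open>The frequencies whose character has order prime to all elements of \<open>L\<close>.\<close>

definition coprime_freqs :: "nat \<Rightarrow> nat set \<Rightarrow> nat set" where
  "coprime_freqs m L = {k. \<exists>d. m dvd d * k \<and> (\<forall>l\<in>L. coprime d l)}"

text \<open>If the character of frequency \<open>k\<close> has order prime to \<open>l\<close>, then
  of the shifts \<open>k + i * (m div l)\<close> with \<open>i < l\<close> only \<open>i = 0\<close>
  can give the principal character. This follows the principal contribution through successive
  averagings.\<close>

lemma freq_avg_unit:
  fixes \<Psi> :: "nat \<Rightarrow> 'a :: real_normed_field"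
  assumes l: "prime l" "l dvd m" "l \<notin> L" and m: "m > 0" and L: "\<And>q. q \<in> L \<Longrightarrow> prime q"
    and \<Psi>: "\<And>k. k \<in> coprime_freqs m L \<Longrightarrow> \<Psi> k = (if m dvd k then c else 0)"
    and k: "k \<in> coprime_freqs m (insert l L)"
  shows "freq_avg m l \<Psi> k = (if m dvd k then c / of_nat l else 0)"
proof -
  obtain d where d: "m dvd d * k" "coprime d l" "\<And>q. q \<in> L \<Longrightarrow> coprime d q"
    using k by (auto simp: coprime_freqs_def)
  obtain t where t: "m = l * t" using l by (elim dvdE)
  have t0: "t > 0" "l > 0" using m t by auto
  have "\<Psi> (k + i * (m div l)) = (if i = 0 \<and> m dvd k then c else 0)" if "i < l" for i
  proof -
    have "m dvd (d * l) * (k + i * (m div l))"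
    proof -
      have "(d * l) * (k + i * (m div l)) = l * (d * k) + d * i * m" using t t0 by (simp add: algebra_simps)
      thus ?thesis using d by simp
    qed
    moreover have "coprime (d * l) q" if "q \<in> L" for q
      using d(3)[OF that] L[OF that] l that by (metis coprime_mult_left_iff primes_coprime)
    ultimately have "k + i * (m div l) \<in> coprime_freqs m L" unfolding coprime_freqs_def by blast
    hence "\<Psi> (k + i * (m div l)) = (if m dvd k + i * (m div l) then c else 0)" by (rule \<Psi>)
    moreover have "i = 0" if dv: "m dvd k + i * (m div l)"
    proof -
      have "m dvd d * (k + i * (m div l))" using dv by simp
      hence "m dvd d * i * t" using d(1) t t0 by (simp add: distrib_left dvd_add_right_iff mult.assoc)
      hence "l dvd d * i" using t t0 by simp
      hence "l dvd i" using d(2) by (simp add: coprime_commute coprime_dvd_mult_right_iff)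
      thus "i = 0" using \<open>i < l\<close> by (meson dvd_imp_le gr0I leD)
    qed
    ultimately show ?thesis by auto
  qed
  hence "(\<Sum>i<l. \<Psi> (k + i * (m div l))) = (\<Sum>i<l. if i = 0 then if m dvd k then c else 0 else 0)"
    by (intro sum.cong) auto
  also have "\<dots> = (if m dvd k then c else 0)" using t0 by simp
  finally show ?thesis by (simp add: freq_avg_def)
qed

lemma coprime_freqs_mono: "L \<subseteq> L' \<Longrightarrow> coprime_freqs m L' \<subseteq> coprime_freqs m L"
  by (auto simp: coprime_freqs_def)

lemma sift_unit_aux:
  fixes \<Psi> :: "nat \<Rightarrow> 'a :: real_normed_field"
  assumes "\<forall>l\<in>set ls. prime l \<and> l dvd m \<and> l \<notin> L" "distinct ls" "m > 0" "\<And>q. q \<in> L \<Longrightarrow> prime q"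
    and "\<And>k. k \<in> coprime_freqs m L \<Longrightarrow> \<Psi> k = (if m dvd k then c else 0)"
    and "k \<in> coprime_freqs m (L \<union> set ls)"
  shows "sift m ls \<Psi> k = (if m dvd k then c * of_real (\<Prod>l\<leftarrow>ls. 1 - 1 / real l) else 0)"
  using assms
proof (induction ls arbitrary: L \<Psi> c)
  case (Cons l ls)
  have "sift m ls (\<lambda>k. \<Psi> k - freq_avg m l \<Psi> k) k
    = (if m dvd k then (c - c / of_nat l) * of_real (\<Prod>l\<leftarrow>ls. 1 - 1 / real l) else 0)"
  proof (rule Cons.IH[where L = "insert l L"])
    fix k assume k: "k \<in> coprime_freqs m (insert l L)"
    hence "k \<in> coprime_freqs m L" using coprime_freqs_mono[of L "insert l L"] by blast
    thus "\<Psi> k - freq_avg m l \<Psi> k = (if m dvd k then c - c / of_nat l else 0)"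
      using freq_avg_unit[OF _ _ _ Cons.prems(3,4,5) k] Cons.prems by simp
  qed (use Cons.prems in auto)
  thus ?case by (simp add: algebra_simps)
qed auto

lemma sift_unit:
  fixes c :: "'a :: real_normed_field"
  assumes "\<forall>l\<in>set ls. prime l \<and> l dvd m" "distinct ls" "m > 0" "k \<in> coprime_freqs m (set ls)"
  shows "sift m ls (\<lambda>k. if m dvd k then c else 0) k = (if m dvd k then c * of_real (\<Prod>l\<leftarrow>ls. 1 - 1 / real l) else 0)"
  by (rule sift_unit_aux[where L = "{}"]) (use assms in auto)

lemma avg_unit_aux:
  fixes \<Psi> :: "nat \<Rightarrow> 'a :: real_normed_field"
  assumes "\<forall>l\<in>set ls. prime l \<and> l dvd m \<and> l \<notin> L" "distinct ls" "m > 0" "\<And>q. q \<in> L \<Longrightarrow> prime q"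
    and "\<And>k. k \<in> coprime_freqs m L \<Longrightarrow> \<Psi> k = (if m dvd k then c else 0)"
    and "k \<in> coprime_freqs m (L \<union> set ls)"
  shows "avg m ls \<Psi> k = (if m dvd k then c / of_nat (\<Prod>l\<leftarrow>ls. l) else 0)"
  using assms
proof (induction ls arbitrary: L \<Psi> c)
  case (Cons l ls)
  have "avg m ls (freq_avg m l \<Psi>) k = (if m dvd k then (c / of_nat l) / of_nat (\<Prod>l\<leftarrow>ls. l) else 0)"
  proof (rule Cons.IH[where L = "insert l L"])
    fix k assume k: "k \<in> coprime_freqs m (insert l L)"
    show "freq_avg m l \<Psi> k = (if m dvd k then c / of_nat l else 0)"
      using freq_avg_unit[OF _ _ _ Cons.prems(3,4,5) k] Cons.prems by simp
  qed (use Cons.prems in auto)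
  thus ?case by simp
qed auto

lemma avg_unit:
  fixes c :: "'a :: real_normed_field"
  assumes "\<forall>l\<in>set ls. prime l \<and> l dvd m" "distinct ls" "m > 0"
  shows "avg m ls (\<lambda>k. if m dvd k then c else 0) 0 = c / of_nat (\<Prod>l\<leftarrow>ls. l)"
proof -
  have "0 \<in> coprime_freqs m ({} \<union> set ls)" by (auto simp: coprime_freqs_def intro: exI[of _ 1])
  from avg_unit_aux[of ls m "{}" "\<lambda>k. if m dvd k then c else 0" c 0, OF _ assms(2,3) _ _ this] assms(1)
  show ?thesis by simp
qed

text \<open>A bound for the sieve weights in absolute value: they are the exact sieve by
  \<open>E\<close> times 1 minus the number of \<open>l \<in> S\<close> dividing the logarithm, and
  the principal parts \<open>1 / l\<close> of the indicators are collected in the first term.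
  Keeping \<open>i = 0\<close> in the inner sums enlarges the constant slightly, but makes them
  averages over subgroups.\<close>

definition sieve_norm :: "nat \<Rightarrow> nat list \<Rightarrow> nat set \<Rightarrow> (nat \<Rightarrow> real) \<Rightarrow> real" where
  "sieve_norm m E S \<Phi> = (1 - (\<Sum>l\<in>S. 1 / real l)) * sift_norm m E \<Phi> 0
     + (\<Sum>l\<in>S. (\<Sum>i<l. sift_norm m E \<Phi> (i * (m div l))) / real l)"

lemma avg_of_real:
  "avg m ls (\<lambda>k. of_real (\<Phi> k) :: complex) = (\<lambda>k. of_real (avg m ls \<Phi> k))"
proof (induction ls arbitrary: \<Phi>)
  case (Cons l ls)
  have "freq_avg m l (\<lambda>k. of_real (\<Phi> k) :: complex) = (\<lambda>k. of_real (freq_avg m l \<Phi> k))"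
    by (simp add: freq_avg_def fun_eq_iff)
  thus ?case by (simp add: Cons)
qed simp

lemma sieve_norm_mono:
  assumes "\<And>k. \<Phi> k \<le> \<Phi>' k" "\<forall>l\<in>set E. l \<ge> 2" "(\<Sum>l\<in>S. 1 / real l) \<le> 1"
  shows "sieve_norm m E S \<Phi> \<le> sieve_norm m E S \<Phi>'"
  unfolding sieve_norm_def
  by (intro add_mono mult_left_mono sum_mono divide_right_mono sift_norm_mono assms) (use assms in auto)

lemma sieve_norm_linear:
  "sieve_norm m E S (\<lambda>k. a * \<Phi> k + b * \<Phi>' k) = a * sieve_norm m E S \<Phi> + b * sieve_norm m E S \<Phi>'"
proof -
  have "(\<Sum>l\<in>S. (\<Sum>i<l. a * sift_norm m E \<Phi> (i * (m div l)) + b * sift_norm m E \<Phi>' (i * (m div l))) / real l)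
    = a * (\<Sum>l\<in>S. (\<Sum>i<l. sift_norm m E \<Phi> (i * (m div l))) / real l)
      + b * (\<Sum>l\<in>S. (\<Sum>i<l. sift_norm m E \<Phi>' (i * (m div l))) / real l)"
    by (simp only: sum.distrib sum_distrib_left add_divide_distrib times_divide_eq_right)
  thus ?thesis unfolding sieve_norm_def sift_norm_linear by (simp add: algebra_simps)
qed

lemma sieve_norm_sum:
  "sieve_norm m E S (\<lambda>k. \<Sum>x\<in>X. \<Phi> x k) = (\<Sum>x\<in>X. sieve_norm m E S (\<Phi> x))"
proof -
  have "(\<Sum>l\<in>S. (\<Sum>i<l. \<Sum>x\<in>X. sift_norm m E (\<Phi> x) (i * (m div l))) / real l)
    = (\<Sum>x\<in>X. \<Sum>l\<in>S. (\<Sum>i<l. sift_norm m E (\<Phi> x) (i * (m div l))) / real l)"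
    by (subst sum.swap, intro sum.cong refl, subst sum.swap) (rule sum_divide_distrib)
  thus ?thesis unfolding sieve_norm_def sift_norm_sum by (simp add: sum.distrib sum_distrib_left)
qed

lemma sieve_norm_const:
  assumes "\<forall>l\<in>set E. l > 0" "\<forall>l\<in>S. l > 0"
  shows "sieve_norm m E S (\<lambda>k. c) = (\<Prod>l\<leftarrow>E. 2 - 2 / real l) * (1 - (\<Sum>l\<in>S. 1 / real l) + card S) * c"
proof -
  have "(\<Sum>l\<in>S. (\<Sum>i<l. (\<Prod>l\<leftarrow>E. 2 - 2 / real l) * c) / real l) = (\<Sum>l\<in>S. (\<Prod>l\<leftarrow>E. 2 - 2 / real l) * c)"
    using assms(2) by (intro sum.cong) auto
  thus ?thesis unfolding sieve_norm_def sift_norm_const[OF assms(1)] by (simp add: algebra_simps)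
qed

text \<open>Only averages of \<open>\<Phi>\<close> over subgroups of characters enter, so no pointwise bound is required.\<close>

lemma sieve_norm_le_avg:
  assumes E: "\<forall>l\<in>set E. l \<ge> 2" "distinct E" and S: "(\<Sum>l\<in>S. 1 / real l) \<le> 1" "\<forall>l\<in>S. l \<notin> set E"
    and Y: "Y \<ge> 0" "\<And>T. set T \<subseteq> set E \<union> S \<Longrightarrow> distinct T \<Longrightarrow> avg m T \<Phi> 0 \<le> Y"
  shows "sieve_norm m E S \<Phi> \<le> (\<Prod>l\<leftarrow>E. 2 - 2 / real l) * (1 - (\<Sum>l\<in>S. 1 / real l) + card S) * Y"
proof -
  have 1: "sift_norm m E \<Phi> 0 \<le> (\<Prod>l\<leftarrow>E. 2 - 2 / real l) * Y"
    by (rule sift_norm_le_avg[OF E(1) Y(1) _ E(2)]) (use Y(2) in auto)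
  have shift: "sift_norm m ls \<Phi> k = sift_norm m ls (\<lambda>j. \<Phi> (j + k)) 0" for ls k and \<Phi> :: "nat \<Rightarrow> real"
  proof (induction ls arbitrary: \<Phi>)
    case (Cons l ls)
    have "freq_avg m l \<Phi> (j + k) = freq_avg m l (\<lambda>j. \<Phi> (j + k)) j" for j
      by (simp add: freq_avg_def add_ac)
    thus ?case by (simp add: Cons)
  qed simp
  have 2: "(\<Sum>i<l. sift_norm m E \<Phi> (i * (m div l))) / real l \<le> (\<Prod>l\<leftarrow>E. 2 - 2 / real l) * Y" if l: "l \<in> S" for l
  proof -
    have "(\<Sum>i<l. sift_norm m E \<Phi> (i * (m div l))) / real l = sift_norm m E (\<lambda>k. \<Sum>i<l. (1 / real l) * \<Phi> (k + i * (m div l)) + 0 * \<Phi> k) 0"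
      unfolding sift_norm_sum sift_norm_linear shift[of _ _ "_ * _"] by (simp add: sum_divide_distrib)
    also have "(\<lambda>k. \<Sum>i<l. (1 / real l) * \<Phi> (k + i * (m div l)) + 0 * \<Phi> k) = freq_avg m l \<Phi>"
      by (simp add: freq_avg_def fun_eq_iff sum_divide_distrib)
    also have "sift_norm m E (freq_avg m l \<Phi>) 0 \<le> (\<Prod>l\<leftarrow>E. 2 - 2 / real l) * Y"
    proof (rule sift_norm_le_avg[OF E(1) Y(1) _ E(2)])
      fix T assume "set T \<subseteq> set E" "distinct T"
      thus "avg m T (freq_avg m l \<Phi>) 0 \<le> Y" using Y(2)[of "l # T"] l S(2) by auto
    qed
    finally show ?thesis .
  qed
  have "sieve_norm m E S \<Phi> \<le> (1 - (\<Sum>l\<in>S. 1 / real l)) * ((\<Prod>l\<leftarrow>E. 2 - 2 / real l) * Y) + (\<Sum>l\<in>S. (\<Prod>l\<leftarrow>E. 2 - 2 / real l) * Y)"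
    unfolding sieve_norm_def by (intro add_mono mult_left_mono sum_mono 1 2) (use S in auto)
  thus ?thesis by (simp add: algebra_simps)
qed

section \<open>From the absence of primitive roots to large character sums\<close>

context primroot_prime
begin

lemma residue_primroot_if_dlog:
  assumes "\<not> p dvd n" "\<And>l. prime l \<Longrightarrow> l dvd m \<Longrightarrow> \<not> l dvd dlog n"
  shows "residue_primroot p n"
proof -
  have "coprime (dlog n) m"
  proof (rule ccontr)
    assume "\<not> coprime (dlog n) m"
    hence "gcd (dlog n) m \<noteq> 1" by (simp only: coprime_iff_gcd_eq_1 not_False_eq_True)
    then obtain l where "prime l" "l dvd gcd (dlog n) m"
      using prime_factor_nat by blast
    thus False using assms(2)[of l] by simp
  qed
  hence "ord p (\<gamma> ^ dlog n) = m"
    using ord_power_aux[of p \<gamma> "dlog n"] by (simp add: ord_gamma)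
  hence "ord p n = m" using ord_cong[OF dlog_cong[OF assms(1)]] by simp
  thus ?thesis using assms(1) p_pos by (simp add: residue_primroot_def totient_p not_dvd_iff_coprime)
qed

text \<open>The functional \<open>F\<close> is evaluated twice. On the points, each \<open>y\<close>
  surviving the sieve by \<open>E\<close> contributes 1 minus the number of \<open>l \<in> S\<close>
  dividing its logarithm, which is at most 0 unless \<open>n y\<close> is a primitive root. On the
  frequencies, the principal ones contribute the positive main term, which the remaining ones
  therefore have to cancel.\<close>

theorem sieve_inequality:
  fixes Y :: "'y set" and n :: "'y \<Rightarrow> nat"
  assumes E: "\<forall>l\<in>set E. prime l \<and> l dvd m" "distinct E"
    and S: "finite S" "\<forall>l\<in>S. prime l \<and> l dvd m \<and> l \<notin> set E" "(\<Sum>l\<in>S. 1 / real l) \<le> 1"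
    and all: "\<And>l. prime l \<Longrightarrow> l dvd m \<Longrightarrow> l \<in> set E \<union> S"
    and Y: "finite Y" "\<And>y. y \<in> Y \<Longrightarrow> \<not> residue_primroot p (n y)"
  shows "card {y\<in>Y. \<not> p dvd n y} * (\<Prod>l\<leftarrow>E. 1 - 1 / real l) * (1 - (\<Sum>l\<in>S. 1 / real l))
    \<le> sieve_norm m E S (\<lambda>k. if m dvd k then 0 else cmod (\<Sum>y\<in>Y. chi k (n y)))"
proof -
  define w :: "'y \<Rightarrow> complex" where "w = (\<lambda>y. if p dvd n y then 0 else 1)"
  define J where "J = (\<lambda>y. int (dlog (n y)))"
  define \<Psi> where "\<Psi> = (\<lambda>k. \<Sum>y\<in>Y. chi k (n y))"
  define \<theta> where "\<theta> = (\<Prod>l\<leftarrow>E. 1 - 1 / real l)"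
  define \<delta> where "\<delta> = 1 - (\<Sum>l\<in>S. 1 / real l)"
  define c where "c = card {y\<in>Y. \<not> p dvd n y}"
  have \<Psi>: "\<Psi> = (\<lambda>k. \<Sum>y\<in>Y. w y * uroot m (int k * J y))"
    unfolding \<Psi>_def by (intro ext sum.cong refl) (simp add: chi_def w_def J_def)
  have cw: "(\<Sum>y\<in>Y. w y) = of_nat c"
    unfolding w_def c_def using Y(1) by (simp add: sum.If_cases Int_def)
  define \<Psi>0 where "\<Psi>0 = (\<lambda>k. if m dvd k then of_nat c else (0 :: complex))"
  define \<Psi>1 where "\<Psi>1 = (\<lambda>k. if m dvd k then 0 else \<Psi> k)"
  have dec: "\<Psi> = (\<lambda>k. 1 * \<Psi>0 k + 1 * \<Psi>1 k)"
  proof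
    fix k
    have "\<Psi> k = of_nat c" if k: "m dvd k"
    proof -
      obtain t where "k = m * t" using k by (elim dvdE)
      hence "2 * pi * of_int (int k * J y) / m = 2 * pi * of_int (int t * J y)" for y
        using m_pos by simp
      thus ?thesis unfolding \<Psi> by (simp only: cis_2pi_of_int mult_1_right cw)
    qed
    thus "\<Psi> k = 1 * \<Psi>0 k + 1 * \<Psi>1 k" by (simp add: \<Psi>0_def \<Psi>1_def)
  qed
  define F where "F = (\<lambda>\<Psi> :: nat \<Rightarrow> complex. sift m E \<Psi> 0 - (\<Sum>l\<in>S. freq_avg m l (sift m E \<Psi>) 0))"
  have Edvd: "\<forall>l\<in>set E. l dvd m" using E by auto
  have "F \<Psi> = F \<Psi>0 + F \<Psi>1"
    unfolding F_def by (subst (1 2) dec) (simp only: sift_linear freq_avg_linear sum.distrib, simp)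
  moreover have "Re (F \<Psi>) \<le> 0"
  proof -
    define v where "v = (\<lambda>y. if \<exists>l\<in>set E. int l dvd J y then 0 else w y)"
    have sv: "sift m E \<Psi> = (\<lambda>k. \<Sum>y\<in>Y. v y * uroot m (int k * J y))"
      unfolding \<Psi> v_def by (rule sift_cis[OF Edvd m_pos])
    have fv: "freq_avg m l (sift m E \<Psi>) 0 = (\<Sum>y\<in>Y. if int l dvd J y then v y else 0)" if "l \<in> S" for l
    proof -
      have "l dvd m" "l > 0" using that S(2) by (auto simp: prime_gt_0_nat)
      from freq_avg_cis[OF this m_pos, of v J Y] show ?thesis unfolding sv by simp
    qed
    have "sift m E \<Psi> 0 = (\<Sum>y\<in>Y. v y)" unfolding sv by simp
    moreover have "(\<Sum>l\<in>S. freq_avg m l (sift m E \<Psi>) 0) = (\<Sum>y\<in>Y. \<Sum>l\<in>S. if int l dvd J y then v y else 0)"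
      by (subst sum.swap) (intro sum.cong refl fv)
    ultimately have "F \<Psi> = (\<Sum>y\<in>Y. v y - (\<Sum>l\<in>S. if int l dvd J y then v y else 0))"
      unfolding F_def sum_subtractf by simp
    hence "Re (F \<Psi>) = (\<Sum>y\<in>Y. Re (v y - (\<Sum>l\<in>S. if int l dvd J y then v y else 0)))"
      by simp
    also have "\<dots> \<le> (\<Sum>y\<in>Y. 0)"
    proof (rule sum_mono)
      fix y assume y: "y \<in> Y"
      show "Re (v y - (\<Sum>l\<in>S. if int l dvd J y then v y else 0)) \<le> 0"
      proof (cases "v y = 0")
        case True
        show ?thesis unfolding True by simp
      next
        case False
        hence v1: "v y = 1" and nd: "\<not> p dvd n y" and nE: "\<not> (\<exists>l\<in>set E. int l dvd J y)"
          by (auto simp: v_def w_def split: if_splits)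
        obtain l where l: "prime l" "l dvd m" "l dvd dlog (n y)"
          using residue_primroot_if_dlog[OF nd] Y(2)[OF y] by blast
        hence lS: "l \<in> S" using all nE by (auto simp: J_def)
        have "1 = (\<Sum>q\<in>{l}. if int q dvd J y then 1 else (0 :: real))" using l by (simp add: J_def)
        also have "\<dots> \<le> (\<Sum>q\<in>S. if int q dvd J y then 1 else 0)"
          by (rule sum_mono2) (use S lS in auto)
        finally show ?thesis unfolding v1 by (simp add: if_distrib cong: if_cong)
      qed
    qed
    finally show ?thesis by simp
  qed
  moreover have "F \<Psi>0 = of_real (c * \<theta> * \<delta>)"
  proof -
    have su: "sift m E \<Psi>0 k = (if m dvd k then of_nat c * of_real \<theta> else 0)" if "k \<in> coprime_freqs m (set E)" for k
      unfolding \<Psi>0_def \<theta>_def by (rule sift_unit[OF E m_pos that])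
    have "0 \<in> coprime_freqs m (set E)" by (auto simp: coprime_freqs_def intro: exI[of _ 1])
    hence "sift m E \<Psi>0 0 = of_nat c * of_real \<theta>" using su by simp
    moreover have "freq_avg m l (sift m E \<Psi>0) 0 = of_nat c * of_real \<theta> / of_nat l" if "l \<in> S" for l
    proof -
      have l: "prime l" "l dvd m" "l \<notin> set E" using that S(2) by auto
      have "0 \<in> coprime_freqs m (insert l (set E))" by (auto simp: coprime_freqs_def intro: exI[of _ 1])
      from freq_avg_unit[OF l m_pos _ su this] E show ?thesis by auto
    qed
    ultimately show ?thesis
      unfolding F_def by (simp add: \<delta>_def right_diff_distrib sum_distrib_left)
  qed
  moreover have "cmod (F \<Psi>1) \<le> sieve_norm m E S (\<lambda>k. cmod (\<Psi>1 k))"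
  proof -
    have E2: "\<forall>l\<in>set E. l \<ge> 2" using E by (auto simp: prime_ge_2_nat)
    note ns = norm_sift_le[OF E2, of m \<Psi>1]
    \<comment> \<open>Moving the principal share \<open>1 / l\<close> of each indicator into
      \<delta> leaves only \<open>i \<ge> 1\<close> in the inner sums.\<close>
    have "F \<Psi>1 = of_real \<delta> * sift m E \<Psi>1 0 + (\<Sum>l\<in>S. (sift m E \<Psi>1 0 - (\<Sum>i<l. sift m E \<Psi>1 (i * (m div l)))) / of_nat l)"
      unfolding F_def freq_avg_def \<delta>_def
      by (simp add: left_diff_distrib diff_divide_distrib sum_subtractf sum_distrib_right)
    also have "cmod \<dots> \<le> \<delta> * sift_norm m E (\<lambda>k. cmod (\<Psi>1 k)) 0
        + (\<Sum>l\<in>S. (\<Sum>i<l. sift_norm m E (\<lambda>k. cmod (\<Psi>1 k)) (i * (m div l))) / real l)"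
    proof (intro order_trans[OF norm_triangle_ineq] add_mono order_trans[OF norm_sum] sum_mono)
      have "\<delta> \<ge> 0" using S by (simp add: \<delta>_def)
      thus "cmod (of_real \<delta> * sift m E \<Psi>1 0) \<le> \<delta> * sift_norm m E (\<lambda>k. cmod (\<Psi>1 k)) 0"
        unfolding norm_mult norm_of_real using ns[of 0] by (simp add: mult_left_mono)
      fix l assume "l \<in> S"
      hence "prime l" using S by auto
      hence l0: "l > 0" by (rule prime_gt_0_nat)
      have "sift m E \<Psi>1 0 - (\<Sum>i<l. sift m E \<Psi>1 (i * (m div l))) = - (\<Sum>i\<in>{1..<l}. sift m E \<Psi>1 (i * (m div l)))"
        using l0 by (simp add: lessThan_atLeast0 sum.atLeast_Suc_lessThan)
      hence "cmod (sift m E \<Psi>1 0 - (\<Sum>i<l. sift m E \<Psi>1 (i * (m div l)))) \<le> (\<Sum>i\<in>{1..<l}. cmod (sift m E \<Psi>1 (i * (m div l))))"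
        by (simp only: norm_minus_cancel norm_sum)
      also have "\<dots> \<le> (\<Sum>i\<in>{1..<l}. sift_norm m E (\<lambda>k. cmod (\<Psi>1 k)) (i * (m div l)))"
        by (intro sum_mono ns)
      also have "\<dots> \<le> (\<Sum>i<l. sift_norm m E (\<lambda>k. cmod (\<Psi>1 k)) (i * (m div l)))"
        by (rule sum_mono2) (auto intro: order_trans[OF norm_ge_zero ns])
      finally show "cmod ((sift m E \<Psi>1 0 - (\<Sum>i<l. sift m E \<Psi>1 (i * (m div l)))) / of_nat l)
        \<le> (\<Sum>i<l. sift_norm m E (\<lambda>k. cmod (\<Psi>1 k)) (i * (m div l))) / real l"
        unfolding norm_divide norm_of_nat by (intro divide_right_mono) auto
    qed
    finally show ?thesis by (simp add: sieve_norm_def \<delta>_def)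
  qed
  moreover have "- cmod (F \<Psi>1) \<le> Re (F \<Psi>1)" using abs_Re_le_cmod[of "F \<Psi>1"] by linarith
  ultimately have "c * \<theta> * \<delta> \<le> sieve_norm m E S (\<lambda>k. cmod (\<Psi>1 k))" by simp
  also have "(\<lambda>k. cmod (\<Psi>1 k)) = (\<lambda>k. if m dvd k then 0 else cmod (\<Sum>y\<in>Y. chi k (n y)))"
    by (simp add: \<Psi>1_def \<Psi>_def fun_eq_iff)
  finally show ?thesis by (simp add: c_def \<theta>_def \<delta>_def)
qed

end

section \<open>Fourth moments of short character sums\<close>

definition quads :: "nat \<Rightarrow> (nat \<times> nat \<times> nat \<times> nat) set" where
  "quads h = {..<h} \<times> {..<h} \<times> {..<h} \<times> {..<h}"

text \<open>Exactly the quadruples without an entry that occurs once. Their ratio of quadratics is 1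
  or the square of a ratio of linear polynomials, and they are only counted trivially.\<close>

definition degenerate_quads :: "nat \<Rightarrow> (nat \<times> nat \<times> nat \<times> nat) set" where
  "degenerate_quads h = {(a, b, c, d) \<in> quads h. {a, b} = {c, d} \<or> a = b \<and> c = d}"

lemma finite_quads: "finite (quads h)" and card_quads: "card (quads h) = h ^ 4"
  by (simp_all add: quads_def card_cartesian_product power_numeral_reduce)

lemma card_degenerate_quads: "card (degenerate_quads h) \<le> 3 * h ^ 2"
proof -
  let ?P = "{..<h} \<times> {..<h}"
  have "degenerate_quads h \<subseteq> (\<lambda>(a, b). (a, b, a, b)) ` ?P \<union> (\<lambda>(a, b). (a, b, b, a)) ` ?P \<union> (\<lambda>(a, b). (a, a, b, b)) ` ?P"
    unfolding degenerate_quads_def quads_def by (auto simp: doubleton_eq_iff image_iff)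
  hence "card (degenerate_quads h) \<le> card ((\<lambda>(a, b). (a, b, a, b)) ` ?P \<union> (\<lambda>(a, b). (a, b, b, a)) ` ?P \<union> (\<lambda>(a, b). (a, a, b, b)) ` ?P)"
    by (intro card_mono) auto
  also have "\<dots> \<le> card ((\<lambda>(a, b). (a, b, a, b)) ` ?P) + card ((\<lambda>(a, b). (a, b, b, a)) ` ?P) + card ((\<lambda>(a, b). (a, a, b, b)) ` ?P)"
    by (meson add_le_mono1 card_Un_le le_trans)
  also have "\<dots> \<le> card ?P + card ?P + card ?P"
    by (intro add_mono card_image_le) auto
  finally show ?thesis by (simp add: card_cartesian_product power2_eq_square)
qed

lemma fourth_power_sum:
  fixes c :: "nat \<Rightarrow> complex"
  shows "of_real (cmod (\<Sum>b<h. c b) ^ 4) = (\<Sum>(b1, b2, b3, b4)\<in>quads h. c b1 * c b2 * cnj (c b3) * cnj (c b4))"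
proof -
  let ?S = "\<Sum>b<h. c b"
  have "of_real (cmod ?S ^ 4) = of_real ((cmod ?S)\<^sup>2) * (of_real ((cmod ?S)\<^sup>2) :: complex)"
    by (simp flip: power_add of_real_mult)
  also have "\<dots> = ?S * (?S * (cnj ?S * cnj ?S))"
    by (simp only: complex_norm_square mult_ac)
  also have "\<dots> = (\<Sum>b1<h. \<Sum>b2<h. \<Sum>b3<h. \<Sum>b4<h. c b1 * (c b2 * (cnj (c b3) * cnj (c b4))))"
  proof -
    define X where "X = (\<Sum>b3<h. \<Sum>b4<h. cnj (c b3) * cnj (c b4))"
    define Z where "Z = ?S * X"
    have "cnj ?S * cnj ?S = X" unfolding X_def by (simp only: cnj_sum sum_product)
    hence "?S * (?S * (cnj ?S * cnj ?S)) = ?S * Z" by (simp only: Z_def)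
    also have "\<dots> = (\<Sum>b1<h. c b1 * Z)" by (rule sum_distrib_right)
    also have "Z = (\<Sum>b2<h. c b2 * X)" unfolding Z_def by (rule sum_distrib_right)
    finally show ?thesis by (simp only: X_def sum_distrib_left)
  qed
  also have "\<dots> = (\<Sum>(b1, b2, b3, b4)\<in>quads h. c b1 * (c b2 * (cnj (c b3) * cnj (c b4))))"
    unfolding quads_def by (simp only: sum.cartesian_product)
  finally show ?thesis by (simp only: mult.assoc)
qed

context primroot_prime
begin

definition short_sum :: "nat \<Rightarrow> nat \<Rightarrow> nat \<Rightarrow> complex" where
  "short_sum h k x = (\<Sum>b<h. chi k (x + b))"

text \<open>The value 0 at principal frequencies removes a term of order \<open>p * h^4\<close>,
  which would spoil averages over small groups of characters.\<close>

definition fourth_moment :: "nat \<Rightarrow> nat \<Rightarrow> real" where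
  "fourth_moment h k = (if m dvd k then 0 else (\<Sum>x<p. cmod (short_sum h k x) ^ 4))"

lemma prod_distinct_primes_dvd:
  assumes "\<forall>l\<in>set T. prime l \<and> l dvd m" "distinct T"
  shows "(\<Prod>l\<leftarrow>T. l) dvd m" "(\<forall>l\<in>set T. int l dvd J) \<Longrightarrow> int (\<Prod>l\<leftarrow>T. l) dvd J"
proof -
  have "(\<forall>l\<in>set T. int l dvd j) \<Longrightarrow> int (\<Prod>l\<leftarrow>T. l) dvd j" for j
    using assms
  proof (induction T)
    case (Cons l T)
    have "coprime l (\<Prod>l\<leftarrow>T. l)"
    proof -
      have "coprime l (prod_list T)"
        using Cons.prems(2,3) by (induction T) (auto intro: primes_coprime)
      thus ?thesis by simp
    qed
    hence "coprime (int l) (int (\<Prod>l\<leftarrow>T. l))" by simp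
    thus ?case using Cons by (simp add: divides_mult)
  qed simp
  from this[of J] this[of "int m"] show "(\<Prod>l\<leftarrow>T. l) dvd m" "(\<forall>l\<in>set T. int l dvd J) \<Longrightarrow> int (\<Prod>l\<leftarrow>T. l) dvd J"
    using assms(1) by auto
qed

text \<open>With \<open>D\<close> the product of \<open>T\<close>, the average counts for each
  quadruple the \<open>x\<close> whose ratio of quadratics is a \<open>D\<close>-th power, minus
  \<open>1 / D\<close> times all admissible \<open>x\<close> because the principal character is left
  out. For nondegenerate quadruples this subtraction cancels the main term \<open>p / D\<close> of
  the Stepanov bound up to \<open>4 / D\<close>; the at most \<open>3 * h^2\<close> degenerate ones
  contribute at most \<open>p\<close> each.\<close>

lemma avg_fourth_moment_le:
  assumes T: "\<forall>l\<in>set T. prime l \<and> l dvd m" "distinct T" and p: "p \<ge> 400" and h: "h < p"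
  shows "avg m T (fourth_moment h) 0 \<le> 3 * real p * real h ^ 2 + 5 * sqrt p * real h ^ 4"
proof (cases "T = []")
  case True
  thus ?thesis by (simp add: fourth_moment_def)
next
  case False
  define D where "D = (\<Prod>l\<leftarrow>T. l)"
  have Dm: "D dvd m" unfolding D_def by (rule prod_distinct_primes_dvd[OF T])
  then obtain g where g: "m = D * g" by (elim dvdE)
  obtain q T' where "T = q # T'" using False by (cases T) auto
  hence "q dvd D" "prime q" using T by (auto simp: D_def)
  moreover have "D > 0" using Dm m_pos by (auto intro: Nat.gr0I)
  ultimately have D2: "D \<ge> 2" by (meson dvd_imp_le le_trans prime_ge_2_nat)
  define Q where "Q = quads h \<times> {..<p}"
  define ok where "ok = (\<lambda>((a, b, c, d), x). \<not> p dvd x + a \<and> \<not> p dvd x + b \<and> \<not> p dvd x + c \<and> \<not> p dvd x + d)"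
  define J where "J = (\<lambda>((a, b, c, d), x). int (dlog (x + a)) + int (dlog (x + b)) - int (dlog (x + c)) - int (dlog (x + d)))"
  define w :: "_ \<Rightarrow> complex" where "w = (\<lambda>y. if ok y then 1 else 0)"
  define M where "M = (\<lambda>k. \<Sum>y\<in>Q. w y * uroot m (int k * J y))"
  have M: "of_real (\<Sum>x<p. cmod (short_sum h k x) ^ 4) = M k" for k
  proof -
    have "of_real (\<Sum>x<p. cmod (short_sum h k x) ^ 4) = (\<Sum>x<p. \<Sum>(a, b, c, d)\<in>quads h. chi k (x + a) * chi k (x + b) * cnj (chi k (x + c)) * cnj (chi k (x + d)))"
      unfolding of_real_sum short_sum_def fourth_power_sum ..
    also have "\<dots> = (\<Sum>b\<in>quads h. \<Sum>x<p. case b of (a, b, c, d) \<Rightarrow> chi k (x + a) * chi k (x + b) * cnj (chi k (x + c)) * cnj (chi k (x + d)))"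
      by (rule sum.swap)
    also have "\<dots> = (\<Sum>(b, x)\<in>Q. case b of (a, b, c, d) \<Rightarrow> chi k (x + a) * chi k (x + b) * cnj (chi k (x + c)) * cnj (chi k (x + d)))"
      unfolding Q_def by (rule sum.cartesian_product)
    also have "\<dots> = M k"
      unfolding M_def
    proof (rule sum.cong[OF refl])
      fix y :: "(nat \<times> nat \<times> nat \<times> nat) \<times> nat"
      obtain a b c d x where y: "y = ((a, b, c, d), x)" by (metis surj_pair)
      show "(case y of (b, x) \<Rightarrow> case b of (a, b, c, d) \<Rightarrow> chi k (x + a) * chi k (x + b) * cnj (chi k (x + c)) * cnj (chi k (x + d)))
        = w y * uroot m (int k * J y)"
      proof (cases "ok y")
        case True
        have "2 * pi * of_int (int k * J y) / m = 2 * pi * of_int (int k * int (dlog (x + a))) / m + 2 * pi * of_int (int k * int (dlog (x + b))) / m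
           + - (2 * pi * of_int (int k * int (dlog (x + c))) / m) + - (2 * pi * of_int (int k * int (dlog (x + d))) / m)"
          using m_pos by (simp add: y J_def field_simps)
        hence "uroot m (int k * J y) = chi k (x + a) * chi k (x + b) * cnj (chi k (x + c)) * cnj (chi k (x + d))"
          using True by (simp only: chi_def cis_mult[symmetric] cis_cnj ok_def y prod.case if_False)
        thus ?thesis using True by (simp add: y w_def)
      next
        case False
        thus ?thesis by (auto simp: y w_def ok_def chi_dvd)
      qed
    qed
    finally show ?thesis .
  qed
  define M0 where "M0 = (\<lambda>k. if m dvd k then (\<Sum>y\<in>Q. w y) else 0)"
  let ?F = "\<lambda>v. (\<Sum>x<p. (if ok (v, x) \<and> (\<forall>l\<in>set T. int l dvd J (v, x)) then 1 else 0) - (if ok (v, x) then 1 else 0) / real D)"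
  have "complex_of_real (fourth_moment h k) = 1 * M k + (-1) * M0 k" for k
  proof (cases "m dvd k")
    case True
    then obtain t where "k = m * t" by (elim dvdE)
    hence "2 * pi * of_int (int k * J y) / m = 2 * pi * of_int (int t * J y)" for y
      using m_pos by simp
    hence "M k = (\<Sum>y\<in>Q. w y)" unfolding M_def by (simp only: cis_2pi_of_int mult_1_right)
    thus ?thesis using True by (simp add: fourth_moment_def M0_def)
  next
    case False
    hence "fourth_moment h k = (\<Sum>x<p. cmod (short_sum h k x) ^ 4)" "M0 k = 0"
      by (simp_all add: fourth_moment_def M0_def)
    thus ?thesis by (simp only: M) simp
  qed
  hence "of_real (avg m T (fourth_moment h) 0) = avg m T (\<lambda>k. 1 * M k + (-1) * M0 k) 0"
    unfolding fun_cong[OF avg_of_real, symmetric] by simp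
  also have "\<dots> = avg m T M 0 - avg m T M0 0" by (simp only: avg_linear) simp
  also have "avg m T M0 0 = (\<Sum>y\<in>Q. w y) / of_nat D"
    unfolding M0_def D_def by (rule avg_unit[OF T m_pos])
  also have "avg m T M 0 = (\<Sum>y\<in>Q. if \<forall>l\<in>set T. int l dvd J y then w y else 0)"
  proof -
    have "\<forall>l\<in>set T. l dvd m" using T by auto
    from avg_cis[OF this m_pos, of w J Q] show ?thesis unfolding M_def by simp
  qed
  also have "(\<Sum>y\<in>Q. if \<forall>l\<in>set T. int l dvd J y then w y else 0) - (\<Sum>y\<in>Q. w y) / of_nat D
    = of_real (\<Sum>y\<in>Q. (if ok y \<and> (\<forall>l\<in>set T. int l dvd J y) then 1 else 0) - (if ok y then 1 else 0) / D)"
    unfolding sum_divide_distrib sum_subtractf[symmetric] of_real_sum w_def by (intro sum.cong) auto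
  finally have "avg m T (fourth_moment h) 0
    = (\<Sum>y\<in>Q. (if ok y \<and> (\<forall>l\<in>set T. int l dvd J y) then 1 else 0) - (if ok y then 1 else 0) / real D)"
    by (simp only: of_real_eq_iff)
  also have "\<dots> = (\<Sum>v\<in>quads h. \<Sum>x<p. (if ok (v, x) \<and> (\<forall>l\<in>set T. int l dvd J (v, x)) then 1 else 0) - (if ok (v, x) then 1 else 0) / real D)"
    unfolding Q_def by (subst sum.cartesian_product) (simp add: case_prod_beta)
  also have "\<dots> \<le> (\<Sum>v\<in>quads h. if v \<in> degenerate_quads h then real p else 5 * sqrt p)"
  proof (rule sum_mono)
    fix v assume v: "v \<in> quads h"
    show "?F v
      \<le> (if v \<in> degenerate_quads h then real p else 5 * sqrt p)"
    proof (cases "v \<in> degenerate_quads h")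
      case True
      have "?F v \<le> (\<Sum>x<p. 1)"
        by (intro sum_mono) (auto intro: order_trans[of _ "0 :: real"])
      thus ?thesis using True by simp
    next
      case False
      obtain a b c d where vv: "v = (a, b, c, d)" by (cases v)
      have lt: "a < p" "b < p" "c < p" "d < p" using v h by (auto simp: vv quads_def)
      have ne: "{a, b} \<noteq> {c, d}" "\<not> (a = b \<and> c = d)" using v False by (auto simp: vv degenerate_quads_def)
      define A where "A = {x. x < p \<and> ok (v, x)}"
      define A' where "A' = {x. x < p \<and> ok (v, x) \<and> (\<forall>l\<in>set T. int l dvd J (v, x))}"
      have fin: "finite A" "finite A'" by (auto simp: A_def A'_def)
      have "?F v
        = real (card A') - real (card A) / D"
        unfolding sum_subtractf sum_divide_distrib[symmetric] A_def A'_def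
        by (simp add: sum.If_cases Int_def lessThan_def)
      also have "\<dots> \<le> (p / D + 4.9 * sqrt p) - (real p - 4) / D"
      proof (rule diff_mono)
        \<comment> \<open>Multiplication by \<open>g\<close> turns divisibility by \<open>D\<close>
          into a congruence of exponents modulo \<open>m = D * g\<close>, that is, into equality of
          \<open>g\<close>-th powers modulo \<open>p\<close>.\<close>
        have "A' \<subseteq> quad_count p g a b c d"
        proof
          fix x assume x: "x \<in> A'"
          hence nd: "\<not> p dvd x + a" "\<not> p dvd x + b" "\<not> p dvd x + c" "\<not> p dvd x + d"
            by (auto simp: A'_def vv ok_def)
          have "int D dvd J (v, x)"
            unfolding D_def using x by (intro prod_distinct_primes_dvd(2)[OF T]) (auto simp: A'_def)
          hence "int (D * g) dvd J (v, x) * int g" by simp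
          also have "J (v, x) * int g = int ((dlog (x + a) + dlog (x + b)) * g) - int ((dlog (x + c) + dlog (x + d)) * g)"
            by (simp add: J_def vv algebra_simps)
          finally have "[(dlog (x + a) + dlog (x + b)) * g = (dlog (x + c) + dlog (x + d)) * g] (mod m)"
            unfolding g by (simp only: cong_iff_dvd_diff flip: cong_int_iff)
          hence "[\<gamma> ^ ((dlog (x + a) + dlog (x + b)) * g) = \<gamma> ^ ((dlog (x + c) + dlog (x + d)) * g)] (mod p)"
            by (simp only: gamma_pow_cong_iff)
          moreover have e: "[(\<gamma> ^ ((dlog (x + a) + dlog (x + b)) * g)) = ((x + a) * (x + b)) ^ g] (mod p)"
            if "\<not> p dvd x + a" "\<not> p dvd x + b" for a b
            unfolding power_mult power_add by (intro cong_pow cong_mult dlog_cong that)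
          ultimately have "[((x + a) * (x + b)) ^ g = ((x + c) * (x + d)) ^ g] (mod p)"
            using e[OF nd(1,2)] e[OF nd(3,4)] by (meson cong_sym cong_trans)
          thus "x \<in> quad_count p g a b c d" using x nd by (simp add: quad_count_def A'_def)
        qed
        hence "card A' \<le> card (quad_count p g a b c d)"
          by (intro card_mono finite_subset[of "quad_count p g a b c d" "{..<p}"]) (auto simp: quad_count_def)
        moreover have "real (card (quad_count p g a b c d)) \<le> p / D + 4.9 * sqrt p"
          by (rule card_quad_count_le[OF prime_p _ D2 lt ne]) (use g in \<open>simp add: m_def mult.commute\<close>)
        ultimately show "real (card A') \<le> p / D + 4.9 * sqrt p" by linarith
        have "{..<p} \<subseteq> A \<union> (\<lambda>a. (p - a) mod p) ` {a, b, c, d}"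
        proof
          fix x assume x: "x \<in> {..<p}"
          show "x \<in> A \<union> (\<lambda>a. (p - a) mod p) ` {a, b, c, d}"
          proof (cases "ok (v, x)")
            case False
            then obtain e where e: "e \<in> {a, b, c, d}" "p dvd x + e" by (auto simp: vv ok_def)
            have "e < p" using e lt by auto
            from e(2) obtain t where t: "x + e = p * t" by (elim dvdE)
            have "t < 2" using t x \<open>e < p\<close> by (smt (verit, best) lessThan_iff mult.commute mult_2 mult_less_mono2 add_less_mono not_less nat_mult_le_cancel_disj linorder_not_le mult_le_cancel1 less_le_trans)
            hence "t = 0 \<or> t = 1" by auto
            hence "x = (p - e) mod p" using t x \<open>e < p\<close> by (cases "e = 0") auto
            thus ?thesis using e by blast
          qed (use x in \<open>auto simp: A_def\<close>)
        qed
        hence "card {..<p} \<le> card (A \<union> (\<lambda>a. (p - a) mod p) ` {a, b, c, d})"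
          using fin by (intro card_mono) auto
        also have "\<dots> \<le> card A + card ((\<lambda>a. (p - a) mod p) ` {a, b, c, d})" by (rule card_Un_le)
        also have "card ((\<lambda>a. (p - a) mod p) ` {a, b, c, d}) \<le> card {a, b, c, d}" by (rule card_image_le) simp
        also have "card {a, b, c, d} \<le> 4" by (simp add: card_insert_if)
        finally have "p \<le> card A + 4" by simp
        thus "(real p - 4) / D \<le> real (card A) / D" by (intro divide_right_mono) auto
      qed
      also have "\<dots> = 4.9 * sqrt p + 4 / D" using D2 by (simp add: field_simps)
      also have "\<dots> \<le> 4.9 * sqrt p + 0.1 * sqrt p"
      proof -
        have "4 / real D \<le> 4 / 2" using D2 by (intro divide_left_mono) auto
        moreover have "sqrt p \<ge> 20" using p by (intro real_le_rsqrt) auto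
        ultimately show ?thesis by simp
      qed
      finally show ?thesis using False by simp
    qed
  qed
  also have "\<dots> = real p * card (degenerate_quads h) + 5 * sqrt p * card (quads h - degenerate_quads h)"
  proof -
    have "quads h \<inter> degenerate_quads h = degenerate_quads h" by (auto simp: degenerate_quads_def)
    moreover have "quads h \<inter> - degenerate_quads h = quads h - degenerate_quads h" by auto
    ultimately show ?thesis using finite_quads by (simp add: sum.If_cases)
  qed
  also have "\<dots> \<le> real p * (3 * h ^ 2) + 5 * sqrt p * h ^ 4"
  proof (intro add_mono mult_left_mono)
    show "real (card (degenerate_quads h)) \<le> 3 * h ^ 2"
      using card_degenerate_quads[of h] by (metis of_nat_le_iff of_nat_mult of_nat_numeral of_nat_power)
    have "card (quads h - degenerate_quads h) \<le> card (quads h)" by (intro card_mono finite_quads) auto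
    thus "real (card (quads h - degenerate_quads h)) \<le> h ^ 4" by (simp add: card_quads flip: of_nat_power)
  qed auto
  finally show ?thesis by simp
qed

end

section \<open>Points near fractions with small denominator\<close>

text \<open>A union bound over the prime divisors of \<open>q\<close>. The primes up to
  \<open>Q\<close> are enlarged to the explicit set \<open>L\<close> of 2 and the odd numbers from 3
  on, whose inverse squares are easy to sum.\<close>

lemma card_coprime_less_ge:
  fixes q :: nat
  assumes q: "1 \<le> q" "q \<le> Q"
  defines "L \<equiv> insert 2 ((\<lambda>j. 2 * j + 1) ` {1..Q})"
  shows "real q - (\<Sum>l\<in>{l\<in>L. l dvd q}. real q / real l) \<le> real (card {t. t < q \<and> coprime t q})"
proof -
  have finL: "finite L" by (simp add: L_def)
  have L0: "l > 0" if "l \<in> L" for l using that by (auto simp: L_def)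
  have "{..<q} \<subseteq> {t. t < q \<and> coprime t q} \<union> (\<Union>l\<in>{l\<in>L. l dvd q}. (\<lambda>i. l * i) ` {..<q div l})"
  proof
    fix t assume t: "t \<in> {..<q}"
    show "t \<in> {t. t < q \<and> coprime t q} \<union> (\<Union>l\<in>{l\<in>L. l dvd q}. (\<lambda>i. l * i) ` {..<q div l})"
    proof (cases "coprime t q")
      case False
      hence "gcd t q \<noteq> 1" by (simp only: coprime_iff_gcd_eq_1 not_False_eq_True)
      then obtain l where "prime l" "l dvd gcd t q" using prime_factor_nat by blast
      hence l: "prime l" "l dvd t" "l dvd q" by auto
      have lQ: "l \<le> Q" using l(3) q by (meson dvd_imp_le le_trans less_le_trans zero_less_one)
      have "l \<in> L"
      proof (cases "l = 2")
        case False
        hence "odd l" using l(1) prime_odd_nat[of l] prime_ge_2_nat[of l] by linarith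
        then obtain j where j: "l = 2 * j + 1" by (elim oddE)
        have "j \<ge> 1" using l(1) j by (cases j) auto
        hence "j \<in> {1..Q}" using j lQ by auto
        thus ?thesis using j by (auto simp: L_def)
      qed (simp add: L_def)
      moreover obtain i where i: "t = l * i" using l(2) by (elim dvdE)
      moreover have "i < q div l"
      proof -
        obtain r where r: "q = l * r" using l(3) by (elim dvdE)
        thus ?thesis using t i l(1) by (simp add: prime_gt_0_nat)
      qed
      ultimately show ?thesis using l by auto
    qed (use t in auto)
  qed
  hence "card {..<q} \<le> card ({t. t < q \<and> coprime t q} \<union> (\<Union>l\<in>{l\<in>L. l dvd q}. (\<lambda>i. l * i) ` {..<q div l}))"
    using finL by (intro card_mono) auto
  also have "\<dots> \<le> card {t. t < q \<and> coprime t q} + card (\<Union>l\<in>{l\<in>L. l dvd q}. (\<lambda>i. l * i) ` {..<q div l})"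
    by (rule card_Un_le)
  also have "card (\<Union>l\<in>{l\<in>L. l dvd q}. (\<lambda>i. l * i) ` {..<q div l}) \<le> (\<Sum>l\<in>{l\<in>L. l dvd q}. card ((\<lambda>i. l * i) ` {..<q div l}))"
    using finL by (intro card_UN_le) auto
  also have "\<dots> \<le> (\<Sum>l\<in>{l\<in>L. l dvd q}. q div l)"
    by (intro sum_mono order_trans[OF card_image_le]) auto
  finally have "q \<le> card {t. t < q \<and> coprime t q} + (\<Sum>l\<in>{l\<in>L. l dvd q}. q div l)" by simp
  hence "real q \<le> real (card {t. t < q \<and> coprime t q}) + (\<Sum>l\<in>{l\<in>L. l dvd q}. real (q div l))"
    by (metis of_nat_add of_nat_le_iff of_nat_sum)
  also have "(\<Sum>l\<in>{l\<in>L. l dvd q}. real (q div l)) = (\<Sum>l\<in>{l\<in>L. l dvd q}. real q / real l)"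
    by (intro sum.cong refl) (auto simp: real_of_nat_div)
  finally show ?thesis by simp
qed

text \<open>With \<open>n = Q div l\<close>, summing the arithmetic progression reduces the claim to
  \<open>0 \<le> (Q - l * n)^2 + l^2 * n\<close>.\<close>

lemma sum_multiples_le:
  fixes Q l :: nat
  assumes l: "l > 0"
  shows "(\<Sum>q\<in>{q\<in>{1..Q}. l dvd q}. real Q - real q) \<le> real Q ^ 2 / (2 * real l)"
proof -
  define n where "n = Q div l"
  have img: "{q\<in>{1..Q}. l dvd q} = (\<lambda>i. l * i) ` {1..n}"
  proof (intro equalityI subsetI)
    fix q assume "q \<in> {q\<in>{1..Q}. l dvd q}"
    then obtain i where i: "q = l * i" "1 \<le> q" "q \<le> Q" by (auto elim!: dvdE)
    have "i \<le> n" unfolding n_def using i l by (simp add: less_eq_div_iff_mult_less_eq mult.commute)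
    moreover have "i \<ge> 1" using i by (cases i) auto
    ultimately show "q \<in> (\<lambda>i. l * i) ` {1..n}" using i by auto
  next
    fix q assume "q \<in> (\<lambda>i. l * i) ` {1..n}"
    then obtain i where "i \<in> {1..n}" "q = l * i" by (elim imageE)
    hence i: "q = l * i" "1 \<le> i" "i \<le> n" by auto
    have "l * i \<le> Q" using i(3) l unfolding n_def by (simp add: less_eq_div_iff_mult_less_eq mult.commute)
    moreover have "1 \<le> l * i" using i l by simp
    ultimately show "q \<in> {q\<in>{1..Q}. l dvd q}" using i by auto
  qed
  have "(\<Sum>q\<in>{q\<in>{1..Q}. l dvd q}. real Q - real q) = (\<Sum>i=1..n. real Q - real l * real i)"
    unfolding img using l by (subst sum.reindex) (auto intro: inj_onI)
  also have "\<dots> = n * real Q - real l * (real n * (real n + 1) / 2)"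
  proof -
    have "2 * (\<Sum>i=1..n. real i) = real n * (real n + 1)" by (induction n) (auto simp: algebra_simps)
    thus ?thesis by (simp add: sum_subtractf sum_distrib_left[symmetric])
  qed
  also have "\<dots> \<le> real Q ^ 2 / (2 * real l)"
  proof -
    have "0 \<le> (real Q - real l * n) ^ 2 + real l ^ 2 * n" by simp
    hence "2 * real l * (n * real Q - real l * (real n * (real n + 1) / 2)) \<le> real Q ^ 2"
      by (simp add: power2_eq_square field_simps)
    thus ?thesis using l by (simp add: pos_le_divide_eq mult_ac)
  qed
  finally show ?thesis .
qed

text \<open>The element 2 contributes 1/4, and
  \<open>1 / (2 * j + 1)^2 \<le> 1 / (4 * j * (j + 1))\<close> telescopes to at most another 1/4.
  Thus half of the main term survives when fractions that are not in lowest terms are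
  discarded.\<close>

lemma sum_inverse_squares_le:
  "(\<Sum>l\<in>insert 2 ((\<lambda>j. 2 * j + 1) ` {1..Q}). 1 / real l ^ 2) \<le> 1 / 2"
proof -
  have "(\<Sum>l\<in>(\<lambda>j. 2 * j + 1) ` {1..Q}. 1 / real l ^ 2) = (\<Sum>j=1..Q. 1 / real (2 * j + 1) ^ 2)"
    by (subst sum.reindex) (auto intro: inj_onI)
  also have "\<dots> \<le> (\<Sum>j=1..Q. 1 / (4 * real j) - 1 / (4 * real (Suc j)))"
  proof (rule sum_mono)
    fix j assume "j \<in> {1..Q}"
    hence j: "real j \<ge> 1" by simp
    have "1 / (4 * real j) - 1 / (4 * real (Suc j)) = 1 / (4 * real j * (real j + 1))"
      using j by (simp add: field_simps)
    also have "1 / real (2 * j + 1) ^ 2 \<le> \<dots>"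
    proof (rule divide_left_mono)
      show "4 * real j * (real j + 1) \<le> real (2 * j + 1) ^ 2" by (simp add: power2_eq_square algebra_simps)
      show "0 < real (2 * j + 1) ^ 2 * (4 * real j * (real j + 1))"
        using j by (intro mult_pos_pos zero_less_power) auto
    qed simp
    finally show "1 / real (2 * j + 1) ^ 2 \<le> 1 / (4 * real j) - 1 / (4 * real (Suc j))" .
  qed
  also have "\<dots> = 1 / 4 - 1 / (4 * real (Suc Q))"
    by (induction Q) auto
  also have "\<dots> \<le> 1 / 4" by simp
  finally have "(\<Sum>l\<in>(\<lambda>j. 2 * j + 1) ` {1..Q}. 1 / real l ^ 2) \<le> 1 / 4" .
  moreover have "(2 :: nat) \<notin> (\<lambda>j. 2 * j + 1) ` {1..Q}" by (rule notI, elim imageE) presburger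
  ultimately show ?thesis by simp
qed

text \<open>For \<open>h \<ge> 1\<close> the inequalities say that
  \<open>q * (x + b) - t * p\<close> lies between 1 and \<open>Q * h\<close> for all
  \<open>b < h\<close>; the extra \<open>q\<close> on the right appears because the last shift is
  \<open>h - 1\<close>.\<close>

definition near_fraction :: "nat \<Rightarrow> nat \<Rightarrow> nat \<Rightarrow> nat \<Rightarrow> nat \<Rightarrow> nat set" where
  "near_fraction p Q h q t = {x. t * p < q * x \<and> q * (x + h) \<le> t * p + Q * h + q}"

lemma card_near_fraction_ge:
  assumes q: "1 \<le> q" "q \<le> Q" and h: "h \<ge> 1"
  shows "finite (near_fraction p Q h q t)" "h * (real Q / q - 1) \<le> card (near_fraction p Q h q t)"
proof -
  define lo where "lo = t * p div q"
  define hi where "hi = (t * p + Q * h) div q"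
  have "near_fraction p Q h q t \<subseteq> {..t * p + Q * h + q}"
  proof
    fix x assume "x \<in> near_fraction p Q h q t"
    hence le: "q * (x + h) \<le> t * p + Q * h + q" by (simp add: near_fraction_def)
    have "x \<le> 1 * (x + h)" by simp
    also have "\<dots> \<le> q * (x + h)" using q by (intro mult_le_mono1)
    also note le
    finally have "x \<le> t * p + Q * h + q" .
    thus "x \<in> {..t * p + Q * h + q}" by simp
  qed
  thus fin: "finite (near_fraction p Q h q t)" by (rule finite_subset) simp
  have qhi: "q * hi \<le> t * p + Q * h" "t * p + Q * h < q * hi + q"
    using q unfolding hi_def by (simp, metis dividend_less_times_div less_le_trans mult.commute zero_less_one add.commute)
  have qlo: "q * lo \<le> t * p" "t * p < q * lo + q"
    using q unfolding lo_def by (simp, metis dividend_less_times_div less_le_trans mult.commute zero_less_one add.commute)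
  have sub: "{lo + 1..<hi + 2 - h} \<subseteq> near_fraction p Q h q t"
  proof
    fix x assume "x \<in> {lo + 1..<hi + 2 - h}"
    hence x: "lo + 1 \<le> x" "x + h \<le> hi + 1" by auto
    have "q * (lo + 1) \<le> q * x" using x by (intro mult_le_mono2)
    moreover have "q * (x + h) \<le> q * (hi + 1)" using x by (intro mult_le_mono2)
    ultimately show "x \<in> near_fraction p Q h q t" using qlo qhi by (simp add: near_fraction_def)
  qed
  have "real q * (real hi - real lo) \<ge> real Q * h - q"
  proof -
    have "real (t * p + Q * h) \<le> real (q * hi + q)" "real (q * lo) \<le> real (t * p)"
      using qhi qlo by (simp_all only: of_nat_le_iff less_imp_le)
    thus ?thesis by (simp add: algebra_simps)
  qed
  hence "real hi - real lo \<ge> (real Q * h - q) / q" using q by (simp add: field_simps)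
  also have "(real Q * h - q) / q = real Q * h / q - 1" using q by (simp add: field_simps)
  finally have "real Q * h / q - h \<le> real hi + 1 - h - lo" by simp
  also have "\<dots> \<le> real (card {lo + 1..<hi + 2 - h})" by simp
  also have "\<dots> \<le> card (near_fraction p Q h q t)" by (simp only: of_nat_le_iff card_mono[OF fin sub])
  finally show "h * (real Q / q - 1) \<le> card (near_fraction p Q h q t)" by (simp add: algebra_simps)
qed

text \<open>The difference of \<open>q' * (q * x - t * p)\<close> and
  \<open>q * (q' * x - t' * p)\<close> is free of \<open>x\<close> and a multiple of
  \<open>p\<close>. Both terms are positive and at most \<open>Q * Q * h < p\<close>, so the
  multiple is 0 and the two reduced fractions agree.\<close>

lemma near_fraction_disjoint:
  assumes "1 \<le> q" "q \<le> Q" "1 \<le> q'" "q' \<le> Q" and h: "h \<ge> 1" and p: "Q * Q * h < p"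
    and c: "coprime t q" "coprime t' q'"
    and x: "x \<in> near_fraction p Q h q t" "x \<in> near_fraction p Q h q' t'"
  shows "q = q' \<and> t = t'"
proof -
  have b: "0 < int q * int x - int t * int p \<and> int q * int x - int t * int p \<le> int Q * int h"
    if "x \<in> near_fraction p Q h q t" "1 \<le> q" for q t
  proof -
    have "t * p < q * x" "q * (x + h) \<le> t * p + Q * h + q" using that by (auto simp: near_fraction_def)
    moreover have "q \<le> q * h" using h by simp
    moreover have "q * (x + h) = q * x + q * h" by (rule distrib_left)
    ultimately have "t * p < q * x" "q * x \<le> t * p + Q * h" by linarith+
    hence "int (t * p) < int (q * x)" "int (q * x) \<le> int (t * p + Q * h)" by linarith+
    thus ?thesis by simp
  qed
  define u where "u = int q * int x - int t * int p"
  define u' where "u' = int q' * int x - int t' * int p"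
  have u: "0 < u" "u \<le> int Q * int h" and u': "0 < u'" "u' \<le> int Q * int h"
    unfolding u_def u'_def using b[OF x(1)] b[OF x(2)] assms by auto
  have "int q' * u \<le> int Q * (int Q * int h)" "int q * u' \<le> int Q * (int Q * int h)"
    using u u' assms by (auto intro!: mult_mono)
  moreover have "0 < int q' * u" "0 < int q * u'" using u u' assms by auto
  moreover have "int Q * (int Q * int h) < int p" using p by (metis mult.assoc of_nat_less_iff of_nat_mult)
  ultimately have "\<bar>int q' * u - int q * u'\<bar> < int p" by linarith
  moreover have "int q' * u - int q * u' = int p * (int q * int t' - int q' * int t)"
    by (simp add: u_def u'_def algebra_simps)
  ultimately have "\<bar>int p\<bar> * \<bar>int q * int t' - int q' * int t\<bar> < int p * 1" by (simp add: abs_mult)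
  hence "\<bar>int q * int t' - int q' * int t\<bar> < 1" by (simp only: abs_of_nat mult_less_cancel_left)
  hence "int q * int t' = int q' * int t" by simp
  hence eq: "q * t' = q' * t" by (metis of_nat_eq_iff of_nat_mult)
  have "q dvd q' * t" by (metis eq dvd_triv_left)
  hence "q dvd q'" using c(1) by (simp add: coprime_commute coprime_dvd_mult_left_iff)
  moreover have "q' dvd q * t'" by (metis eq dvd_triv_left)
  hence "q' dvd q" using c(2) by (simp add: coprime_commute coprime_dvd_mult_left_iff)
  ultimately have "q = q'" by (rule dvd_antisym)
  thus ?thesis using eq assms by simp
qed

definition near_points :: "nat \<Rightarrow> nat \<Rightarrow> nat \<Rightarrow> nat set" where
  "near_points p Q h = (\<Union>q\<in>{1..Q}. \<Union>t\<in>{t. t < q \<and> coprime t q}. near_fraction p Q h q t)"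

lemma near_points_subset:
  assumes p: "Q * Q * h < p" and h: "h \<ge> 1"
  shows "near_points p Q h \<subseteq> {..<p}"
proof
  fix x assume "x \<in> near_points p Q h"
  then obtain q t where q: "1 \<le> q" "q \<le> Q" "t < q" and x: "x \<in> near_fraction p Q h q t"
    by (auto simp: near_points_def)
  have "q * (x + h) \<le> t * p + Q * h + q" using x by (simp add: near_fraction_def)
  moreover have "q \<le> q * h" using h by simp
  moreover have "q * (x + h) = q * x + q * h" by (rule distrib_left)
  ultimately have "q * x \<le> t * p + Q * h" by linarith
  moreover have "Q * h < p"
  proof -
    have "1 * (Q * h) \<le> Q * (Q * h)" using q by (intro mult_le_mono1) simp
    moreover have "Q * (Q * h) = Q * Q * h" by simp
    ultimately show ?thesis using p by linarith
  qed
  moreover have "t * p + p \<le> q * p"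
  proof -
    have "Suc t * p \<le> q * p" using q by (intro mult_le_mono1) simp
    thus ?thesis by simp
  qed
  ultimately have "q * x < q * p" by linarith
  thus "x \<in> {..<p}" by simp
qed

text \<open>By disjointness the count is at least the sum over \<open>q \<le> Q\<close> of
  \<open>\<phi>(q) * h * (Q / q - 1)\<close>. Bounding \<open>\<phi>(q) / q\<close> below by 1 minus
  the sum of \<open>1 / l\<close> over the \<open>l \<in> L\<close> dividing \<open>q\<close> and
  exchanging sums leaves \<open>h * (Q * (Q - 1) / 2 - Q^2 / 4)\<close>.\<close>

lemma card_near_points_ge:
  assumes p: "Q * Q * h < p" and h: "h \<ge> 1"
  shows "real h * real Q * (real Q - 2) / 4 \<le> real (card (near_points p Q h))"
proof -
  define Tq where "Tq = (\<lambda>q. {t. t < q \<and> coprime t (q :: nat)})"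
  define L where "L = insert 2 ((\<lambda>j. 2 * j + 1) ` {1..Q})"
  have finL: "finite L" and L0: "\<And>l. l \<in> L \<Longrightarrow> l > 0" by (auto simp: L_def)
  have fin: "finite (Tq q)" for q by (simp add: Tq_def)
  have "near_points p Q h = (\<Union>(q, t)\<in>Sigma {1..Q} Tq. near_fraction p Q h q t)"
    by (auto simp: near_points_def Tq_def)
  moreover have "card (\<Union>(q, t)\<in>Sigma {1..Q} Tq. near_fraction p Q h q t) = (\<Sum>(q, t)\<in>Sigma {1..Q} Tq. card (near_fraction p Q h q t))"
  proof (subst card_UN_disjoint)
    show "finite (Sigma {1..Q} Tq)" using fin by auto
    show "\<forall>i\<in>Sigma {1..Q} Tq. finite (case i of (q, t) \<Rightarrow> near_fraction p Q h q t)"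
      using card_near_fraction_ge(1)[OF _ _ h] by auto
    show "\<forall>i\<in>Sigma {1..Q} Tq. \<forall>j\<in>Sigma {1..Q} Tq. i \<noteq> j \<longrightarrow> (case i of (q, t) \<Rightarrow> near_fraction p Q h q t) \<inter> (case j of (q, t) \<Rightarrow> near_fraction p Q h q t) = {}"
    proof (intro ballI impI)
      fix i j assume ij: "i \<in> Sigma {1..Q} Tq" "j \<in> Sigma {1..Q} Tq" "i \<noteq> j"
      obtain q t where i: "i = (q, t)" by (cases i)
      obtain q' t' where j: "j = (q', t')" by (cases j)
      have "\<not> (x \<in> near_fraction p Q h q t \<and> x \<in> near_fraction p Q h q' t')" for x
        using near_fraction_disjoint[OF _ _ _ _ h p, of q q' t t' x] ij by (auto simp: i j Tq_def)
      thus "(case i of (q, t) \<Rightarrow> near_fraction p Q h q t) \<inter> (case j of (q, t) \<Rightarrow> near_fraction p Q h q t) = {}"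
        by (auto simp: i j)
    qed
  qed (simp add: case_prod_beta)
  ultimately have "real (card (near_points p Q h)) = (\<Sum>(q, t)\<in>Sigma {1..Q} Tq. real (card (near_fraction p Q h q t)))"
    by (simp add: case_prod_beta)
  also have "\<dots> = (\<Sum>q\<in>{1..Q}. \<Sum>t\<in>Tq q. real (card (near_fraction p Q h q t)))"
    by (rule sum.Sigma[symmetric]) (use fin in auto)
  finally have card_eq: "real (card (near_points p Q h)) = (\<Sum>q\<in>{1..Q}. \<Sum>t\<in>Tq q. real (card (near_fraction p Q h q t)))" .
  have "h * ((real Q * (real Q - 1) / 2) - (real Q ^ 2 / 2) * (1 / 2))
    \<le> h * ((\<Sum>q\<in>{1..Q}. real Q - q) - (\<Sum>q\<in>{1..Q}. \<Sum>l\<in>{l\<in>L. l dvd q}. (real Q - q) / l))"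
  proof (intro mult_left_mono diff_mono)
    have "2 * (\<Sum>i=1..n. real i) = real n * (real n + 1)" for n by (induction n) (auto simp: algebra_simps)
    from this[of Q] show "real Q * (real Q - 1) / 2 \<le> (\<Sum>q\<in>{1..Q}. real Q - q)" by (simp add: sum_subtractf field_simps)
    have "(\<Sum>q\<in>{1..Q}. \<Sum>l\<in>{l\<in>L. l dvd q}. (real Q - q) / l) = (\<Sum>l\<in>L. \<Sum>q\<in>{q\<in>{1..Q}. l dvd q}. (real Q - q) / l)"
      by (rule sum.swap_restrict) (use finL in auto)
    also have "\<dots> \<le> (\<Sum>l\<in>L. (real Q ^ 2 / 2) * (1 / real l ^ 2))"
    proof (rule sum_mono)
      fix l assume "l \<in> L"
      hence l: "l > 0" by (rule L0)
      have "(\<Sum>q\<in>{q\<in>{1..Q}. l dvd q}. (real Q - q) / l) \<le> (real Q ^ 2 / (2 * real l)) / l"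
        unfolding sum_divide_distrib[symmetric] by (intro divide_right_mono sum_multiples_le l) simp
      thus "(\<Sum>q\<in>{q\<in>{1..Q}. l dvd q}. (real Q - q) / l) \<le> (real Q ^ 2 / 2) * (1 / real l ^ 2)"
        by (simp add: power2_eq_square)
    qed
    also have "\<dots> \<le> (real Q ^ 2 / 2) * (1 / 2)"
      unfolding sum_distrib_left[symmetric] L_def by (intro mult_left_mono sum_inverse_squares_le) simp
    finally show "(\<Sum>q\<in>{1..Q}. \<Sum>l\<in>{l\<in>L. l dvd q}. (real Q - q) / l) \<le> (real Q ^ 2 / 2) * (1 / 2)" .
  qed simp
  also have "\<dots> = (\<Sum>q\<in>{1..Q}. (real q - (\<Sum>l\<in>{l\<in>L. l dvd q}. real q / real l)) * (h * (real Q / q - 1)))"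
    unfolding sum_subtractf[symmetric] sum_distrib_left
  proof (rule sum.cong[OF refl])
    fix q assume q: "q \<in> {1..Q}"
    define A where "A = (\<Sum>l\<in>{l\<in>L. l dvd q}. 1 / real l)"
    have e1: "(real q - (\<Sum>l\<in>{l\<in>L. l dvd q}. real q / real l)) = real q * (1 - A)"
      by (simp add: A_def right_diff_distrib sum_distrib_left)
    have e2: "(\<Sum>l\<in>{l\<in>L. l dvd q}. (real Q - q) / l) = (real Q - q) * A"
      by (simp add: A_def sum_distrib_left)
    have e3: "real q * (real Q / q - 1) = real Q - q" using q by (simp add: field_simps)
    have "real q * (1 - A) * (h * (real Q / q - 1)) = h * (1 - A) * (real q * (real Q / q - 1))"
      by (simp only: mult_ac)
    thus "h * (real Q - q - (\<Sum>l\<in>{l\<in>L. l dvd q}. (real Q - q) / l))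
      = (real q - (\<Sum>l\<in>{l\<in>L. l dvd q}. real q / real l)) * (h * (real Q / q - 1))"
      unfolding e1 e2 e3 by (simp add: algebra_simps)
  qed
  also have "\<dots> \<le> (\<Sum>q\<in>{1..Q}. real (card (Tq q)) * (h * (real Q / q - 1)))"
  proof (intro sum_mono mult_right_mono)
    fix q assume q: "q \<in> {1..Q}"
    thus "real q - (\<Sum>l\<in>{l\<in>L. l dvd q}. real q / real l) \<le> real (card (Tq q))"
      unfolding L_def Tq_def by (intro card_coprime_less_ge) auto
    show "0 \<le> h * (real Q / q - 1)" using q by simp
  qed
  also have "\<dots> = (\<Sum>q\<in>{1..Q}. \<Sum>t\<in>Tq q. h * (real Q / q - 1))" by simp
  also have "\<dots> \<le> real (card (near_points p Q h))"
    unfolding card_eq by (intro sum_mono card_near_fraction_ge(2) h) auto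
  finally have le: "h * ((real Q * (real Q - 1) / 2) - (real Q ^ 2 / 2) * (1 / 2)) \<le> real (card (near_points p Q h))" .
  have eq: "h * (real Q * (real Q - 1) / 2 - (real Q ^ 2 / 2) * (1 / 2)) = real h * real Q * (real Q - 2) / 4"
    by (simp add: power2_eq_square field_simps)
  show ?thesis using le unfolding eq .
qed

section \<open>Bounds for intervals without primitive roots\<close>

context primroot_prime
begin

text \<open>\<open>E\<close> lists the prime divisors of \<open>p - 1\<close> that are sieved exactly; the loss for the remaining ones,
  collected in \<open>S\<close>, is additive.\<close>

definition sieve_const :: "nat list \<Rightarrow> nat set \<Rightarrow> real" where
  "sieve_const E S = 2 ^ length E * (card S / (1 - (\<Sum>l\<in>S. 1 / real l)) + 1)"

definition sieve_split :: "nat list \<Rightarrow> nat set \<Rightarrow> bool" where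
  "sieve_split E S \<longleftrightarrow> distinct E \<and> finite S \<and> set E \<inter> S = {} \<and> (\<forall>l. l \<in> set E \<union> S \<longleftrightarrow> prime l \<and> l dvd m)
     \<and> (\<Sum>l\<in>S. 1 / real l) < 1"

context
  fixes E :: "nat list" and S :: "nat set"
  assumes split: "sieve_split E S"
begin

definition theta :: real where "theta = (\<Prod>l\<leftarrow>E. 1 - 1 / real l)"
definition delta :: real where "delta = 1 - (\<Sum>l\<in>S. 1 / real l)"

lemma delta_pos: "delta > 0"
  using split by (simp add: sieve_split_def delta_def)

lemma E_prime: "\<forall>l\<in>set E. prime l \<and> l dvd m" and S_prime: "\<forall>l\<in>S. prime l \<and> l dvd m \<and> l \<notin> set E"
  and split_simps: "distinct E" "finite S" "(\<Sum>l\<in>S. 1 / real l) \<le> 1"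
  and split_all: "\<And>l. prime l \<Longrightarrow> l dvd m \<Longrightarrow> l \<in> set E \<union> S"
  using split unfolding sieve_split_def by (blast, blast, simp_all) 

lemma theta_pos: "theta > 0"
proof -
  have "(\<Prod>l\<leftarrow>ls. 1 - 1 / real l) > 0" if "\<forall>l\<in>set ls. l \<ge> 2" for ls
    using that by (induction ls) auto
  thus ?thesis using E_prime by (simp add: theta_def prime_ge_2_nat)
qed

lemma prod_two_minus: "(\<Prod>l\<leftarrow>E. 2 - 2 / real l) = 2 ^ length E * theta"
proof -
  have "(\<Prod>l\<leftarrow>ls. 2 - 2 / real l) = 2 ^ length ls * (\<Prod>l\<leftarrow>ls. 1 - 1 / real l)" for ls
    by (induction ls) (auto simp: algebra_simps)
  thus ?thesis by (simp add: theta_def)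
qed

lemma sieve_const_eq: "(\<Prod>l\<leftarrow>E. 2 - 2 / real l) * (1 - (\<Sum>l\<in>S. 1 / real l) + card S) = sieve_const E S * theta * delta"
  using delta_pos unfolding prod_two_minus sieve_const_def delta_def[symmetric] by (simp add: field_simps)

lemma sieve_const_pos: "sieve_const E S > 0"
  using delta_pos unfolding sieve_const_def delta_def[symmetric] by (intro mult_pos_pos add_nonneg_pos) auto

lemma sieve_norm_const': "sieve_norm m E S (\<lambda>k. c) = sieve_const E S * theta * delta * c"
  unfolding sieve_const_eq[symmetric] using E_prime S_prime by (intro sieve_norm_const) (auto simp: prime_gt_0_nat)

lemma sieve_ineq:
  fixes Y :: "'y set" and n :: "'y \<Rightarrow> nat"
  assumes "finite Y" "\<And>y. y \<in> Y \<Longrightarrow> \<not> residue_primroot p (n y)"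
  shows "card {y\<in>Y. \<not> p dvd n y} * theta * delta \<le> sieve_norm m E S (\<lambda>k. if m dvd k then 0 else cmod (\<Sum>y\<in>Y. chi k (n y)))"
  unfolding theta_def delta_def
  by (rule sieve_inequality[OF E_prime split_simps(1,2) S_prime split_simps(3) split_all assms])

text \<open>The weighted inequality of means as a sum of squares. For \<open>t > 0\<close> it bounds
  \<open>u\<close> by \<open>3 / 4 * t + u^4 / (4 * t^3)\<close>; used in place of Hoelder's
  inequality, it keeps the estimate linear, which suits \<open>sieve_norm\<close>.\<close>

lemma amgm_fourth: "(4 :: real) * t ^ 3 * u \<le> 3 * t ^ 4 + u ^ 4"
proof -
  have "0 \<le> (u\<^sup>2 - t\<^sup>2)\<^sup>2 + 2 * (t * (u - t))\<^sup>2" by simp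
  also have "\<dots> = 3 * t ^ 4 + u ^ 4 - 4 * t ^ 3 * u"
    by (simp add: power2_eq_square power3_eq_cube power4_eq_xxxx algebra_simps)
  finally show ?thesis by simp
qed

text \<open>At a near point \<open>x\<close> with denominator \<open>q\<close>, the numbers
  \<open>q * (x + b)\<close> with \<open>b < h\<close> are congruent to numbers in
  \<open>1..Q * h\<close>, and \<open>chi k q\<close> has modulus 1. So the sieve inequality forces
  the short sums at every near point to be large, and summing over the near points brings in the
  averaged fourth moments.\<close>

theorem burgess_bound:
  assumes p: "p \<ge> 400" and h: "h \<ge> 1" and Q: "Q * Q * h < p"
    and nr: "\<And>n. 1 \<le> n \<Longrightarrow> n \<le> Q * h \<Longrightarrow> \<not> residue_primroot p n"
  shows "real (card (near_points p Q h)) * real h ^ 4 \<le> sieve_const E S ^ 4 * (3 * real p * real h ^ 2 + 5 * sqrt p * real h ^ 4)"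
proof (cases "Q = 0")
  case True
  thus ?thesis by (simp add: near_points_def)
next
  case False
  define X where "X = near_points p Q h"
  define C where "C = sieve_const E S"
  define Y where "Y = 3 * real p * real h ^ 2 + 5 * sqrt p * real h ^ 4"
  define W where "W = C * theta * delta"
  have C: "C > 0" unfolding C_def by (rule sieve_const_pos)
  have W: "W > 0" unfolding W_def using C theta_pos delta_pos by simp
  have Qh: "Q * h < p"
  proof -
    have "1 * (Q * h) \<le> Q * (Q * h)" using False by (intro mult_le_mono1) simp
    moreover have "Q * (Q * h) = Q * Q * h" by simp
    ultimately show ?thesis using Q by linarith
  qed
  have hp: "h < p"
  proof -
    have "1 * h \<le> Q * h" using False by (intro mult_le_mono1) simp
    thus ?thesis using Qh by linarith
  qed
  define \<Phi> where "\<Phi> = (\<lambda>x k. if m dvd k then 0 else cmod (short_sum h k x))"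
  have lower: "h * theta * delta \<le> sieve_norm m E S (\<Phi> x)" if xX: "x \<in> X" for x
  proof -
    obtain q t where q: "1 \<le> q" "q \<le> Q" "t < q" and x: "x \<in> near_fraction p Q h q t"
      using xX by (auto simp: X_def near_points_def)
    have res: "\<exists>r. 1 \<le> r \<and> r \<le> Q * h \<and> q * (x + b) = t * p + r" if "b < h" for b
    proof (rule exI[of _ "q * (x + b) - t * p"])
      have "q * (x + (b + 1)) \<le> q * (x + h)" using that by (intro mult_le_mono2) simp
      moreover have "q * (x + (b + 1)) = q * (x + b) + q" "q * (x + b) = q * x + q * b"
        by (simp_all add: distrib_left)
      ultimately have "t * p < q * (x + b)" "q * (x + b) \<le> t * p + Q * h"
        using x unfolding near_fraction_def mem_Collect_eq by linarith+
      moreover have "1 \<le> v - u \<and> v - u \<le> w \<and> v = u + (v - u)" if "u < v" "v \<le> u + w" for u v w :: nat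
        using that by arith
      ultimately show "1 \<le> q * (x + b) - t * p \<and> q * (x + b) - t * p \<le> Q * h \<and> q * (x + b) = t * p + (q * (x + b) - t * p)"
        by blast
    qed
    have q': "\<not> p dvd q"
    proof
      assume "p dvd q"
      hence "p \<le> q" using q by (intro dvd_imp_le) auto
      moreover have "Q * 1 \<le> Q * h" using h by (intro mult_le_mono2)
      ultimately show False using q Qh by linarith
    qed
    have "card {b\<in>{..<h}. \<not> p dvd q * (x + b)} * theta * delta
      \<le> sieve_norm m E S (\<lambda>k. if m dvd k then 0 else cmod (\<Sum>b<h. chi k (q * (x + b))))"
    proof (rule sieve_ineq)
      fix b assume "b \<in> {..<h}"
      then obtain r where r: "1 \<le> r" "r \<le> Q * h" "q * (x + b) = t * p + r" using res by auto
      hence "[q * (x + b) = r] (mod p)" by (simp add: cong_def)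
      thus "\<not> residue_primroot p (q * (x + b))" using nr[OF r(1,2)] residue_primroot_cong by blast
    qed simp
    also have "{b\<in>{..<h}. \<not> p dvd q * (x + b)} = {..<h}"
    proof (intro equalityI subsetI CollectI conjI notI)
      fix b assume b: "b \<in> {..<h}" "p dvd q * (x + b)"
      then obtain r where r: "1 \<le> r" "r \<le> Q * h" "q * (x + b) = t * p + r" using res by auto
      hence "p dvd r" using b(2) by (simp add: dvd_add_right_iff)
      thus False using r Qh by (auto dest: dvd_imp_le)
    qed auto
    also have "(\<lambda>k. if m dvd k then 0 else cmod (\<Sum>b<h. chi k (q * (x + b)))) = \<Phi> x"
    proof
      fix k
      have "(\<Sum>b<h. chi k (q * (x + b))) = chi k q * short_sum h k x"
        by (simp only: chi_mult short_sum_def sum_distrib_left)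
      thus "(if m dvd k then 0 else cmod (\<Sum>b<h. chi k (q * (x + b)))) = \<Phi> x k"
        using q' by (simp add: \<Phi>_def norm_mult norm_chi)
    qed
    finally show ?thesis by simp
  qed
  have finX: "finite X" and XP: "X \<subseteq> {..<p}"
    using near_points_subset[OF Q h] finite_subset unfolding X_def by auto
  \<comment> \<open>With this value the lower bound is \<open>card X * t * W\<close>, and the linear
    term of \<open>amgm_fourth\<close> accounts for exactly three quarters of it; the fourth moments
    must supply the remaining quarter.\<close>
  define t where "t = h / C"
  have t: "t > 0" using h C by (simp add: t_def)
  have E2: "\<forall>l\<in>set E. l \<ge> 2" using E_prime by (auto simp: prime_ge_2_nat)
  have "card X * (h * theta * delta) = (\<Sum>x\<in>X. h * theta * delta)" by simp
  also have "\<dots> \<le> (\<Sum>x\<in>X. sieve_norm m E S (\<Phi> x))"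
    by (intro sum_mono lower)
  also have "\<dots> = sieve_norm m E S (\<lambda>k. \<Sum>x\<in>X. \<Phi> x k)"
    by (rule sieve_norm_sum[symmetric])
  also have "\<dots> \<le> sieve_norm m E S (\<lambda>k. (3 / 4 * t) * card X + (1 / (4 * t ^ 3)) * fourth_moment h k)"
  proof (rule sieve_norm_mono[OF _ E2 split_simps(3)])
    fix k
    have "(\<Sum>x\<in>X. \<Phi> x k) \<le> (\<Sum>x\<in>X. 3 / 4 * t + (1 / (4 * t ^ 3)) * \<Phi> x k ^ 4)"
    proof (rule sum_mono)
      fix x
      have "\<Phi> x k \<le> (3 * t ^ 4 + \<Phi> x k ^ 4) / (4 * t ^ 3)"
        using amgm_fourth[of t "\<Phi> x k"] t by (simp add: pos_le_divide_eq mult_ac)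
      also have "\<dots> = 3 / 4 * t + (1 / (4 * t ^ 3)) * \<Phi> x k ^ 4"
        using t by (simp add: add_divide_distrib power_numeral_reduce)
      finally show "\<Phi> x k \<le> 3 / 4 * t + (1 / (4 * t ^ 3)) * \<Phi> x k ^ 4" .
    qed
    also have "\<dots> = (3 / 4 * t) * card X + (1 / (4 * t ^ 3)) * (\<Sum>x\<in>X. \<Phi> x k ^ 4)"
      unfolding sum.distrib sum_distrib_left[symmetric] by simp
    also have "\<dots> \<le> (3 / 4 * t) * card X + (1 / (4 * t ^ 3)) * fourth_moment h k"
    proof (intro add_left_mono mult_left_mono)
      show "(\<Sum>x\<in>X. \<Phi> x k ^ 4) \<le> fourth_moment h k"
      proof (cases "m dvd k")
        case False
        have "(\<Sum>x\<in>X. cmod (short_sum h k x) ^ 4) \<le> (\<Sum>x<p. cmod (short_sum h k x) ^ 4)"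
          by (rule sum_mono2) (use XP in auto)
        thus ?thesis using False by (simp add: \<Phi>_def fourth_moment_def)
      qed (simp add: \<Phi>_def fourth_moment_def)
    qed (use t in simp)
    finally show "(\<Sum>x\<in>X. \<Phi> x k) \<le> (3 / 4 * t) * card X + (1 / (4 * t ^ 3)) * fourth_moment h k" .
  qed
  also have "\<dots> = (3 / 4 * t) * sieve_norm m E S (\<lambda>k. real (card X)) + (1 / (4 * t ^ 3)) * sieve_norm m E S (fourth_moment h)"
    by (rule sieve_norm_linear)
  also have "\<dots> \<le> (3 / 4 * t) * (W * card X) + (1 / (4 * t ^ 3)) * (W * Y)"
  proof (intro add_mono mult_left_mono)
    show "sieve_norm m E S (\<lambda>k. real (card X)) \<le> W * card X"
      by (simp add: sieve_norm_const' W_def C_def)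
    have "sieve_norm m E S (fourth_moment h) \<le> (\<Prod>l\<leftarrow>E. 2 - 2 / real l) * (1 - (\<Sum>l\<in>S. 1 / real l) + card S) * Y"
    proof (rule sieve_norm_le_avg[OF E2 split_simps(1,3)])
      fix T assume T: "set T \<subseteq> set E \<union> S" "distinct T"
      show "avg m T (fourth_moment h) 0 \<le> Y"
        unfolding Y_def by (rule avg_fourth_moment_le[OF _ T(2) p hp]) (use T E_prime S_prime in blast)
    qed (use S_prime in \<open>auto simp: Y_def\<close>)
    thus "sieve_norm m E S (fourth_moment h) \<le> W * Y" unfolding sieve_const_eq W_def C_def .
  qed (use t in auto)
  finally have main: "card X * (h * theta * delta) \<le> (3 / 4 * t) * (W * card X) + (1 / (4 * t ^ 3)) * (W * Y)" .
  have htd: "h * theta * delta = t * W" using C by (simp add: t_def W_def)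
  have "card X * (t * W) \<le> (3 / 4 * t) * (W * card X) + (1 / (4 * t ^ 3)) * (W * Y)"
    using main unfolding htd .
  hence "W * (card X * t) \<le> W * ((1 / t ^ 3) * Y)" by (simp add: algebra_simps)
  hence "card X * t \<le> (1 / t ^ 3) * Y" using W by (simp only: mult_le_cancel_left_pos)
  hence "card X * t * t ^ 3 \<le> Y" using t by (simp add: pos_le_divide_eq)
  hence "card X * t ^ 4 \<le> Y" by (simp add: power_numeral_reduce mult_ac)
  hence "card X * h ^ 4 \<le> C ^ 4 * Y" using C by (simp add: t_def power_divide pos_divide_le_eq mult_ac)
  thus ?thesis by (simp add: X_def C_def Y_def)
qed

lemma window_sum_eq: "window_sum s N k = (\<Sum>y\<in>{..<N} \<times> {..<N}. chi k (s + fst y - snd y))"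
  unfolding window_sum_def by (subst sum.cartesian_product) (simp add: case_prod_beta)

text \<open>For \<open>l = 2\<close> the coefficient \<open>1 - 2 / l\<close> vanishes, so the sieve
  by 2 leaves pure averages over \<open>k\<close> and \<open>k + m div 2\<close>. These have
  opposite parity because \<open>m div 2\<close> is odd, so \<open>A\<close> and \<open>B\<close>
  enter only through their mean. The window centred at \<open>N\<close> covers
  \<open>1..2 * N - 1\<close>.\<close>

theorem polya_vinogradov_bound_odd:
  assumes E: "E = 2 # E'" and m: "odd (m div 2)" and N: "N \<ge> 1" "2 * N \<le> p"
    and nr: "\<And>n. 1 \<le> n \<Longrightarrow> n < 2 * N \<Longrightarrow> \<not> residue_primroot p n"
  shows "real N \<le> sieve_const E S * (sqrt 2 / 2) * sqrt p"
proof -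
  define Y where "Y = {..<N} \<times> {..<N}"
  obtain A B where AB: "A \<ge> 0" "B \<ge> 0" "A + B \<le> sqrt 2 * (sqrt p * N)"
    "\<And>k. \<not> m dvd k \<Longrightarrow> cmod (window_sum N N k) \<le> (if even k then A else B)"
    using window_sum_parity_bound[of N N] N by auto
  define G where "G = (\<lambda>k :: nat. if even k then A else B)"
  have E2: "\<forall>l\<in>set E. l \<ge> 2" using E_prime by (auto simp: prime_ge_2_nat)
  have Yn: "1 \<le> N + fst y - snd y \<and> N + fst y - snd y < 2 * N" if "y \<in> Y" for y
    using that by (auto simp: Y_def)
  have "card {y\<in>Y. \<not> p dvd N + fst y - snd y} * theta * delta
    \<le> sieve_norm m E S (\<lambda>k. if m dvd k then 0 else cmod (\<Sum>y\<in>Y. chi k (N + fst y - snd y)))"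
    by (rule sieve_ineq) (use Yn nr in \<open>auto simp: Y_def\<close>)
  also have "{y\<in>Y. \<not> p dvd N + fst y - snd y} = Y"
  proof -
    have "\<not> p dvd N + fst y - snd y" if "y \<in> Y" for y
    proof
      assume "p dvd N + fst y - snd y"
      hence "p \<le> N + fst y - snd y" using Yn[OF that] by (intro dvd_imp_le) auto
      thus False using Yn[OF that] N by linarith
    qed
    thus ?thesis by auto
  qed
  also have "(\<lambda>k. if m dvd k then 0 else cmod (\<Sum>y\<in>Y. chi k (N + fst y - snd y))) = (\<lambda>k. if m dvd k then 0 else cmod (window_sum N N k))"
    by (simp only: window_sum_eq Y_def)
  also have "sieve_norm m E S \<dots> \<le> sieve_norm m E S G"
  proof (rule sieve_norm_mono[OF _ E2 split_simps(3)])
    fix k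
    show "(if m dvd k then 0 else cmod (window_sum N N k)) \<le> G k"
      using AB(1,2) AB(4)[of k] by (auto simp: G_def)
  qed
  also have "\<dots> = sieve_norm m E S (\<lambda>k. (A + B) / 2)"
  proof -
    have "freq_avg m 2 G k = (A + B) / 2" for k
    proof -
      have "freq_avg m 2 G k = (G k + G (k + m div 2)) / 2"
        by (simp add: freq_avg_def lessThan_nat_numeral lessThan_Suc)
      thus ?thesis using m by (cases "even k") (simp_all add: G_def)
    qed
    hence "freq_avg m 2 G = (\<lambda>k. (A + B) / 2)" by (intro ext)
    moreover have "freq_avg m 2 (\<lambda>k. (A + B) / 2) = (\<lambda>k. (A + B) / 2)"
      by (simp add: freq_avg_def fun_eq_iff)
    ultimately have "sift_norm m E G = sift_norm m E (\<lambda>k. (A + B) / 2)" by (simp add: E)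
    thus ?thesis by (simp only: sieve_norm_def)
  qed
  also have "\<dots> = sieve_const E S * theta * delta * ((A + B) / 2)" by (rule sieve_norm_const')
  also have "\<dots> \<le> sieve_const E S * theta * delta * (sqrt 2 * (sqrt p * N) / 2)"
    using AB(3) sieve_const_pos theta_pos delta_pos by (intro mult_left_mono divide_right_mono) auto
  finally have "(theta * delta * N) * N \<le> (theta * delta * N) * (sieve_const E S * (sqrt 2 / 2) * sqrt p)"
    by (simp add: Y_def mult_ac)
  thus ?thesis using theta_pos delta_pos N by simp
qed

text \<open>The logarithm of -1 is \<open>m div 2\<close>, which for even \<open>m div 2\<close> is
  divisible by every prime factor of \<open>m\<close>. Negation therefore does not change whether
  such a prime divides the logarithm.\<close>

lemma residue_primroot_neg:
  assumes m: "even (m div 2)" and d: "0 < d" "d < p" and pr: "residue_primroot p (p - d)"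
  shows "residue_primroot p d"
proof (rule residue_primroot_if_dlog)
  show nd: "\<not> p dvd d" using d by (auto dest: dvd_imp_le)
  have nd': "\<not> p dvd p - d" using d by (auto dest: dvd_imp_le)
  fix l assume l: "prime l" "l dvd m"
  have lm: "l dvd m div 2"
  proof (cases "l = 2")
    case False
    hence "coprime l 2" using l(1) by (intro primes_coprime) auto
    moreover have "l dvd 2 * (m div 2)" using l(2) even_m by simp
    ultimately show ?thesis by (simp add: coprime_dvd_mult_right_iff)
  qed (use m in simp)
  have "ord p (p - d) = m" using pr totient_p by (simp add: residue_primroot_def)
  hence "ord p (\<gamma> ^ dlog (p - d)) = m" using ord_cong[OF dlog_cong[OF nd']] by simp
  hence "m * gcd (dlog (p - d)) m = m" using ord_power_aux[of p \<gamma> "dlog (p - d)"] by (simp add: ord_gamma)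
  hence g: "gcd (dlog (p - d)) m = 1" using m_pos by simp
  show "\<not> l dvd dlog d"
  proof
    assume "l dvd dlog d"
    hence "l dvd m div 2 + dlog d" using lm by simp
    moreover have "[dlog (p - d) = m div 2 + dlog d] (mod l)"
      using dlog_uminus[OF d(2,1)] l(2) unfolding cong_def by (metis mod_mod_cancel)
    ultimately have "l dvd dlog (p - d)" by (simp add: cong_dvd_iff)
    hence "l dvd gcd (dlog (p - d)) m" using l(2) by simp
    thus False using g l(1) by simp
  qed
qed

text \<open>A window centred at \<open>p\<close>, that is at 0, only involves the numbers below
  \<open>N\<close> and their negatives, which are covered by \<open>residue_primroot_neg\<close>.
  The \<open>N\<close> pairs with \<open>i = j\<close> hit a multiple of \<open>p\<close>, hence
  \<open>N - 1\<close> on the left.\<close>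

theorem polya_vinogradov_bound_even:
  assumes m: "even (m div 2)" and N: "N \<ge> 1" "N \<le> p"
    and nr: "\<And>n. 1 \<le> n \<Longrightarrow> n < N \<Longrightarrow> \<not> residue_primroot p n"
  shows "real N - 1 \<le> sieve_const E S * sqrt p"
proof -
  define Y where "Y = {..<N} \<times> {..<N}"
  have E2: "\<forall>l\<in>set E. l \<ge> 2" using E_prime by (auto simp: prime_ge_2_nat)
  have nrY: "\<not> residue_primroot p (p + fst y - snd y)" if "y \<in> Y" for y
  proof -
    obtain i j where y: "y = (i, j)" by (cases y)
    have ij: "i < N" "j < N" using that by (auto simp: Y_def y)
    consider "i = j" | "i > j" | "i < j" by linarith
    thus ?thesis
    proof cases
      case 1
      have "\<not> residue_primroot p p" using p_gt_2 by (simp add: residue_primroot_def)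
      thus ?thesis using 1 by (simp add: y)
    next
      case 2
      have "p + i - j = p + (i - j)" using 2 by simp
      hence "[p + i - j = i - j] (mod p)" by (simp add: cong_def)
      moreover have "\<not> residue_primroot p (i - j)" using 2 ij by (intro nr) auto
      ultimately show ?thesis using residue_primroot_cong by (auto simp: y)
    next
      case 3
      have "p + i - j = p - (j - i)" using 3 by simp
      moreover have "\<not> residue_primroot p (j - i)" using 3 ij by (intro nr) auto
      hence "\<not> residue_primroot p (p - (j - i))" using residue_primroot_neg[OF m, of "j - i"] 3 ij N by linarith
      ultimately show ?thesis by (simp only: y fst_conv snd_conv simp_thms)
    qed
  qed
  have "card {y\<in>Y. \<not> p dvd p + fst y - snd y} * theta * delta
    \<le> sieve_norm m E S (\<lambda>k. if m dvd k then 0 else cmod (\<Sum>y\<in>Y. chi k (p + fst y - snd y)))"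
    by (rule sieve_ineq) (use nrY in \<open>auto simp: Y_def\<close>)
  also have "(\<lambda>k. if m dvd k then 0 else cmod (\<Sum>y\<in>Y. chi k (p + fst y - snd y))) = (\<lambda>k. if m dvd k then 0 else cmod (window_sum p N k))"
    by (simp only: window_sum_eq Y_def)
  also have "sieve_norm m E S \<dots> \<le> sieve_norm m E S (\<lambda>k. sqrt p * N)"
    by (rule sieve_norm_mono[OF _ E2 split_simps(3)]) (use norm_window_sum_le_sqrt N in auto)
  also have "\<dots> = sieve_const E S * theta * delta * (sqrt p * N)" by (rule sieve_norm_const')
  finally have up: "card {y\<in>Y. \<not> p dvd p + fst y - snd y} * theta * delta \<le> sieve_const E S * theta * delta * (sqrt p * N)" .
  have "Y - (\<lambda>i. (i, i)) ` {..<N} \<subseteq> {y\<in>Y. \<not> p dvd p + fst y - snd y}"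
  proof
    fix y assume y: "y \<in> Y - (\<lambda>i. (i, i)) ` {..<N}"
    obtain i j where yy: "y = (i, j)" by (cases y)
    have ij: "i < N" "j < N" "i \<noteq> j" using y by (auto simp: Y_def yy)
    have "\<not> p dvd p + i - j"
    proof
      assume dv: "p dvd p + i - j"
      show False
      proof (cases "i > j")
        case True
        hence "p dvd p + (i - j)" using dv by simp
        hence "p dvd i - j" by simp
        hence "p \<le> i - j" using True by (intro dvd_imp_le) auto
        thus False using ij N by linarith
      next
        case False
        hence "p \<le> p + i - j" using dv ij N by (intro dvd_imp_le) auto
        thus False using False ij N by linarith
      qed
    qed
    thus "y \<in> {y\<in>Y. \<not> p dvd p + fst y - snd y}" using y by (simp add: yy)
  qed
  hence "card (Y - (\<lambda>i. (i, i)) ` {..<N}) \<le> card {y\<in>Y. \<not> p dvd p + fst y - snd y}"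
    by (intro card_mono) (auto simp: Y_def)
  moreover have "card (Y - (\<lambda>i. (i, i)) ` {..<N}) = N * N - N"
  proof (subst card_Diff_subset)
    have "card ((\<lambda>i. (i, i)) ` {..<N}) = N" by (subst card_image) (auto intro: inj_onI)
    thus "card Y - card ((\<lambda>i. (i, i)) ` {..<N}) = N * N - N" by (simp add: Y_def)
  qed (auto simp: Y_def)
  ultimately have "real (N * N - N) \<le> real (card {y\<in>Y. \<not> p dvd p + fst y - snd y})" by (simp only: of_nat_le_iff)
  moreover have "real (N * N - N) = real N * (real N - 1)" using N by (simp add: of_nat_diff algebra_simps)
  ultimately have "(real N * (real N - 1)) * (theta * delta) \<le> real (card {y\<in>Y. \<not> p dvd p + fst y - snd y}) * (theta * delta)"
    using theta_pos delta_pos by (intro mult_right_mono) auto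
  also have "\<dots> \<le> sieve_const E S * theta * delta * (sqrt p * N)" using up by (simp add: mult.assoc)
  finally have "(theta * delta * N) * (real N - 1) \<le> (theta * delta * N) * (sieve_const E S * sqrt p)"
    by (simp add: mult_ac)
  thus ?thesis using theta_pos delta_pos N by simp
qed

end

end

section \<open>Numerical estimates\<close>

definition prime_list :: "nat list" where
  "prime_list = [2, 3, 5, 7, 11, 13, 17, 19, 23, 29, 31, 37, 41, 43, 47, 53, 59, 61, 67, 71,
     73, 79, 83, 89, 97, 101, 103, 107, 109, 113]"

text \<open>A lower bound for the prime number of index \<open>i\<close>, counted from \<open>0\<close>: exact up to 113, then all odd numbers.\<close>

definition prime_lb :: "nat \<Rightarrow> nat" where
  "prime_lb i = (if i < 30 then prime_list ! i else 113 + 2 * (i - 29))"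

lemma primes_upto_113: "primes_upto 113 = prime_list"
  unfolding prime_list_def by code_simp

lemma prime_list_next: "\<forall>i\<in>set [0..<29]. \<forall>q\<in>set prime_list. prime_list ! i < q \<longrightarrow> prime_list ! Suc i \<le> q"
  unfolding prime_list_def by code_simp

lemma prime_list_le: "\<forall>i\<in>set [0..<30]. prime_list ! i \<le> 113"
  unfolding prime_list_def by code_simp

lemma prime_lb_next:
  assumes q: "prime q" "prime_lb i < q"
  shows "prime_lb (Suc i) \<le> q"
proof (cases "i < 29")
  case True
  show ?thesis
  proof (cases "q \<le> 113")
    case False
    have "prime_list ! Suc i \<le> 113" using prime_list_le True by simp
    thus ?thesis using False True by (simp add: prime_lb_def)
  next
    case le: True
    hence "q \<in> set prime_list" using q(1) by (simp add: primes_upto_113[symmetric] set_primes_upto)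
    thus ?thesis using prime_list_next True q(2) by (simp add: prime_lb_def)
  qed
next
  case False
  have lb: "prime_lb j = 113 + 2 * (j - 29)" if "j \<ge> 29" for j
  proof (cases "j = 29")
    case True
    thus ?thesis by (simp add: prime_lb_def prime_list_def)
  qed (use that in \<open>simp add: prime_lb_def\<close>)
  have "odd q" using q False lb[of i] by (intro prime_odd_nat) auto
  then obtain r where "q = 2 * r + 1" by (elim oddE)
  moreover obtain j where "i = 29 + j" using False le_Suc_ex[of 29 i] by auto
  ultimately show ?thesis using q(2) lb[of i] lb[of "Suc i"] by (simp, presburger)
qed

lemma prime_lb_0 [simp]: "prime_lb 0 = 2"
  by (simp add: prime_lb_def prime_list_def)

lemma prime_lb_nth:
  assumes "sorted_wrt (<) qs" "\<forall>q\<in>set qs. prime q" "i < length qs"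
  shows "prime_lb i \<le> qs ! i"
  using assms(3)
proof (induction i)
  case 0
  thus ?case using assms(2) by (auto intro: prime_ge_2_nat)
next
  case (Suc i)
  have "qs ! i < qs ! Suc i" using assms(1) Suc.prems by (simp add: sorted_wrt_nth_less)
  thus ?case using Suc assms(2) by (intro prime_lb_next) auto
qed

lemma prime_lb_pos: "prime_lb i > 0"
proof -
  have "\<forall>i\<in>set [0..<30]. prime_list ! i > 0" unfolding prime_list_def by code_simp
  thus ?thesis by (simp add: prime_lb_def)
qed

lemma two_i_le_prime_lb: "2 * i \<le> prime_lb i"
proof -
  have "\<forall>i\<in>set [0..<30]. 2 * i \<le> prime_list ! i" unfolding prime_list_def by code_simp
  thus ?thesis by (auto simp: prime_lb_def)
qed

lemma prime_lb_eqs: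
  "prime_lb (Suc 0) = 3" "prime_lb 2 = 5" "prime_lb 3 = 7" "prime_lb 4 = 11" "prime_lb 5 = 13" "prime_lb 6 = 17"
  "prime_lb 7 = 19" "prime_lb 8 = 23" "prime_lb 9 = 29" "prime_lb 10 = 31" "prime_lb 11 = 37" "prime_lb 12 = 41"
  "prime_lb 13 = 43" "prime_lb 14 = 47" "prime_lb 15 = 53" "prime_lb 16 = 59" "prime_lb 17 = 61" "prime_lb 18 = 67"
  "prime_lb 19 = 71" "prime_lb 20 = 73" "prime_lb 21 = 79" "prime_lb 22 = 83" "prime_lb 23 = 89" "prime_lb 24 = 97"
  "prime_lb 25 = 101" "prime_lb 26 = 103" "prime_lb 27 = 107" "prime_lb 28 = 109" "prime_lb 29 = 113"
  by (simp_all add: prime_lb_def prime_list_def)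

lemma prime_lb_ge_30: "30 \<le> i \<Longrightarrow> prime_lb i = 113 + 2 * (i - 29)"
  by (simp add: prime_lb_def)

text \<open>In this family the lower limit is the number of primes sieved exactly and the upper
  limit the largest number of prime factors in one case of the final distinction; the values serve
  as \<sigma>.\<close>

lemma sum_prime_lb_19: "(\<Sum>i=3..<19. 1 / real (prime_lb i)) \<le> 0.69545"
  by (simp add: atLeastLessThan_nat_numeral prime_lb_eqs prime_lb_ge_30)

lemma sum_prime_lb_20: "(\<Sum>i=3..<20. 1 / real (prime_lb i)) \<le> 0.70954"
  by (simp add: atLeastLessThan_nat_numeral prime_lb_eqs prime_lb_ge_30)

lemma sum_prime_lb_22: "(\<Sum>i=3..<22. 1 / real (prime_lb i)) \<le> 0.7359"
  by (simp add: atLeastLessThan_nat_numeral prime_lb_eqs prime_lb_ge_30)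

lemma sum_prime_lb_29: "(\<Sum>i=3..<29. 1 / real (prime_lb i)) \<le> 0.80762"
  by (simp add: atLeastLessThan_nat_numeral prime_lb_eqs prime_lb_ge_30)

lemma sum_prime_lb_50: "(\<Sum>i=4..<50. 1 / real (prime_lb i)) \<le> 0.824"
  by (simp add: atLeastLessThan_nat_numeral prime_lb_eqs prime_lb_ge_30)

text \<open>In this family the number of factors is the least number of prime factors in a case; the
  products bound \<open>p\<close> from below.\<close>

lemma prod_prime_lb_20: "(\<Prod>i<20. prime_lb i) \<ge> 5 * 10 ^ 26"
  by (simp add: lessThan_nat_numeral prime_lb_eqs prime_lb_ge_30)

lemma prod_prime_lb_21: "(\<Prod>i<21. prime_lb i) \<ge> 4 * 10 ^ 28"
  by (simp add: lessThan_nat_numeral prime_lb_eqs prime_lb_ge_30)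

lemma prod_prime_lb_23: "(\<Prod>i<23. prime_lb i) \<ge> 2 * 10 ^ 32"
  by (simp add: lessThan_nat_numeral prime_lb_eqs prime_lb_ge_30)

lemma prod_prime_lb_30: "(\<Prod>i<30. prime_lb i) \<ge> 3 * 10 ^ 46"
  by (simp add: lessThan_nat_numeral prime_lb_eqs prime_lb_ge_30)

lemma prod_prime_lb_51: "9 * (\<Prod>i<51. prime_lb i) \<ge> 400 * 16 ^ 51 * 51 ^ 16"
  by (simp add: lessThan_nat_numeral prime_lb_eqs prime_lb_ge_30)

text \<open>One step multiplies the right side by at most 32, since
  \<open>(52 / 51)^16 \<le> 2\<close>, and the left side by \<open>prime_lb n \<ge> 2 * n\<close>.
  The right side is \<open>25 * H^4\<close> for \<open>H = 2 * 2^n * n^4\<close>, the form in which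
  the size of \<open>p\<close> will be needed.\<close>

lemma prod_prime_lb_ge:
  assumes "n \<ge> 51"
  shows "9 * (\<Prod>i<n. prime_lb i) \<ge> 400 * 16 ^ n * n ^ 16"
  using assms
proof (induction n rule: dec_induct)
  case base
  show ?case by (rule prod_prime_lb_51)
next
  case (step n)
  have "51 * Suc n \<le> 52 * n" using step.hyps by simp
  hence "(51 * Suc n) ^ 16 \<le> (52 * n) ^ 16" by (rule power_mono) simp
  hence "51 ^ 16 * Suc n ^ 16 \<le> 52 ^ 16 * n ^ 16" by (simp only: power_mult_distrib)
  also have "\<dots> \<le> (2 * 51 ^ 16) * n ^ 16" by (rule mult_le_mono1) simp
  finally have "51 ^ 16 * Suc n ^ 16 \<le> 51 ^ 16 * (2 * n ^ 16)" by (simp only: mult_ac)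
  hence s: "Suc n ^ 16 \<le> 2 * n ^ 16" by simp
  have "400 * 16 ^ Suc n * Suc n ^ 16 \<le> 400 * 16 ^ Suc n * (2 * n ^ 16)"
    using s by (rule mult_le_mono2)
  also have "\<dots> = (400 * 16 ^ n * n ^ 16) * 32" by simp
  also have "\<dots> \<le> (9 * (\<Prod>i<n. prime_lb i)) * prime_lb n"
    by (rule mult_le_mono[OF step.IH]) (use two_i_le_prime_lb[of n] step.hyps in linarith)
  finally show ?case by (simp only: prod.lessThan_Suc mult.assoc)
qed

lemma ln_2_le: "ln (2 :: real) \<le> 0.7"
proof -
  have "(2 :: real) \<le> (1 + 0.7 / 64) ^ 64" by (simp add: power_divide)
  also have "\<dots> \<le> exp 0.7" using exp_ge_one_plus_x_over_n_power_n[of 64 "0.7 :: real"] by simp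
  finally have "ln 2 \<le> ln (exp (0.7 :: real))" by (subst ln_le_cancel_iff) auto
  thus ?thesis by simp
qed

text \<open>Each term is at most \<open>1 / (2 * i)\<close>, hence at most half of
  \<open>ln (i / (i - 1))\<close>, and these logarithms telescope.\<close>

lemma sum_prime_lb_le_ln:
  assumes k: "k \<ge> 2" "k \<le> n"
  shows "(\<Sum>i=k..<n. 1 / real (prime_lb i)) \<le> ln (real (n - 1) / real (k - 1)) / 2"
  using k(2)
proof (induction n rule: dec_induct)
  case base
  show ?case using k by simp
next
  case (step n)
  have n: "n \<ge> 2" using step k by simp
  have "2 * real n \<le> real (prime_lb n)"
    using two_i_le_prime_lb[of n] by (metis of_nat_le_iff of_nat_mult of_nat_numeral)
  hence "1 / real (prime_lb n) \<le> 1 / (2 * real n)"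
    using prime_lb_pos[of n] n by (intro divide_left_mono mult_pos_pos) auto
  also have "1 / real n \<le> ln (real n / real (n - 1))"
  proof -
    have "ln (real (n - 1) / real n) \<le> real (n - 1) / real n - 1" using n by (intro ln_le_minus_one) auto
    also have "\<dots> = - (1 / real n)" using n by (simp add: of_nat_diff field_simps)
    finally have "1 / real n \<le> - ln (real (n - 1) / real n)" by simp
    thus ?thesis using n by (simp add: ln_div)
  qed
  hence "1 / (2 * real n) \<le> ln (real n / real (n - 1)) / 2" by simp
  finally have "1 / real (prime_lb n) \<le> ln (real n / real (n - 1)) / 2" .
  hence "(\<Sum>i=k..<Suc n. 1 / real (prime_lb i)) \<le> ln (real (n - 1) / real (k - 1)) / 2 + ln (real n / real (n - 1)) / 2"
    using step by simp
  also have "\<dots> = ln (real (Suc n - 1) / real (k - 1)) / 2"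
    using n k by (simp add: ln_div field_simps)
  finally show ?case .
qed

section \<open>Prime factors of \<open>p - 1\<close> and the choice of parameters\<close>

context primroot_prime
begin

definition prime_divs :: "nat list" where
  "prime_divs = sorted_list_of_set {l. prime l \<and> l dvd m}"

lemma finite_prime_divs: "finite {l. prime l \<and> l dvd m}"
  by (rule finite_subset[of _ "{..m}"]) (auto dest: dvd_imp_le simp: m_pos)

lemma set_prime_divs: "set prime_divs = {l. prime l \<and> l dvd m}"
  and sorted_prime_divs: "sorted_wrt (<) prime_divs" and distinct_prime_divs: "distinct prime_divs"
  using finite_prime_divs by (simp_all add: prime_divs_def)

lemma prime_lb_le_prime_divs: "i < length prime_divs \<Longrightarrow> prime_lb i \<le> prime_divs ! i"
  using sorted_prime_divs set_prime_divs by (intro prime_lb_nth) auto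

lemma prod_prime_lb_le:
  assumes "n \<le> length prime_divs"
  shows "(\<Prod>i<n. prime_lb i) \<le> p"
proof -
  have "(\<Prod>i<n. prime_lb i) \<le> (\<Prod>i<n. prime_divs ! i)"
    using assms by (intro prod_mono) (auto intro: prime_lb_le_prime_divs)
  also have "\<dots> = prod_list (take n prime_divs)"
    unfolding prod.list_conv_set_nth using assms by (intro prod.cong) auto
  also have "\<dots> = (\<Prod>l\<leftarrow>take n prime_divs. l)" by simp
  also have "\<dots> \<le> m"
  proof (rule dvd_imp_le[OF prod_distinct_primes_dvd(1) m_pos])
    show "\<forall>l\<in>set (take n prime_divs). prime l \<and> l dvd m"
      using set_prime_divs set_take_subset[of n prime_divs] by auto
  qed (simp add: distinct_prime_divs)
  finally show ?thesis using p_eq by linarith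
qed

text \<open>Replacing prime factors by their lower bounds, and their number by \<open>N\<close>, can
  only increase the bound for the constant, so one numerical value covers all lengths up to
  \<open>N\<close>.\<close>

lemma sieve_split_prime_divs:
  assumes n: "length prime_divs \<le> N" "k \<le> N" and \<sigma>: "(\<Sum>i=k..<N. 1 / real (prime_lb i)) \<le> \<sigma>" "\<sigma> < 1"
  shows "sieve_split (take k prime_divs) (set (drop k prime_divs))"
    and "sieve_const (take k prime_divs) (set (drop k prime_divs)) \<le> 2 ^ k * ((real N - real k) / (1 - \<sigma>) + 1)"
proof -
  let ?q = prime_divs
  have td: "set (take k ?q) \<inter> set (drop k ?q) = {}" using distinct_prime_divs
    by (metis append_take_drop_id distinct_append)
  have tu: "set (take k ?q) \<union> set (drop k ?q) = set ?q" by (metis append_take_drop_id set_append)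
  have "(\<Sum>l\<in>set (drop k ?q). 1 / real l) = (\<Sum>l\<leftarrow>drop k ?q. 1 / real l)"
    by (rule sum.distinct_set_conv_list) (simp add: distinct_prime_divs)
  also have "\<dots> = (\<Sum>i=0..<length ?q - k. 1 / real (?q ! (k + i)))"
    by (simp add: sum_list_sum_nth)
  also have "\<dots> \<le> (\<Sum>i=0..<length ?q - k. 1 / real (prime_lb (k + i)))"
  proof (intro sum_mono divide_left_mono)
    fix i assume "i \<in> {0..<length ?q - k}"
    hence "prime_lb (k + i) \<le> ?q ! (k + i)" by (intro prime_lb_le_prime_divs) auto
    thus "real (prime_lb (k + i)) \<le> real (?q ! (k + i))" "0 < real (?q ! (k + i)) * real (prime_lb (k + i))"
      using prime_lb_pos[of "k + i"] by auto
  qed simp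
  also have "\<dots> \<le> (\<Sum>i=0..<N - k. 1 / real (prime_lb (k + i)))"
    by (rule sum_mono2) (use n in auto)
  also have "\<dots> = (\<Sum>i=k..<N. 1 / real (prime_lb i))"
    using n sum.shift_bounds_nat_ivl[of "\<lambda>i. 1 / real (prime_lb i)" 0 k "N - k"] by (simp add: add.commute)
  finally have s: "(\<Sum>l\<in>set (drop k ?q). 1 / real l) \<le> \<sigma>" using \<sigma> by simp
  show "sieve_split (take k ?q) (set (drop k ?q))"
    unfolding sieve_split_def tu using td s \<sigma>(2) distinct_prime_divs set_prime_divs by auto
  have "card (set (drop k ?q)) = length ?q - k" using distinct_prime_divs by (simp add: distinct_card)
  hence c: "real (card (set (drop k ?q))) \<le> real N - real k" using n by simp
  have "2 ^ length (take k ?q) * (card (set (drop k ?q)) / (1 - (\<Sum>l\<in>set (drop k ?q). 1 / real l)) + 1)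
    \<le> 2 ^ k * ((real N - real k) / (1 - \<sigma>) + 1)"
    using s \<sigma>(2) c by (intro mult_mono power_increasing add_mono frac_le) (auto intro!: add_nonneg_nonneg divide_nonneg_nonneg)
  thus "sieve_const (take k ?q) (set (drop k ?q)) \<le> 2 ^ k * ((real N - real k) / (1 - \<sigma>) + 1)"
    by (simp add: sieve_const_def)
qed

text \<open>\<open>H\<close> is an integral lower bound for \<open>sqrt (0.6 * sqrt p)\<close>,
  since \<open>25 * H^4 \<le> 9 * p\<close> says \<open>H^2 \<le> 0.6 * sqrt p\<close>. Its minimum
  \<open>384400 = 620^2\<close> secures \<open>Q * Q * h < p\<close>. The argument ends with
  \<open>619^2 * h \<le> 24 * C^4\<close>, which contradicts \<open>c\<close> because
  \<open>24 * 15900 < 619^2\<close>.\<close>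

lemma burgess_contradiction:
  assumes split: "sieve_split E S" and c: "sieve_const E S \<le> c" "c ^ 4 < 15900 * real H"
    and H: "25 * H ^ 4 \<le> 9 * p" "H \<ge> 384400"
    and nr: "\<And>n. 1 \<le> n \<Longrightarrow> real n < 620 * sqrt p \<Longrightarrow> \<not> residue_primroot p n"
  shows False
proof -
  define r where "r = sqrt p"
  have r: "r > 0" "r ^ 2 = p" using p_pos by (simp_all add: r_def)
  \<comment> \<open>At \<open>h^2 = 0.6 * sqrt p\<close> the terms \<open>5 * sqrt p * h^4\<close>
    and \<open>3 * p * h^2\<close> of the fourth moment bound are equal.\<close>
  define h where "h = nat \<lfloor>sqrt (0.6 * r)\<rfloor>"
  have "real h \<le> sqrt (0.6 * r)" using r by (simp add: h_def)
  hence "real h ^ 2 \<le> sqrt (0.6 * r) ^ 2" by (rule power_mono) simp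
  hence h2: "real h ^ 2 \<le> 0.6 * r" using r by simp
  have "(real H ^ 2) ^ 2 \<le> (0.6 * r) ^ 2"
  proof -
    have "real (25 * H ^ 4) \<le> real (9 * p)" using H(1) by (simp only: of_nat_le_iff)
    hence "25 * real H ^ 4 \<le> 9 * r ^ 2" using r by simp
    thus ?thesis by (simp add: power_mult_distrib power_divide flip: power_mult)
  qed
  hence "real H ^ 2 \<le> 0.6 * r" by (rule power2_le_imp_le) (use r in simp)
  hence "real H \<le> sqrt (0.6 * r)" by (rule real_le_rsqrt)
  hence Hh: "H \<le> h" unfolding h_def by (rule le_nat_floor)
  hence h0: "real h \<ge> 384400" using H(2) by linarith
  have "3 * real h \<le> real h * real h" using h0 by (intro mult_right_mono) auto
  hence h3: "3 * real h \<le> r" using h2 r by (simp add: power2_eq_square)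
  have r0: "r \<ge> 3 * 384400" using h0 h3 by linarith
  define y where "y = 620 * r / h"
  have yh: "y * h = 620 * r" using h0 by (simp add: y_def)
  \<comment> \<open>The largest integer strictly below \<open>y\<close>, because \<open>nr\<close>
    covers only numbers strictly below \<open>620 * sqrt p\<close>.\<close>
  define Q where "Q = nat \<lceil>y\<rceil> - 1"
  have y0: "y \<ge> 3"
  proof -
    have "3 * real h \<le> 620 * r" using h3 r by linarith
    thus ?thesis unfolding y_def using h0 by (simp add: pos_le_divide_eq)
  qed
  have Q: "real Q < y" "y \<le> real Q + 1"
  proof -
    have "real (nat \<lceil>y\<rceil>) \<ge> y" "real (nat \<lceil>y\<rceil>) < y + 1" using y0 by (simp_all, linarith)
    moreover have "real Q = real (nat \<lceil>y\<rceil>) - 1"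
    proof -
      have "nat \<lceil>y\<rceil> \<ge> 1" using y0 by linarith
      thus ?thesis by (simp add: Q_def of_nat_diff)
    qed
    ultimately show "real Q < y" "y \<le> real Q + 1" by linarith+
  qed
  have Qh: "real Q * h < 620 * r" using Q(1) h0 yh by (metis mult_strict_right_mono le_less_trans less_eq_real_def of_nat_0_less_iff zero_less_numeral order_less_le_trans)
  have "y * h \<le> (real Q + 1) * h" using Q(2) by (rule mult_right_mono) simp
  hence Qh1: "real Q * h \<ge> 620 * r - h" using yh by (simp add: algebra_simps)
  have QQ: "Q * Q * h < p"
  proof -
    have "(real Q * h) ^ 2 < (620 * r) ^ 2" using Qh by (rule power_strict_mono) auto
    also have "\<dots> = 384400 * real p" using r by (simp add: power_mult_distrib)
    also have "\<dots> \<le> real h * real p" using h0 by (rule mult_right_mono) simp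
    finally have "real h * real (Q * Q * h) < real h * real p" by (simp add: power2_eq_square mult_ac)
    thus ?thesis using h0 by (simp only: mult_less_cancel_left_pos of_nat_less_iff)
  qed
  have p400: "p \<ge> 400"
  proof -
    have "real 400 \<le> r ^ 2" using power_mono[of 20 r 2] r0 by simp
    thus ?thesis using r by (simp only: of_nat_le_iff)
  qed
  have h1: "h \<ge> 1" using h0 by linarith
  define C where "C = sieve_const E S"
  have C0: "C > 0" unfolding C_def by (rule sieve_const_pos[OF split])
  have bb: "real (card (near_points p Q h)) * real h ^ 4 \<le> C ^ 4 * (3 * real p * real h ^ 2 + 5 * sqrt p * real h ^ 4)"
    unfolding C_def
  proof (rule burgess_bound[OF split p400 h1 QQ])
    fix n assume n: "1 \<le> n" "n \<le> Q * h"
    have "real n \<le> real (Q * h)" using n(2) by (simp only: of_nat_le_iff)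
    hence "real n < 620 * sqrt p" using Qh by (simp add: r_def)
    thus "\<not> residue_primroot p n" using nr[OF n(1)] by simp
  qed
  \<comment> \<open>From \<open>Q * h \<ge> 620 * r - h\<close> and \<open>3 * h \<le> r\<close>,
    even \<open>Q * h - 2 * h\<close> is at least \<open>619 * r\<close>.\<close>
  have "(619 * r) * (619 * r) \<le> (real Q * h) * (real Q * h - 2 * h)"
    by (rule mult_mono) (use Qh1 h3 r h0 in linarith)+
  hence "(619 * r) ^ 2 * real h ^ 3 \<le> (real Q * h) * (real Q * h - 2 * h) * real h ^ 3"
    unfolding power2_eq_square by (rule mult_right_mono) simp
  also have "\<dots> = 4 * ((real h * real Q * (real Q - 2) / 4) * real h ^ 4)"
    by (simp add: power_numeral_reduce algebra_simps)
  also have "\<dots> \<le> 4 * (real (card (near_points p Q h)) * real h ^ 4)"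
    by (intro mult_left_mono mult_right_mono card_near_points_ge QQ h1) auto
  also have "\<dots> \<le> 4 * (C ^ 4 * (3 * real p * real h ^ 2 + 5 * sqrt p * real h ^ 4))"
    using bb by simp
  also have "\<dots> \<le> 4 * (C ^ 4 * (6 * r ^ 2 * real h ^ 2))"
  proof -
    have "5 * r * real h ^ 2 \<le> 5 * r * (0.6 * r)" using h2 r by (intro mult_left_mono) auto
    hence "(5 * r * real h ^ 2) * real h ^ 2 \<le> (3 * r ^ 2) * real h ^ 2"
      by (intro mult_right_mono) (auto simp: power2_eq_square)
    moreover have "5 * r * real h ^ 4 = (5 * r * real h ^ 2) * real h ^ 2"
      by (simp add: power4_eq_xxxx power2_eq_square)
    moreover have "3 * real p * real h ^ 2 = (3 * r ^ 2) * real h ^ 2" using r by simp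
    moreover have "6 * r ^ 2 * real h ^ 2 = 2 * ((3 * r ^ 2) * real h ^ 2)" by simp
    ultimately have "3 * real p * real h ^ 2 + 5 * sqrt p * real h ^ 4 \<le> 6 * r ^ 2 * real h ^ 2"
      unfolding r_def[symmetric] by linarith
    thus ?thesis using C0 by (intro mult_left_mono) auto
  qed
  finally have "(r ^ 2 * real h ^ 2) * (383161 * h) \<le> (r ^ 2 * real h ^ 2) * (24 * C ^ 4)"
    by (simp add: power_numeral_reduce mult_ac)
  moreover have "0 < r ^ 2 * real h ^ 2" using r(1) h0 by (intro mult_pos_pos zero_less_power) linarith+
  ultimately have "383161 * h \<le> 24 * C ^ 4" by (simp only: mult_le_cancel_left_pos)
  moreover have "C ^ 4 \<le> c ^ 4" using c(1) C0 by (intro power_mono) (auto simp: C_def)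
  ultimately show False using c(2) Hh h0 by linarith
qed

text \<open>The number of prime factors is enclosed by \<open>n\<close>, which bounds
  \<open>p\<close> from below, and \<open>N\<close>, which bounds the sieve constant from
  above.\<close>

lemma burgess_range:
  assumes n: "n \<le> length prime_divs" "length prime_divs \<le> N" "k \<le> N"
    and \<sigma>: "(\<Sum>i=k..<N. 1 / real (prime_lb i)) \<le> \<sigma>" "\<sigma> < 1"
    and c: "(2 ^ k * ((real N - real k) / (1 - \<sigma>) + 1)) ^ 4 < 15900 * real H"
    and H: "25 * H ^ 4 \<le> 9 * (\<Prod>i<n. prime_lb i)" "H \<ge> 384400"
    and nr: "\<And>n. 1 \<le> n \<Longrightarrow> real n < 620 * sqrt p \<Longrightarrow> \<not> residue_primroot p n"
  shows False
proof (rule burgess_contradiction)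
  have "9 * (\<Prod>i<n. prime_lb i) \<le> 9 * p" using prod_prime_lb_le[OF n(1)] by simp
  thus "25 * H ^ 4 \<le> 9 * p" using H(1) by linarith
qed (use sieve_split_prime_divs[OF n(2,3) \<sigma>] c H(2) nr in auto)

text \<open>About a quarter of the primes are sieved exactly. The reciprocals of the others add up
  to at most \<open>ln 4 / 2 = ln 2 \<le> 0.7\<close>, and the fourth power of the sieve constant is
  at most a constant times \<open>2^n * n^4\<close>, which the product of the prime factors
  outweighs.\<close>

lemma length_prime_divs_ge_51:
  assumes n: "51 \<le> length prime_divs"
    and nr: "\<And>n. 1 \<le> n \<Longrightarrow> real n < 620 * sqrt p \<Longrightarrow> \<not> residue_primroot p n"
  shows False
proof -
  define n where "n = length prime_divs"
  \<comment> \<open>The summand 2 ensures \<open>n \<le> 4 * (k - 1)\<close>, hence a ratio of at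
    most 4 inside the logarithm.\<close>
  define k where "k = n div 4 + 2"
  have n51: "n \<ge> 51" using n by (simp add: n_def)
  have k: "k \<ge> 2" "k \<le> n" "n \<le> 4 * (k - 1)" using n51 unfolding k_def by linarith+
  have "4 * (n div 4) \<le> n" by simp
  hence kn: "4 * k \<le> n + 8" unfolding k_def distrib_left by linarith
  show False
  proof (rule burgess_range[of n n k "0.7" "2 * 2 ^ n * n ^ 4"])
    show "n \<le> length prime_divs" "length prime_divs \<le> n" "k \<le> n" using k by (simp_all add: n_def)
    have "(\<Sum>i=k..<n. 1 / real (prime_lb i)) \<le> ln (real (n - 1) / real (k - 1)) / 2"
      by (rule sum_prime_lb_le_ln[OF k(1,2)])
    also have "ln (real (n - 1) / real (k - 1)) \<le> ln 4"
    proof (subst ln_le_cancel_iff)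
      have "real (n - 1) \<le> real (4 * (k - 1))" using k by (simp only: of_nat_le_iff)
      thus "real (n - 1) / real (k - 1) \<le> 4" using k by (simp add: pos_divide_le_eq)
    qed (use k n51 in auto)
    also have "ln 4 = 2 * ln (2 :: real)" using ln_realpow[of 2 2] by simp
    finally show "(\<Sum>i=k..<n. 1 / real (prime_lb i)) \<le> 0.7" using ln_2_le by simp
    have "(2 ^ k * ((real n - real k) / (1 - 0.7) + 1)) ^ 4 \<le> (2 ^ k * (10 / 3 * n)) ^ 4"
    proof (intro power_mono mult_left_mono)
      have "(real n - real k) / (1 - 0.7) + 1 = 10 / 3 * (real n - real k) + 1" by simp
      also have "\<dots> \<le> 10 / 3 * real n" using k(1) by (simp add: right_diff_distrib)
      finally show "(real n - real k) / (1 - 0.7) + 1 \<le> 10 / 3 * n" .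
      show "0 \<le> 2 ^ k * ((real n - real k) / (1 - 0.7) + 1)" using k by (intro mult_nonneg_nonneg add_nonneg_nonneg) auto
    qed simp
    also have "\<dots> = 2 ^ (4 * k) * (10000 / 81 * real n ^ 4)"
      by (simp add: power_mult_distrib power_divide mult.commute[of 4] power_mult)
    also have "\<dots> \<le> 2 ^ (n + 8) * (10000 / 81 * real n ^ 4)"
      using kn by (intro mult_right_mono power_increasing) auto
    also have "\<dots> = (2560000 / 81) * (2 ^ n * real n ^ 4)" by (simp add: power_add)
    \<comment> \<open>\<open>2560000 / 81\<close> is just below \<open>31800 = 2 * 15900\<close>;
      the factor 2 in \<open>H\<close> makes room for it.\<close>
    also have "\<dots> < 31800 * (2 ^ n * real n ^ 4)" using n51 by (intro mult_strict_right_mono mult_pos_pos) auto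
    finally show "(2 ^ k * ((real n - real k) / (1 - 0.7) + 1)) ^ 4 < 15900 * real (2 * 2 ^ n * n ^ 4)" by simp
    have "25 * (2 * 2 ^ n * n ^ 4) ^ 4 = 400 * 16 ^ n * n ^ 16"
    proof -
      have "((2 :: nat) ^ n) ^ 4 = (2 ^ 4) ^ n" by (simp only: power_mult[symmetric] mult.commute[of n 4])
      hence e: "((2 :: nat) ^ n) ^ 4 = 16 ^ n" by simp
      have "(n ^ 4) ^ 4 = n ^ 16" by (simp flip: power_mult)
      hence "25 * (2 * 2 ^ n * n ^ 4) ^ 4 = 25 * (2 ^ 4 * 16 ^ n * n ^ 16)"
        by (simp only: power_mult_distrib e)
      thus ?thesis by simp
    qed
    thus "25 * (2 * 2 ^ n * n ^ 4) ^ 4 \<le> 9 * (\<Prod>i<n. prime_lb i)" using prod_prime_lb_ge[OF n51] by (simp only:)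
    have "(51 :: nat) ^ 4 * 2 \<le> n ^ 4 * (2 * 2 ^ n)" using n51 by (intro mult_le_mono power_mono) auto
    thus "384400 \<le> 2 * 2 ^ n * n ^ 4" by simp
  qed (use nr in auto)
qed

lemma primroot_lt_620_sqrt:
  assumes p: "p \<ge> 191 * 10 ^ 21"
  shows "\<exists>n\<ge>1. real n < 620 * sqrt p \<and> residue_primroot p n"
proof (rule ccontr)
  assume "\<not> ?thesis"
  hence nr: "\<And>n. 1 \<le> n \<Longrightarrow> real n < 620 * sqrt p \<Longrightarrow> \<not> residue_primroot p n" by blast
  define n where "n = length prime_divs"
  consider "n \<le> 19" | "n = 20" | "n = 21 \<or> n = 22" | "23 \<le> n" "n \<le> 29" | "30 \<le> n" "n \<le> 50" | "51 \<le> n" by linarith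
  thus False
  proof cases
    case 1
    \<comment> \<open>With at most 16 primes in \<open>S\<close>, the constant is at most
      \<open>8 * (16 / 0.30455 + 1)\<close>, just below 428.4. This is less than 620, and 0.71 times
      it is less than 310, as the two parities of \<open>m div 2\<close> require.\<close>
    define E S where "E = take 3 prime_divs" and "S = set (drop 3 prime_divs)"
    have sp: "sieve_split E S" "sieve_const E S \<le> 2 ^ 3 * ((real 19 - real 3) / (1 - 0.69545) + 1)"
      unfolding E_def S_def by (rule sieve_split_prime_divs[OF _ _ sum_prime_lb_19]; use 1 in \<open>simp add: n_def\<close>)+
    have C: "sieve_const E S \<le> 428.4" using sp(2) by simp
    define r where "r = sqrt p"
    have r: "r \<ge> 620" "r ^ 2 = p"
    proof -
      have "(620 :: real) ^ 2 \<le> 191 * 10 ^ 21" by simp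
      also have "\<dots> = real (191 * 10 ^ 21)" by simp
      also have "\<dots> \<le> p" using p by (simp only: of_nat_le_iff)
      finally show "r \<ge> 620" unfolding r_def by (rule real_le_rsqrt)
    qed (simp add: r_def)
    have rp: "620 * r \<le> p"
    proof -
      have "620 * r \<le> r * r" using r by (intro mult_right_mono) auto
      thus ?thesis using r(2) by (simp add: power2_eq_square)
    qed
    have two: "prime_divs = 2 # tl prime_divs"
    proof -
      have "2 \<in> set prime_divs" using set_prime_divs even_m by simp
      then obtain i where i: "i < length prime_divs" "prime_divs ! i = 2" by (auto simp: in_set_conv_nth)
      have "i = 0"
      proof (rule ccontr)
        assume "i \<noteq> 0"
        hence "prime_divs ! 0 < 2" using sorted_wrt_nth_less[OF sorted_prime_divs, of 0 i] i by simp
        moreover have "0 < length prime_divs" using i by linarith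
        from prime_lb_le_prime_divs[OF this] have "2 \<le> prime_divs ! 0" by (simp only: prime_lb_0)
        ultimately show False by simp
      qed
      thus ?thesis using i by (cases prime_divs) auto
    qed
    show False
    proof (cases "even (m div 2)")
      case True
      define N where "N = nat \<lfloor>620 * r\<rfloor>"
      have N: "real N \<le> 620 * r" "620 * r < real N + 1" using r by (auto simp: N_def)
      have "real N - 1 \<le> sieve_const E S * sqrt p"
      proof (rule polya_vinogradov_bound_even[OF sp(1) True])
        show "1 \<le> N" using N(2) r by linarith
        show "N \<le> p" using N(1) rp by linarith
        show "\<not> residue_primroot p n" if "1 \<le> n" "n < N" for n
          using that N(1) by (intro nr) (auto simp: r_def)
      qed
      also have "\<dots> \<le> 428.4 * r" unfolding r_def by (intro mult_right_mono C) auto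
      finally show False using N(2) r by linarith
    next
      case False
      define N where "N = nat \<lfloor>310 * r\<rfloor>"
      have N: "real N \<le> 310 * r" "310 * r < real N + 1" using r by (auto simp: N_def)
      have "E = 2 # take 2 (tl prime_divs)" unfolding E_def by (subst two) (simp add: numeral_3_eq_3 numeral_2_eq_2)
      hence "real N \<le> sieve_const E S * (sqrt 2 / 2) * sqrt p"
      proof (rule polya_vinogradov_bound_odd[OF sp(1) _ False])
        show "1 \<le> N" using N(2) r by linarith
        show "2 * N \<le> p" using N(1) rp by linarith
        show "\<not> residue_primroot p n" if "1 \<le> n" "n < 2 * N" for n
          using that N(1) by (intro nr) (auto simp: r_def)
      qed
      also have "\<dots> \<le> 428.4 * (71 / 100) * r" unfolding r_def
      proof (intro mult_right_mono mult_mono C)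
        have "sqrt 2 \<le> 1.42" by (rule real_le_lsqrt) (auto simp: power2_eq_square)
        thus "sqrt 2 / 2 \<le> 71 / 100" by simp
      qed auto
      finally show False using N(2) r by linarith
    qed
  next
    case 2
    show False
    \<comment> \<open>In this and the next three cases \<open>H\<close> must exceed
      \<open>c^4 / 15900\<close> while \<open>25 * H^4\<close> stays below 9 times the product; it
      is chosen just above the former bound.\<close>
    proof (rule burgess_range[OF _ _ _ sum_prime_lb_20 _ _ _ _ nr, where n = 20 and H = 3236900])
      show "25 * 3236900 ^ 4 \<le> 9 * (\<Prod>i<20. prime_lb i)" using prod_prime_lb_20 by simp
      show "20 \<le> length prime_divs" "length prime_divs \<le> 20" using 2 by (auto simp: n_def)
    qed (simp_all add: power_divide)
  next
    case 3
    show False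
    proof (rule burgess_range[OF _ _ _ sum_prime_lb_22 _ _ _ _ nr, where n = 21 and H = 7300000])
      show "25 * 7300000 ^ 4 \<le> 9 * (\<Prod>i<21. prime_lb i)" using prod_prime_lb_21 by simp
      show "21 \<le> length prime_divs" "length prime_divs \<le> 22" using 3 by (auto simp: n_def)
    qed (simp_all add: power_divide)
  next
    case 4
    show False
    proof (rule burgess_range[OF _ _ _ sum_prime_lb_29 _ _ _ _ nr, where n = 23 and H = 88600000])
      show "25 * 88600000 ^ 4 \<le> 9 * (\<Prod>i<23. prime_lb i)" using prod_prime_lb_23 by simp
      show "23 \<le> length prime_divs" "length prime_divs \<le> 29" using 4 by (auto simp: n_def)
    qed (simp_all add: power_divide)
  next
    case 5
    show False
    proof (rule burgess_range[OF _ _ _ sum_prime_lb_50 _ _ _ _ nr, where n = 30 and H = 20000000000])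
      show "25 * 20000000000 ^ 4 \<le> 9 * (\<Prod>i<30. prime_lb i)" using prod_prime_lb_30 by simp
      show "30 \<le> length prime_divs" "length prime_divs \<le> 50" using 5 by (auto simp: n_def)
    qed (simp_all add: power_divide)
  next
    case 6
    thus False using length_prime_divs_ge_51 nr by (auto simp: n_def)
  qed
qed

end

lemma least_primroot_lt_620_sqrt:
  assumes "prime p" "p \<ge> 191 * 10 ^ 21"
  shows "real (least_primroot p) < 620 * sqrt p"
proof -
  have p: "p > 2" using assms(2) by simp
  obtain \<gamma> where "residue_primroot p \<gamma>"
    using prime_primitive_root_exists[of p] assms(1) p by auto
  then interpret primroot_prime p \<gamma> using assms p by unfold_locales
  obtain n where n: "n \<ge> 1" "real n < 620 * sqrt p" "residue_primroot p n"
    using primroot_lt_620_sqrt[OF assms(2)] by blast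
  have "least_primroot p \<le> n" unfolding least_primroot_def using n by (intro Least_le) auto
  thus ?thesis using n by linarith
qed

lemma mult_sqrt_le_powr:
  fixes p c P \<alpha> :: real and a n :: nat
  assumes p: "p \<ge> P" "P > 0" and c: "c > 0" "c ^ n \<le> P ^ a" and n: "n > 0" "\<alpha> = 1 / 2 + real a / real n"
  shows "c * sqrt p \<le> p powr \<alpha>"
proof -
  have p0: "p > 0" using p by linarith
  have "(c powr real n) powr (1 / real n) \<le> (p powr real a) powr (1 / real n)"
  proof (rule powr_mono2)
    have "P ^ a \<le> p ^ a" using p by (intro power_mono) auto
    thus "c powr real n \<le> p powr real a" using c p0 by (simp add: powr_realpow)
  qed auto
  hence "c \<le> p powr (real a / real n)" using c n by (simp add: powr_powr)
  hence "c * sqrt p \<le> p powr (real a / real n) * sqrt p" using p0 by (intro mult_right_mono) auto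
  also have "\<dots> = p powr \<alpha>" using p0 n by (simp add: powr_add powr_half_sqrt)
  finally show ?thesis .
qed

text \<open>200 is the common denominator of the exponents \<open>\<alpha> - 1/2\<close>, and 3009
  is the leading part of \<open>620^200\<close> rounded up.\<close>

lemma power_620_le: "(620 :: real) ^ 200 \<le> 3009 * 10 ^ 555"
  by simp

text \<open>Splitting off the powers of 10 keeps the numbers to be compared small.\<close>

lemma power_620_le_mult_power_10:
  fixes c :: real
  assumes "3009 * 10 ^ j \<le> c ^ a" "j + e * a = 555"
  shows "620 ^ 200 \<le> (c * 10 ^ e) ^ a"
proof -
  have "(620 :: real) ^ 200 \<le> (3009 * 10 ^ j) * 10 ^ (e * a)"
    using power_620_le unfolding assms(2)[symmetric] power_add by (simp only: mult.assoc)
  also have "\<dots> \<le> c ^ a * 10 ^ (e * a)" using assms(1) by (rule mult_right_mono) simp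
  also have "\<dots> = (c * 10 ^ e) ^ a" by (simp only: power_mult_distrib power_mult)
  finally show ?thesis .
qed

lemma least_primroot_lt_powr:
  fixes p a e j :: nat and c P \<alpha> :: real
  assumes "3009 * 10 ^ j \<le> c ^ a" "j + e * a = 555" "191 * 10 ^ 21 \<le> c * 10 ^ e"
    and "\<alpha> = 1 / 2 + real a / 200" "P = c * 10 ^ e" "prime p" "real p > P"
  shows "real (least_primroot p) < real p powr \<alpha>"
proof -
  have "real (191 * 10 ^ 21) \<le> real p" using assms(3,5,7) by simp
  hence "p \<ge> 191 * 10 ^ 21" by (simp only: of_nat_le_iff)
  hence "real (least_primroot p) < 620 * sqrt p" by (rule least_primroot_lt_620_sqrt[OF assms(6)])
  also have "\<dots> \<le> real p powr \<alpha>"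
    by (rule mult_sqrt_le_powr[OF less_imp_le[OF assms(7)] _ _ power_620_le_mult_power_10[OF assms(1,2), folded assms(5)]])
      (use assms(3-5) in simp_all)
  finally show ?thesis .
qed

theorem theorem5:
  fixes p :: nat and \<alpha> p\<^sub>\<alpha> :: real
  assumes "(\<alpha>, p\<^sub>\<alpha>) \<in> set
    [(0.62, 1.91 * 10^23), (0.615, 1.97 * 10^24), (0.61, 2.47 * 10^25),
     (0.605, 4.00 * 10^26), (0.6, 8.52 * 10^27), (0.595, 2.53 * 10^29),
     (0.59, 1.09 * 10^31), (0.585, 7.24 * 10^32), (0.58, 8.21 * 10^34),
     (0.575, 1.77 * 10^37), (0.57, 7.98 * 10^39), (0.565, 9.42 * 10^42),
     (0.56, 3.57 * 10^46), (0.555, 6.08 * 10^50), (0.55, 7.27 * 10^55)]"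
    and "prime p"
    and "real p > p\<^sub>\<alpha>"
  shows "real (least_primroot p) < real p powr \<alpha>"
proof -
  note bound = least_primroot_lt_powr[OF _ _ _ _ _ assms(2,3)]
  show ?thesis
    using assms(1) unfolding set_simps insert_iff empty_iff prod.inject
  proof (elim disjE conjE, goal_cases)
    \<comment> \<open>In each case \<open>c * 10^e\<close> is the threshold with integral mantissa,
      \<open>a = 200 * (\<alpha> - 1/2)\<close> and \<open>j = 555 - e * a\<close>.\<close>
    case 1 show ?case by (rule bound[where j = 51 and c = 191 and a = 24 and e = 21]) (use 1 in simp_all)
  next case 2 show ?case by (rule bound[where j = 49 and c = 197 and a = 23 and e = 22]) (use 2 in simp_all)
  next case 3 show ?case by (rule bound[where j = 49 and c = 247 and a = 22 and e = 23]) (use 3 in simp_all)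
  next case 4 show ?case by (rule bound[where j = 51 and c = 400 and a = 21 and e = 24]) (use 4 in simp_all)
  next case 5 show ?case by (rule bound[where j = 55 and c = 852 and a = 20 and e = 25]) (use 5 in simp_all)
  next case 6 show ?case by (rule bound[where j = 42 and c = 253 and a = 19 and e = 27]) (use 6 in simp_all)
  next case 7 show ?case by (rule bound[where j = 33 and c = 109 and a = 18 and e = 29]) (use 7 in simp_all)
  next case 8 show ?case by (rule bound[where j = 45 and c = 724 and a = 17 and e = 30]) (use 8 in simp_all)
  next case 9 show ?case by (rule bound[where j = 43 and c = 821 and a = 16 and e = 32]) (use 9 in simp_all)
  next case 10 show ?case by (rule bound[where j = 30 and c = 177 and a = 15 and e = 35]) (use 10 in simp_all)
  next case 11 show ?case by (rule bound[where j = 37 and c = 798 and a = 14 and e = 37]) (use 11 in simp_all)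
  next case 12 show ?case by (rule bound[where j = 35 and c = 942 and a = 13 and e = 40]) (use 12 in simp_all)
  next case 13 show ?case by (rule bound[where j = 27 and c = 357 and a = 12 and e = 44]) (use 13 in simp_all)
  next case 14 show ?case by (rule bound[where j = 27 and c = 608 and a = 11 and e = 48]) (use 14 in simp_all)
  next case 15 show ?case by (rule bound[where j = 25 and c = 727 and a = 10 and e = 53]) (use 15 in simp_all)
  qed simp
qed

end
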